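(* Let $X$ be a Polish space, $E$ an analytic equivalence relation on $X$, and $(E_n)_{n\in\mathbb N}$ a sequence of Borel subequivalence relations of $E$. Then exactly one of the following holds: (1) there is a cover $(B_n)_{n\in\mathbb N}$ of $X$ such that, for every $n$, $B_n$ is an $E_n$-invariant Borel set on which $E$ has countable index over $E_n$; (2) there is a continuous map $\phi\colon(2^{\mathbb N})^{\mathbb N}\to X$ such that for every $n\in\mathbb N$, $\phi$ is a homomorphism from $\mathbb{E}_1\setminus F_0^n$ to $E\setminus\bigcup_{i\le n}E_i$.
   Context: For $n\in\mathbb N$, $F_0^n$ is the equivalence relation on $(2^{\mathbb N})^{\mathbb N}$ given by $x\mathrel{F_0^n}y\iff\forall l\ge n\ x(l)=y(l)$, and $\mathbb{E}_1=\bigcup_nF_0^n$. A homomorphism from $R$ to $S$ is a map $\phi$ with $(\phi\times\phi)[R]\subseteq S$. $E$ has countable index over $E_n$ on a set $B$ if every $(E\restriction B)$-class is a countable union of $(E_n\restriction B)$-classes, where $R\restriction B=R\cap(B\times B)$. *)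

theory Defs
  imports "HOL-Analysis.Analysis"
begin

text \<open>Binary relations are sets of pairs, as in \<open>HOL.Relation\<close>. Cantor space \<open>2\<^sup>\<nat>\<close> is the type
  \<open>nat \<Rightarrow> bool\<close> and Baire space \<open>\<nat>\<^sup>\<nat>\<close> is \<open>nat \<Rightarrow> nat\<close>; the library topology on these function types is
  the product of the discrete topologies.\<close>

definition F0 :: "nat \<Rightarrow> ((nat \<Rightarrow> nat \<Rightarrow> bool) \<times> (nat \<Rightarrow> nat \<Rightarrow> bool)) set" where
  "F0 n = {(x, y). \<forall>l\<ge>n. x l = y l}"

definition EE1 :: "((nat \<Rightarrow> nat \<Rightarrow> bool) \<times> (nat \<Rightarrow> nat \<Rightarrow> bool)) set" where
  "EE1 = (\<Union>n. F0 n)"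

text \<open>Analytic sets are the continuous images of closed subsets of Baire space. Allowing closed
  subsets rather than only the whole space makes the empty set analytic.\<close>

definition analytic_set :: "'a::topological_space set \<Rightarrow> bool" where
  "analytic_set A \<longleftrightarrow>
    (\<exists>(C :: (nat \<Rightarrow> nat) set) f. closed C \<and> continuous_on C f \<and> f ` C = A)"

definition rel_homomorphism :: "('a \<times> 'a) set \<Rightarrow> ('b \<times> 'b) set \<Rightarrow> ('a \<Rightarrow> 'b) \<Rightarrow> bool" where
  "rel_homomorphism R S \<phi> \<longleftrightarrow> map_prod \<phi> \<phi> ` R \<subseteq> S"

definition rel_restrict :: "('a \<times> 'a) set \<Rightarrow> 'a set \<Rightarrow> ('a \<times> 'a) set" where
  "rel_restrict R B = R \<inter> (B \<times> B)"

definition invariant_set :: "('a \<times> 'a) set \<Rightarrow> 'a set \<Rightarrow> bool" where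
  "invariant_set R B \<longleftrightarrow> (\<forall>x y. x \<in> B \<longrightarrow> (x, y) \<in> R \<longrightarrow> y \<in> B)"

definition countable_index_on :: "('a \<times> 'a) set \<Rightarrow> ('a \<times> 'a) set \<Rightarrow> 'a set \<Rightarrow> bool" where
  "countable_index_on E F B \<longleftrightarrow>
    (\<forall>C \<in> B // rel_restrict E B.
      \<exists>\<D>. countable \<D> \<and> \<D> \<subseteq> B // rel_restrict F B \<and> C = \<Union>\<D>)"

end

theory Submission
  imports Defs
begin

text \<open>Call a set null if it is a countable union of Borel sets, each invariant under some \<open>En i\<close> and meeting
  every \<open>E\<close>-class in countably many \<open>En i\<close>-classes. If \<open>X\<close> is null, grouping by \<open>i\<close> gives the cover.
  Otherwise one builds a continuous map on \<open>2\<^sup>\<nat>\<close>, whose coordinates are distributed over infinitely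
  many rows, as in the proof of the \<open>G\<^sub>0\<close> dichotomy: along the coordinates of row \<open>p\<close> a dense set of edges
  is sent outside \<open>En 0, \<dots>, En p\<close>, while paths of links inside \<open>E\<close> keep points \<open>E\<close>-equivalent when their
  rows agree from some row on. A stage \<open>K\<close> approximation stays extendable because it is large for a
  game of height \<open>K\<close> even after any null set is removed. A Mycielski argument then turns the dense edges
  into inequivalence of all pairs that differ.

  The alternatives exclude each other: one of the preimages of the sets of a cover is comeager in some
  open box, and a Mycielski set in it varying only in row \<open>n\<close> gives uncountably many \<open>En n\<close>-classes in one
  \<open>E\<close>-class.\<close>

section \<open>Analytic sets\<close>

text \<open>Two obstacles shape the construction. Stage \<open>K\<close> may open the row
  \<open>K\<close>, so the height of the game has to grow with the stage, and any failure to grow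
  must be charged to a null set; minimal heavy cells serve this purpose. To enclose their leaves in
  a Borel null set, these leaves must form an analytic set, although liveness quantifies over all
  countable families. The way out is to run the tree construction once more: a position is live
  exactly when its upper data extend to a code of a whole tree, and such codes form a closed set. A
  frame is abstract because it is used three times: here, for covering by thin sets, and for the
  final map. The other delicate point is that countability is needed over each
  \<open>E\<close>-class, whereas different cells may be live at unrelated starting positions.
  Freely replaceable tails of paths bring all cells over one class to a common position.\<close>

lemma continuous_on_coord: "continuous_on S (\<lambda>x :: 'i \<Rightarrow> 'b::topological_space. x i)"
  by (rule continuous_on_subset[OF continuous_on_product_coordinates]) simp

lemma continuous_on_comp_index:
  "continuous_on S (\<lambda>x. (\<lambda>j. (x::'i \<Rightarrow> 'b::topological_space) (h j)))"
  by (intro continuous_on_coordinatewise_then_product continuous_on_coord)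

lemma closed_agree:
  fixes u v :: "'a::topological_space \<Rightarrow> 'b::t2_space"
  assumes "closed K" "continuous_on K u" "continuous_on K v"
  shows "closed {x\<in>K. u x = v x}"
proof -
  have "closed (K \<inter> (\<lambda>x. (u x, v x)) -` {p. fst p = snd p})"
  proof (rule continuous_closed_preimage)
    show "continuous_on K (\<lambda>x. (u x, v x))" by (intro continuous_on_Pair assms)
    have "{p::'b\<times>'b. fst p = snd p} = {y. \<exists>x. y = (x,x)}" by auto
    then show "closed {p::'b\<times>'b. fst p = snd p}" using closed_diagonal by simp
  qed (use assms in auto)
  moreover have "K \<inter> (\<lambda>x. (u x, v x)) -` {p. fst p = snd p} = {x\<in>K. u x = v x}" by auto
  ultimately show ?thesis by simp
qed

lemma closed_pre:
  assumes "closed K" "closed D" "continuous_on K u"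
  shows "closed {x\<in>K. u x \<in> D}"
proof -
  have "closed (K \<inter> u -` D)" by (rule continuous_closed_preimage) (use assms in auto)
  then show ?thesis by (simp add: vimage_def Int_def)
qed

lemma continuous_on_locally:
  assumes "\<And>x. x \<in> K \<Longrightarrow> open (U x)" "\<And>x. x \<in> K \<Longrightarrow> x \<in> U x"
    and "\<And>x. x \<in> K \<Longrightarrow> continuous_on (K \<inter> U x) f"
  shows "continuous_on K f"
  unfolding continuous_on_def
proof
  fix x assume "x \<in> K"
  then have "(f \<longlongrightarrow> f x) (at x within (K \<inter> U x))"
    using assms by (auto simp: continuous_on_def)
  moreover have "at x within (K \<inter> U x) = at x within K"
    by (rule at_within_nhd[of _ "U x"]) (use assms \<open>x \<in> K\<close> in auto)
  ultimately show "(f \<longlongrightarrow> f x) (at x within K)" by simp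
qed

lemma analytic_setI:
  "closed (C :: (nat \<Rightarrow> nat) set) \<Longrightarrow> continuous_on C f \<Longrightarrow> f ` C = A \<Longrightarrow> analytic_set A"
  by (auto simp: analytic_set_def)

lemma analytic_setE:
  assumes "analytic_set A"
  obtains C f where "closed (C :: (nat \<Rightarrow> nat) set)" "continuous_on C f" "f ` C = A"
  using assms by (auto simp: analytic_set_def)

lemma analytic_image:
  assumes "analytic_set A" "continuous_on A g"
  shows "analytic_set (g ` A)"
proof -
  obtain C f where C: "closed (C :: (nat \<Rightarrow> nat) set)" "continuous_on C f" "f ` C = A"
    using assms(1) by (rule analytic_setE)
  have "continuous_on C (g \<circ> f)" using C assms(2) continuous_on_compose by blast
  then show ?thesis using C by (intro analytic_setI[of C "g \<circ> f"]) (auto simp: image_comp[symmetric])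
qed

lemma analytic_closed_subset:
  assumes "analytic_set (UNIV :: 'a::topological_space set)" "closed (S :: 'a set)"
  shows "analytic_set S"
proof -
  obtain C f where C: "closed (C :: (nat \<Rightarrow> nat) set)" "continuous_on C f" "f ` C = (UNIV::'a set)"
    using assms(1) by (rule analytic_setE)
  have "closed {x\<in>C. f x \<in> S}" by (rule closed_pre) (use C assms in auto)
  moreover have "continuous_on {x\<in>C. f x \<in> S} f" using C(2) continuous_on_subset by fastforce
  moreover have "f ` {x\<in>C. f x \<in> S} = S" using C(3) by (auto simp: set_eq_iff image_iff) (metis UNIV_I)
  ultimately show ?thesis by (rule analytic_setI)
qed

lemma analytic_UNIV_fun: "analytic_set (UNIV :: ('j::countable \<Rightarrow> nat) set)"
proof (rule analytic_setI[of UNIV "\<lambda>x j. x (to_nat j)"])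
  show "range (\<lambda>x j. x (to_nat (j::'j))) = (UNIV :: ('j \<Rightarrow> nat) set)"
  proof (intro equalityI subsetI, simp)
    fix y :: "'j \<Rightarrow> nat"
    have "y = (\<lambda>x j. x (to_nat j)) (y \<circ> from_nat)" by (simp add: fun_eq_iff)
    then show "y \<in> range (\<lambda>x j. x (to_nat (j::'j)))" by blast
  qed
qed (auto intro: continuous_on_comp_index)

lemma analytic_closed_fun: "closed (S :: ('j::countable \<Rightarrow> nat) set) \<Longrightarrow> analytic_set S"
  by (rule analytic_closed_subset[OF analytic_UNIV_fun])

lemma analytic_UNIV_fun2: "analytic_set (UNIV :: ('i::countable \<Rightarrow> 'j::countable \<Rightarrow> nat) set)"
proof -
  let ?g = "\<lambda>(x :: 'i \<times> 'j \<Rightarrow> nat) i j. x (i, j)"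
  have "analytic_set (?g ` UNIV)"
    by (intro analytic_image analytic_UNIV_fun continuous_on_coordinatewise_then_product
        continuous_on_coord)
  moreover have "?g ` UNIV = UNIV"
  proof (intro equalityI subsetI, simp)
    fix y :: "'i \<Rightarrow> 'j \<Rightarrow> nat"
    have "y = ?g (\<lambda>(i, j). y i j)" by simp
    then show "y \<in> range ?g" by blast
  qed
  ultimately show ?thesis by simp
qed

lemma analytic_closed_fun2:
  "closed (S :: ('i::countable \<Rightarrow> 'j::countable \<Rightarrow> nat) set) \<Longrightarrow> analytic_set S"
  by (rule analytic_closed_subset[OF analytic_UNIV_fun2])

lemma analytic_empty [simp]: "analytic_set {}"
  by (rule analytic_setI[of "{}" undefined]) auto

text \<open>A code interleaves a code \<open>c\<close> of a point of \<open>A\<close> with a code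
  \<open>d\<close> of its image. The condition \<open>l (g c) = h d\<close> is closed because the
  target is Hausdorff.\<close>

lemma analytic_preimage:
  fixes l :: "'a::topological_space \<Rightarrow> 'b::t2_space"
  assumes "analytic_set A" "continuous_on A l" "analytic_set U"
  shows "analytic_set {a\<in>A. l a \<in> U}"
proof -
  obtain C g where C: "closed (C :: (nat \<Rightarrow> nat) set)" "continuous_on C g" "g ` C = A"
    using assms(1) by (rule analytic_setE)
  obtain D h where D: "closed (D :: (nat \<Rightarrow> nat) set)" "continuous_on D h" "h ` D = U"
    using assms(3) by (rule analytic_setE)
  define ev where "ev = (\<lambda>(z :: nat \<Rightarrow> nat) n. z (2 * n))"
  define od where "od = (\<lambda>(z :: nat \<Rightarrow> nat) n. z (2 * n + 1))"
  have cont: "continuous_on S ev" "continuous_on S od" for S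
    unfolding ev_def od_def by (rule continuous_on_comp_index)+
  define K where "K = {z. ev z \<in> C \<and> od z \<in> D}"
  have "closed K"
  proof -
    have "closed {z\<in>UNIV. ev z \<in> C}" "closed {z\<in>UNIV. od z \<in> D}"
      by (rule closed_pre; use C D cont in auto)+
    then have "closed ({z\<in>UNIV. ev z \<in> C} \<inter> {z\<in>UNIV. od z \<in> D})" by (rule closed_Int)
    then show ?thesis by (simp add: K_def Collect_conj_eq)
  qed
  have "continuous_on K (g \<circ> ev)" "continuous_on K (h \<circ> od)"
    by (intro continuous_on_compose cont; rule continuous_on_subset[OF C(2)] continuous_on_subset[OF D(2)];
        auto simp: K_def)+
  then have "continuous_on K (l \<circ> (g \<circ> ev))"
    by (intro continuous_on_compose[OF \<open>continuous_on K (g \<circ> ev)\<close>] continuous_on_subset[OF assms(2)])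
      (use C in \<open>auto simp: K_def\<close>)
  define K' where "K' = {z\<in>K. (l \<circ> (g \<circ> ev)) z = (h \<circ> od) z}"
  have "closed K'" unfolding K'_def by (rule closed_agree) fact+
  moreover have "continuous_on K' (g \<circ> ev)"
    using \<open>continuous_on K (g \<circ> ev)\<close> by (rule continuous_on_subset) (auto simp: K'_def)
  moreover have "(g \<circ> ev) ` K' = {a\<in>A. l a \<in> U}"
  proof (intro equalityI subsetI)
    fix a assume "a \<in> (g \<circ> ev) ` K'"
    then show "a \<in> {a\<in>A. l a \<in> U}" using C(3) D(3) by (auto simp: K'_def K_def)
  next
    fix a assume "a \<in> {a\<in>A. l a \<in> U}"
    then obtain c d where "c \<in> C" "g c = a" "d \<in> D" "h d = l a" using C(3) D(3) by force
    define z where "z = (\<lambda>n. if even n then c (n div 2) else d (n div 2))"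
    have "ev z = c" "od z = d" by (auto simp: ev_def od_def z_def)
    then have "z \<in> K'" using \<open>c \<in> C\<close> \<open>d \<in> D\<close> \<open>g c = a\<close> \<open>h d = l a\<close> by (auto simp: K'_def K_def)
    then show "a \<in> (g \<circ> ev) ` K'" using \<open>ev z = c\<close> \<open>g c = a\<close> by force
  qed
  ultimately show ?thesis by (rule analytic_setI)
qed

lemma analytic_Int:
  fixes A B :: "'a::t2_space set"
  assumes "analytic_set A" "analytic_set B"
  shows "analytic_set (A \<inter> B)"
  using analytic_preimage[OF assms(1) continuous_on_id assms(2)] by (simp add: Int_def)

text \<open>One code lists codes for all the sets at once, subject to the closed requirement that
  they name the same point.\<close>

lemma analytic_INT:
  fixes A :: "nat \<Rightarrow> 'a::t2_space set"
  assumes "\<And>n. analytic_set (A n)"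
  shows "analytic_set (\<Inter>n. A n)"
proof -
  have "\<forall>n. \<exists>C f. closed (C :: (nat \<Rightarrow> nat) set) \<and> continuous_on C f \<and> f ` C = A n"
    using assms by (simp add: analytic_set_def)
  then obtain C g where C: "\<And>n. closed (C n :: (nat \<Rightarrow> nat) set)" "\<And>n. continuous_on (C n) (g n)"
    "\<And>n. g n ` C n = A n" by metis
  define pr where "pr = (\<lambda>n (z :: nat \<Rightarrow> nat) m. z (prod_encode (n, m)))"
  have cont: "continuous_on S (pr n)" for S n unfolding pr_def by (rule continuous_on_comp_index)
  define K where "K = (\<Inter>n. {z\<in>UNIV. pr n z \<in> C n})"
  have "closed K" unfolding K_def by (intro closed_INT ballI closed_pre C cont) auto
  have cg: "continuous_on K (g n \<circ> pr n)" for n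
    by (intro continuous_on_compose cont continuous_on_subset[OF C(2)]) (auto simp: K_def)
  define K' where "K' = (\<Inter>n. {z\<in>K. (g n \<circ> pr n) z = (g 0 \<circ> pr 0) z})"
  have "closed K'" unfolding K'_def by (intro closed_INT ballI closed_agree \<open>closed K\<close> cg)
  moreover have "continuous_on K' (g 0 \<circ> pr 0)"
    using cg by (rule continuous_on_subset) (auto simp: K'_def)
  moreover have "(g 0 \<circ> pr 0) ` K' = (\<Inter>n. A n)"
  proof (intro equalityI subsetI)
    fix a assume "a \<in> (g 0 \<circ> pr 0) ` K'"
    then obtain z where z: "z \<in> K'" "a = g 0 (pr 0 z)" by auto
    have "a \<in> A n" for n
    proof -
      have "g n (pr n z) = a" "pr n z \<in> C n" using z by (auto simp: K'_def K_def)
      then show ?thesis using C(3) by blast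
    qed
    then show "a \<in> (\<Inter>n. A n)" by auto
  next
    fix a assume a: "a \<in> (\<Inter>n. A n)"
    then have "\<forall>n. \<exists>c\<in>C n. g n c = a" using C(3) by force
    then obtain c where c: "\<And>n. c n \<in> C n" "\<And>n. g n (c n) = a" by metis
    define z where "z = (\<lambda>k. case prod_decode k of (n, m) \<Rightarrow> c n m)"
    have "pr n z = c n" for n by (auto simp: pr_def z_def)
    then have "z \<in> K'" "(g 0 \<circ> pr 0) z = a" using c by (auto simp: K'_def K_def)
    then show "a \<in> (g 0 \<circ> pr 0) ` K'" by blast
  qed
  ultimately show ?thesis by (rule analytic_setI)
qed

text \<open>The first entry of a code selects the set, and the rest codes a point of it. The sets
  with a fixed first entry are open, so closedness and continuity may be checked on each of
  them.\<close>

lemma analytic_UN: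
  fixes A :: "nat \<Rightarrow> 'a::topological_space set"
  assumes "\<And>n. analytic_set (A n)"
  shows "analytic_set (\<Union>n. A n)"
proof -
  have "\<forall>n. \<exists>C f. closed (C :: (nat \<Rightarrow> nat) set) \<and> continuous_on C f \<and> f ` C = A n"
    using assms by (simp add: analytic_set_def)
  then obtain C g where C: "\<And>n. closed (C n :: (nat \<Rightarrow> nat) set)" "\<And>n. continuous_on (C n) (g n)"
    "\<And>n. g n ` C n = A n" by metis
  define tl where "tl = (\<lambda>(z :: nat \<Rightarrow> nat) m. z (Suc m))"
  have ct: "continuous_on S tl" for S unfolding tl_def by (rule continuous_on_comp_index)
  define U where "U = (\<lambda>n. {z :: nat \<Rightarrow> nat. z 0 = n})"
  have "open (U n)" for n
  proof -
    have "open ((\<lambda>z :: nat \<Rightarrow> nat. z 0) -` {n})"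
      by (rule open_vimage[OF open_discrete]) (intro continuous_on_coord)
    then show ?thesis by (simp add: U_def vimage_def)
  qed
  define K where "K = {z. tl z \<in> C (z 0)}"
  have "closed K"
  proof -
    have "open {z\<in>U n. tl z \<notin> C n}" for n
    proof -
      have "open (U n \<inter> tl -` (- C n))"
        by (intro open_Int \<open>open (U n)\<close> open_vimage ct) (use C in auto)
      then show ?thesis by (simp add: vimage_def Int_def)
    qed
    then have "open (\<Union>n. {z\<in>U n. tl z \<notin> C n})" by blast
    moreover have "(\<Union>n. {z\<in>U n. tl z \<notin> C n}) = - K" by (auto simp: U_def K_def)
    ultimately show ?thesis by (simp add: closed_def)
  qed
  moreover have "continuous_on K (\<lambda>z. g (z 0) (tl z))"
  proof -
    have "continuous_on (K \<inter> U n) (\<lambda>z. g (z 0) (tl z))" for n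
    proof -
      have "continuous_on (K \<inter> U n) (g n \<circ> tl)"
        by (intro continuous_on_compose ct continuous_on_subset[OF C(2)]) (auto simp: K_def U_def)
      then show ?thesis by (rule continuous_on_eq) (auto simp: U_def)
    qed
    note pieces = this
    show ?thesis
    proof (rule continuous_on_locally[where U = "\<lambda>z. U (z 0)"])
      show "open (U (x 0))" for x :: "nat \<Rightarrow> nat" by fact
      show "x \<in> U (x 0)" for x by (simp add: U_def)
      show "continuous_on (K \<inter> U (x 0)) (\<lambda>z. g (z 0) (tl z))" for x :: "nat \<Rightarrow> nat" by (rule pieces)
    qed
  qed
  moreover have "(\<lambda>z. g (z 0) (tl z)) ` K = (\<Union>n. A n)"
  proof (intro equalityI subsetI)
    fix a assume "a \<in> (\<lambda>z. g (z 0) (tl z)) ` K"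
    then show "a \<in> (\<Union>n. A n)" using C(3) by (auto simp: K_def)
  next
    fix a assume "a \<in> (\<Union>n. A n)"
    then obtain n where "a \<in> g n ` C n" using C(3) by auto
    then obtain c where "c \<in> C n" "g n c = a" by auto
    define z where "z = (\<lambda>k. case k of 0 \<Rightarrow> n | Suc m \<Rightarrow> c m)"
    have "z 0 = n" "tl z = c" by (auto simp: z_def tl_def)
    then have "z \<in> K" "g (z 0) (tl z) = a" using \<open>c \<in> C n\<close> \<open>g n c = a\<close> by (auto simp: K_def)
    then show "a \<in> (\<lambda>z. g (z 0) (tl z)) ` K" by blast
  qed
  ultimately show ?thesis by (rule analytic_setI)
qed

lemma analytic_Un:
  assumes "analytic_set A" "analytic_set B"
  shows "analytic_set (A \<union> B)"
proof -
  have "analytic_set (\<Union>n::nat. if n = 0 then A else B)"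
    by (rule analytic_UN) (use assms in auto)
  moreover have "(\<Union>n::nat. if n = 0 then A else B) = A \<union> B"
    by (auto split: if_splits)
  ultimately show ?thesis by simp
qed

lemma analytic_finite_preimages:
  fixes l :: "'t \<Rightarrow> 'b::topological_space \<Rightarrow> 'y::t2_space"
  assumes A: "analytic_set A"
    and "finite L" "\<And>t. t \<in> L \<Longrightarrow> continuous_on A (l t)" "\<And>t. t \<in> L \<Longrightarrow> analytic_set (V t)"
  shows "analytic_set {x\<in>A. \<forall>t\<in>L. l t x \<in> V t}"
  using assms(2-)
proof (induction L)
  case empty
  show ?case using A by simp
next
  case (insert t L)
  let ?S = "{x\<in>A. \<forall>t\<in>L. l t x \<in> V t}"
  have "continuous_on ?S (l t)" by (rule continuous_on_subset[OF insert.prems(1)]) auto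
  with insert have "analytic_set {x\<in>?S. l t x \<in> V t}" by (intro analytic_preimage) auto
  moreover have "{x\<in>?S. l t x \<in> V t} = {x\<in>A. \<forall>t\<in>insert t L. l t x \<in> V t}" by auto
  ultimately show ?case by simp
qed

section \<open>Polish spaces and their Borel sets\<close>

instance prod :: (polish_space, polish_space) polish_space ..

text \<open>A point is coded by indices into a countable dense set whose consecutive distances are
  at most \<open>(1/2)^n\<close>. The set of codes is closed and the convergence on it is uniform,
  so the limit is continuous.\<close>

lemma analytic_UNIV_polish: "analytic_set (UNIV :: 'a::polish_space set)"
proof -
  obtain S :: "'a set" where S: "countable S" "\<And>X. open X \<Longrightarrow> X \<noteq> {} \<Longrightarrow> \<exists>s\<in>S. s \<in> X"
    using countable_dense_exists[where 'a='a] by blast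
  have "S \<noteq> {}" using S(2)[of UNIV] by auto
  then obtain d :: "nat \<Rightarrow> 'a" where d: "range d = S"
    using S(1) by (metis range_from_nat_into)
  have dense: "\<exists>n. dist y (d n) < e" if "e > 0" for y e
  proof -
    have "ball y e \<noteq> {}" using that by simp
    then obtain s where "s \<in> S" "s \<in> ball y e" using S(2)[OF open_ball] by blast
    then show ?thesis using d by (auto simp: image_iff)
  qed
  define C where "C = (\<Inter>n. {x :: nat \<Rightarrow> nat. dist (d (x n)) (d (x (Suc n))) \<le> (1/2)^n})"
  have cd: "continuous_on T (\<lambda>x :: nat \<Rightarrow> nat. d (x n))" for T n
  proof -
    have "continuous_on T (d \<circ> (\<lambda>x. x n))"
      by (intro continuous_on_compose continuous_on_coord Topological_Spaces.continuous_on_discrete)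
    then show ?thesis by (simp add: o_def)
  qed
  have "closed C" unfolding C_def
    by (intro closed_INT ballI closed_Collect_le continuous_on_dist cd continuous_on_const)
  have far: "dist (d (x n)) (d (x (n + k))) \<le> 2 * (1/2)^n - 2 * (1/2)^(n + k)" if "x \<in> C" for x n k
  proof (induction k)
    case (Suc k)
    have "dist (d (x (n + k))) (d (x (Suc (n + k)))) \<le> (1/2)^(n + k)" using that by (auto simp: C_def)
    then have "dist (d (x n)) (d (x (n + Suc k))) \<le> dist (d (x n)) (d (x (n + k))) + (1/2)^(n + k)"
      using dist_triangle[of "d (x n)" "d (x (Suc (n + k)))" "d (x (n + k))"] by simp
    then show ?case using Suc by simp
  qed simp
  then have far': "dist (d (x n)) (d (x (n + k))) \<le> 2 * (1/2)^n" if "x \<in> C" for x n k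
    using that by (smt (verit) zero_le_power divide_nonneg_nonneg)
  have cauchy: "Cauchy (\<lambda>n. d (x n))" if "x \<in> C" for x
  proof (rule metric_CauchyI)
    fix e :: real assume "e > 0"
    then obtain N where N: "(1/2)^N < e / 4" using real_arch_pow_inv[of "e/4" "1/2"] by auto
    have "dist (d (x m)) (d (x n)) < e" if "m \<ge> N" "n \<ge> N" for m n
    proof -
      have "dist (d (x N)) (d (x m)) \<le> 2 * (1/2)^N" "dist (d (x N)) (d (x n)) \<le> 2 * (1/2)^N"
        using far'[OF \<open>x \<in> C\<close>, of N "m - N"] far'[OF \<open>x \<in> C\<close>, of N "n - N"] that by auto
      then show ?thesis using N dist_triangle3[of "d (x m)" "d (x n)" "d (x N)"] by linarith
    qed
    then show "\<exists>M. \<forall>m\<ge>M. \<forall>n\<ge>M. dist (d (x m)) (d (x n)) < e" by blast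
  qed
  define f where "f x = lim (\<lambda>n. d (x n))" for x
  have lim: "(\<lambda>n. d (x n)) \<longlonglongrightarrow> f x" if "x \<in> C" for x
    unfolding f_def using cauchy[OF that] Cauchy_convergent convergent_LIMSEQ_iff by blast
  have fdist: "dist (d (x n)) (f x) \<le> 2 * (1/2)^n" if "x \<in> C" for x n
  proof (rule LIMSEQ_le_const2)
    show "(\<lambda>k. dist (d (x n)) (d (x (k + n)))) \<longlonglongrightarrow> dist (d (x n)) (f x)"
      by (intro tendsto_intros LIMSEQ_ignore_initial_segment lim that)
    show "\<exists>N. \<forall>k\<ge>N. dist (d (x n)) (d (x (k + n))) \<le> 2 * (1/2)^n"
      using far'[OF that, of n] by (auto simp: add.commute)
  qed
  have "continuous_on C f"
  proof (rule uniform_limit_theorem[of _ "\<lambda>n x. d (x n)" sequentially])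
    show "\<forall>\<^sub>F n in sequentially. continuous_on C (\<lambda>x. d (x n))" using cd by simp
    show "uniform_limit C (\<lambda>n x. d (x n)) f sequentially"
    proof (rule uniform_limitI)
      fix e :: real assume "e > 0"
      then obtain N where N: "(1/2)^N < e / 2" using real_arch_pow_inv[of "e/2" "1/2"] by auto
      show "\<forall>\<^sub>F n in sequentially. \<forall>x\<in>C. dist (d (x n)) (f x) < e"
      proof (rule eventually_sequentiallyI[of N], intro ballI)
        fix n x assume "N \<le> n" "x \<in> C"
        have "(1/2::real)^n \<le> (1/2)^N" using \<open>N \<le> n\<close> by (intro power_decreasing) auto
        then show "dist (d (x n)) (f x) < e" using fdist[OF \<open>x \<in> C\<close>, of n] N by linarith
      qed
    qed
  qed simp
  moreover have "f ` C = UNIV"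
  proof (intro equalityI subsetI, simp)
    fix y :: 'a
    \<comment> \<open>The halved radius leaves room for the triangle inequality: entries
      \<open>n\<close> and \<open>Suc n\<close> are then within \<open>(1/2)^n\<close> of each
      other.\<close>
    have "\<forall>n. \<exists>k. dist y (d k) < (1/2)^n / 2" by (intro allI dense) simp
    then obtain x where x: "\<And>n. dist y (d (x n)) < (1/2)^n / 2" by metis
    have "x \<in> C" unfolding C_def
    proof (intro INT_I CollectI)
      fix n
      have "(1/2::real)^n > 0" by simp
      then show "dist (d (x n)) (d (x (Suc n))) \<le> (1/2)^n"
        using x[of n] x[of "Suc n"] dist_triangle3[of "d (x n)" "d (x (Suc n))" y]
        by (simp only: power_Suc)
    qed
    moreover have "(\<lambda>n. d (x n)) \<longlonglongrightarrow> y"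
    proof (rule metric_LIMSEQ_I)
      fix e :: real assume "e > 0"
      then obtain N where N: "(1/2)^N < e" using real_arch_pow_inv[of e "1/2"] by auto
      have "dist (d (x n)) y < e" if "n \<ge> N" for n
      proof -
        have "(1/2::real)^n \<le> (1/2)^N" using that by (intro power_decreasing) auto
        moreover have "(1/2::real)^n > 0" by simp
        ultimately show ?thesis using x[of n] N dist_commute[of y "d (x n)"] by linarith
      qed
      then show "\<exists>no. \<forall>n\<ge>no. dist (d (x n)) y < e" by blast
    qed
    ultimately show "y \<in> f ` C" using lim LIMSEQ_unique by blast
  qed
  ultimately show ?thesis using \<open>closed C\<close> by (intro analytic_setI[of C f])
qed

text \<open>Analyticity does not pass to complements, so the induction carries a set and its
  complement together. The complement of a closed set is written as a countable union of closed sets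
  by means of \<open>infdist\<close>.\<close>

lemma analytic_borel:
  assumes "A \<in> sets (borel :: 'a::polish_space measure)"
  shows "analytic_set A"
proof -
  have cl: "analytic_set S" if "closed S" for S :: "'a set"
    by (rule analytic_closed_subset[OF analytic_UNIV_polish that])
  have "A \<in> sigma_sets UNIV {S. closed S}"
    using assms by (simp add: borel_eq_closed)
  then have "analytic_set A \<and> analytic_set (- A)"
  proof induction
    case (Basic S)
    have "analytic_set (- S)"
    proof -
      show ?thesis
      proof (cases "S = {}")
        case True
        then show ?thesis using analytic_UNIV_polish by simp
      next
        case False
        have "- S = (\<Union>n. {x. 1 / real (Suc n) \<le> infdist x S})"
        proof (intro equalityI subsetI)
          fix x assume "x \<in> - S"
          then have "infdist x S > 0"
            using in_closed_iff_infdist_zero[of S x] Basic False infdist_nonneg[of x S] by force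
          then obtain n where "1 / real (Suc n) < infdist x S" using nat_approx_posE by blast
          then show "x \<in> (\<Union>n. {x. 1 / real (Suc n) \<le> infdist x S})" by (auto intro: less_imp_le)
        next
          fix x assume "x \<in> (\<Union>n. {x. 1 / real (Suc n) \<le> infdist x S})"
          then have "infdist x S > 0" by (auto intro: less_le_trans[rotated])
          then show "x \<in> - S" using infdist_zero[of x S] by force
        qed
        moreover have "closed {x. 1 / real (Suc n) \<le> infdist x S}" for n
          by (intro closed_Collect_le continuous_intros)
        ultimately show ?thesis using analytic_UN[of "\<lambda>n. {x. 1 / real (Suc n) \<le> infdist x S}"] cl by simp
      qed
    qed
    then show ?case using cl Basic by auto
  next
    case Empty
    then show ?case using analytic_UNIV_polish by simp
  next
    case (Compl a)
    then show ?case by (simp add: Compl_eq_Diff_UNIV[symmetric])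
  next
    case (Union a)
    then show ?case using analytic_UN[of a] analytic_INT[of "\<lambda>n. - a n"] by simp
  qed
  then show ?thesis by simp
qed

lemma analytic_Times:
  fixes A :: "'a::polish_space set" and B :: "'b::polish_space set"
  assumes "analytic_set A" "analytic_set B"
  shows "analytic_set (A \<times> B)"
proof -
  have "analytic_set {p\<in>(UNIV::('a\<times>'b) set). fst p \<in> A}"
    by (rule analytic_preimage[OF analytic_UNIV_polish _ assms(1), where l = fst]) (intro continuous_on_fst continuous_on_id)
  moreover have "analytic_set {p\<in>(UNIV::('a\<times>'b) set). snd p \<in> B}"
    by (rule analytic_preimage[OF analytic_UNIV_polish _ assms(2), where l = snd]) (intro continuous_on_snd continuous_on_id)
  ultimately have "analytic_set ({p\<in>UNIV. fst p \<in> A} \<inter> {p\<in>(UNIV::('a\<times>'b) set). snd p \<in> B})" by (rule analytic_Int)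
  moreover have "{p\<in>UNIV. fst p \<in> A} \<inter> {p\<in>(UNIV::('a\<times>'b) set). snd p \<in> B} = A \<times> B" by auto
  ultimately show ?thesis by simp
qed

section \<open>Separation of analytic sets\<close>

definition borel_separated :: "'a::topological_space set \<Rightarrow> 'a set \<Rightarrow> bool" where
  "borel_separated A B \<longleftrightarrow> (\<exists>S\<in>sets borel. A \<subseteq> S \<and> S \<inter> B = {})"

lemma borel_separated_UN_left:
  assumes "\<And>n::nat. borel_separated (A n) B" shows "borel_separated (\<Union>n. A n) B"
proof -
  obtain S where "\<And>n. S n \<in> sets borel" "\<And>n. A n \<subseteq> S n" "\<And>n. S n \<inter> B = {}"
    using assms unfolding borel_separated_def by metis
  then show ?thesis unfolding borel_separated_def by (intro bexI[of _ "\<Union>n. S n"]) (auto, blast)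
qed

lemma borel_separated_UN_right:
  assumes "\<And>n::nat. borel_separated A (B n)" shows "borel_separated A (\<Union>n. B n)"
proof -
  obtain S where "\<And>n. S n \<in> sets borel" "\<And>n. A \<subseteq> S n" "\<And>n. S n \<inter> B n = {}"
    using assms unfolding borel_separated_def by metis
  then show ?thesis unfolding borel_separated_def by (intro bexI[of _ "\<Inter>n. S n"]) (auto, blast+)
qed

definition cyl :: "(nat \<Rightarrow> nat) \<Rightarrow> nat \<Rightarrow> (nat \<Rightarrow> nat) set" where
  "cyl x n = {z. \<forall>i<n. z i = x i}"

lemma cyl_Suc_UN: "cyl x n = (\<Union>m. cyl (x(n := m)) (Suc n))"
proof (intro equalityI subsetI)
  fix z assume "z \<in> cyl x n"
  then have "z \<in> cyl (x(n := z n)) (Suc n)" by (auto simp: cyl_def less_Suc_eq)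
  then show "z \<in> (\<Union>m. cyl (x(n := m)) (Suc n))" by blast
next
  fix z assume "z \<in> (\<Union>m. cyl (x(n := m)) (Suc n))"
  then obtain m where m: "\<And>i. i < Suc n \<Longrightarrow> z i = (x(n := m)) i" by (auto simp: cyl_def)
  then show "z \<in> cyl x n" using m by (auto simp: cyl_def)
qed

lemma open_fun_nhd:
  fixes U :: "(nat \<Rightarrow> 'b::topological_space) set"
  assumes "open U" "z \<in> U"
  obtains n where "\<And>z'. (\<And>i. i < n \<Longrightarrow> z' i = z i) \<Longrightarrow> z' \<in> U"
proof -
  have "openin (product_topology (\<lambda>i. euclidean) UNIV) U"
    using assms(1) by (simp add: open_fun_def)
  then obtain X where X: "z \<in> (\<Pi>\<^sub>E i\<in>UNIV. X i)" "\<And>i. openin euclidean (X i)"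
    "finite {i. X i \<noteq> topspace euclidean}" "(\<Pi>\<^sub>E i\<in>UNIV. X i) \<subseteq> U"
    using product_topology_open_contains_basis[OF _ assms(2)] by blast
  define n where "n = Suc (Max (insert 0 {i. X i \<noteq> topspace euclidean}))"
  have n: "i < n" if "X i \<noteq> UNIV" for i
    using that X(3) by (simp add: n_def less_Suc_eq_le)
  have "z' \<in> U" if "\<And>i. i < n \<Longrightarrow> z' i = z i" for z'
  proof -
    have "z' i \<in> X i" for i
      using X(1) n[of i] that[of i] by (cases "X i = UNIV") (auto simp: PiE_iff)
    then have "z' \<in> (\<Pi>\<^sub>E i\<in>UNIV. X i)" by auto
    then show ?thesis by (rule subsetD[OF X(4)])
  qed
  then show ?thesis by (rule that)
qed

lemma open_cyl_nhd:
  assumes "open U" "x \<in> U" obtains n where "cyl x n \<subseteq> U"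
proof -
  obtain n where "\<And>z. (\<And>i. i < n \<Longrightarrow> z i = x i) \<Longrightarrow> z \<in> U"
    using open_fun_nhd[OF assms] by metis
  then have "cyl x n \<subseteq> U" by (auto simp: cyl_def)
  then show ?thesis by (rule that)
qed

text \<open>An inseparable pair of cylinders splits into countably many pairs, one of which is again
  inseparable. This yields branches \<open>a\<close> and \<open>b\<close> along which separation
  always fails, yet the distinct points \<open>f a\<close> and \<open>g b\<close> have disjoint
  neighbourhoods, which separate small cylinders.\<close>

theorem lusin_separation:
  fixes A B :: "'a::t2_space set"
  assumes "analytic_set A" "analytic_set B" "A \<inter> B = {}"
  shows "\<exists>S\<in>sets borel. A \<subseteq> S \<and> S \<inter> B = {}"
proof -
  obtain C f where C: "closed (C :: (nat \<Rightarrow> nat) set)" "continuous_on C f" "f ` C = A"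
    using assms(1) by (rule analytic_setE)
  obtain D g where D: "closed (D :: (nat \<Rightarrow> nat) set)" "continuous_on D g" "g ` D = B"
    using assms(2) by (rule analytic_setE)
  define P where "P n x y \<longleftrightarrow> \<not> borel_separated (f ` (C \<inter> cyl x n)) (g ` (D \<inter> cyl y n))" for n x y
  have step: "\<exists>a b. P (Suc n) (x(n := a)) (y(n := b))" if "P n x y" for n x y
  proof (rule ccontr)
    assume "\<not> ?thesis"
    then have "borel_separated (f ` (C \<inter> cyl (x(n := a)) (Suc n))) (g ` (D \<inter> cyl (y(n := b)) (Suc n)))" for a b
      by (auto simp: P_def)
    then have "borel_separated (\<Union>a. f ` (C \<inter> cyl (x(n := a)) (Suc n))) (\<Union>b. g ` (D \<inter> cyl (y(n := b)) (Suc n)))"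
      by (intro borel_separated_UN_left borel_separated_UN_right)
    moreover have "(\<Union>a. f ` (C \<inter> cyl (x(n := a)) (Suc n))) = f ` (C \<inter> cyl x n)"
      by (subst (2) cyl_Suc_UN) auto
    moreover have "(\<Union>a. g ` (D \<inter> cyl (y(n := a)) (Suc n))) = g ` (D \<inter> cyl y n)"
      by (subst (2) cyl_Suc_UN) auto
    ultimately show False using that by (simp add: P_def)
  qed
  have "borel_separated (f ` (C \<inter> cyl x 0)) (g ` (D \<inter> cyl x 0))" for x
  proof (rule ccontr)
    assume "\<not> ?thesis"
    then have P0: "P 0 x x" by (simp add: P_def)
    have "\<exists>h. \<forall>n. P n (fst (h n)) (snd (h n)) \<and>
       (\<exists>a b. h (Suc n) = ((fst (h n))(n := a), (snd (h n))(n := b)))"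
    proof (rule dependent_nat_choice)
      show "\<exists>p. P 0 (fst p) (snd p)" using P0 by (intro exI[of _ "(x, x)"]) simp
    next
      fix p n assume "P n (fst p) (snd p)"
      then obtain a b where "P (Suc n) ((fst p)(n := a)) ((snd p)(n := b))" using step by blast
      then show "\<exists>q. P (Suc n) (fst q) (snd q) \<and> (\<exists>a b. q = ((fst p)(n := a), (snd p)(n := b)))"
        by (intro exI[of _ "((fst p)(n := a), (snd p)(n := b))"]) auto
    qed
    then obtain h where h: "\<And>n. P n (fst (h n)) (snd (h n))"
      "\<And>n. \<exists>a b. h (Suc n) = ((fst (h n))(n := a), (snd (h n))(n := b))" by blast
    define u where "u n = fst (h n)" for n
    define v where "v n = snd (h n)" for n
    have Puv: "P n (u n) (v n)" for n using h by (simp add: u_def v_def)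
    have uS: "u (Suc n) i = u n i" "v (Suc n) i = v n i" if "i \<noteq> n" for n i
      using h(2)[of n] that by (auto simp: u_def v_def)
    define a where "a i = u (Suc i) i" for i
    define b where "b i = v (Suc i) i" for i
    have "u n i = a i \<and> v n i = b i" if "i < n" for n i
      using that by (induction n) (auto simp: a_def b_def less_Suc_eq uS)
    then have "cyl (u n) n = cyl a n" "cyl (v n) n = cyl b n" for n by (auto simp: cyl_def)
    then have Pab: "P n a b" for n using Puv[of n] by (simp add: P_def)
    have "a \<in> C"
    proof (rule ccontr)
      assume "a \<notin> C"
      then obtain n where "cyl a n \<subseteq> - C" using open_cyl_nhd[of "- C" a] C(1) by (auto simp: closed_def)
      then have "C \<inter> cyl a n = {}" by auto
      then show False using Pab[of n] by (auto simp: P_def borel_separated_def)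
    qed
    moreover have "b \<in> D"
    proof (rule ccontr)
      assume "b \<notin> D"
      then obtain n where "cyl b n \<subseteq> - D" using open_cyl_nhd[of "- D" b] D(1) by (auto simp: closed_def)
      then have "D \<inter> cyl b n = {}" by auto
      then show False using Pab[of n] by (auto simp: P_def borel_separated_def)
    qed
    ultimately have "f a \<noteq> g b" using assms(3) C(3) D(3) by blast
    then obtain U V where UV: "open U" "open V" "f a \<in> U" "g b \<in> V" "U \<inter> V = {}"
      by (meson hausdorff)
    obtain U' where U': "open U'" "C \<inter> f -` U = C \<inter> U'"
      using continuous_on_open_invariant[of C f] C(2) UV(1) by (metis Int_commute)
    obtain V' where V': "open V'" "D \<inter> g -` V = D \<inter> V'"
      using continuous_on_open_invariant[of D g] D(2) UV(2) by (metis Int_commute)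
    obtain n where n: "cyl a n \<subseteq> U'" using open_cyl_nhd[of U' a] U' \<open>a \<in> C\<close> UV(3) by blast
    obtain m where m: "cyl b m \<subseteq> V'" using open_cyl_nhd[of V' b] V' \<open>b \<in> D\<close> UV(4) by blast
    have "cyl a (max n m) \<subseteq> cyl a n" "cyl b (max n m) \<subseteq> cyl b m" by (auto simp: cyl_def)
    then have fU: "f ` (C \<inter> cyl a (max n m)) \<subseteq> U" and gV: "g ` (D \<inter> cyl b (max n m)) \<subseteq> V"
      using n m U'(2) V'(2) by blast+
    have "U \<inter> g ` (D \<inter> cyl b (max n m)) = {}" using gV UV(5) by blast
    then have "borel_separated (f ` (C \<inter> cyl a (max n m))) (g ` (D \<inter> cyl b (max n m)))"
      unfolding borel_separated_def using fU UV(1) by (intro bexI[of _ U] conjI) simp_all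
    then have "\<not> P (max n m) a b" by (simp add: P_def)
    then show False using Pab by blast
  qed
  from this[of undefined] show ?thesis using C D by (auto simp: cyl_def borel_separated_def)
qed

text \<open>Iterate separation and saturation.\<close>

lemma invariant_borel_between:
  fixes F :: "('a::polish_space \<times> 'a) set"
  assumes F: "equiv UNIV F" "analytic_set F"
    and A: "analytic_set A" "A \<subseteq> H"
    and H: "analytic_set (- H)" "invariant_set F H"
  shows "\<exists>B\<in>sets borel. A \<subseteq> B \<and> B \<subseteq> H \<and> invariant_set F B"
proof -
  have sat: "analytic_set (F `` S)" if "analytic_set S" for S
  proof -
    have "analytic_set (snd ` {p\<in>F. fst p \<in> S})"
      by (intro analytic_image analytic_preimage F that continuous_on_snd continuous_on_fst continuous_on_id)
    moreover have "snd ` {p\<in>F. fst p \<in> S} = F `` S" by force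
    ultimately show ?thesis by simp
  qed
  have step: "\<exists>T\<in>sets borel. F `` S \<subseteq> T \<and> T \<subseteq> H" if "analytic_set S" "S \<subseteq> H" for S
  proof -
    have "F `` S \<inter> - H = {}" using that(2) H(2) by (auto simp: invariant_set_def)
    then show ?thesis using lusin_separation[OF sat[OF that(1)] H(1)] by blast
  qed
  have "\<exists>T. \<forall>n. (T n \<in> sets borel \<and> A \<subseteq> T n \<and> T n \<subseteq> H) \<and> F `` T n \<subseteq> T (Suc n)"
  proof (rule dependent_nat_choice)
    have "A \<subseteq> F `` A" using F(1) by (auto simp: equiv_def refl_on_def)
    then show "\<exists>T. T \<in> sets borel \<and> A \<subseteq> T \<and> T \<subseteq> H" using step[OF A] by (meson subset_trans)
  next
    fix T n assume T: "T \<in> sets borel \<and> A \<subseteq> T \<and> T \<subseteq> H"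
    then obtain T' where T': "T' \<in> sets borel" "F `` T \<subseteq> T'" "T' \<subseteq> H"
      using step[of T] analytic_borel by metis
    have "T \<subseteq> F `` T" using F(1) by (auto simp: equiv_def refl_on_def)
    then have "A \<subseteq> T'" using T T'(2) by (meson subset_trans)
    then show "\<exists>y. (y \<in> sets borel \<and> A \<subseteq> y \<and> y \<subseteq> H) \<and> F `` T \<subseteq> y" using T' by metis
  qed
  then obtain T where T: "\<And>n. T n \<in> sets borel" "\<And>n. A \<subseteq> T n" "\<And>n. T n \<subseteq> H" "\<And>n. F `` T n \<subseteq> T (Suc n)"
    by blast
  show ?thesis
  proof (intro bexI[of _ "\<Union>n. T n"] conjI)
    show "invariant_set F (\<Union>n. T n)" unfolding invariant_set_def
    proof (intro allI impI)
      fix x y assume "x \<in> (\<Union>n. T n)" "(x, y) \<in> F"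
      then obtain n where "x \<in> T n" by auto
      then have "y \<in> T (Suc n)" using T(4)[of n] \<open>(x, y) \<in> F\<close> by auto
      then show "y \<in> (\<Union>n. T n)" by auto
    qed
    show "(\<Union>n. T n) \<in> sets borel" using T(1) by auto
    show "A \<subseteq> (\<Union>n. T n)" using T(2)[of 0] by auto
    show "(\<Union>n. T n) \<subseteq> H" using T(3) by auto
  qed
qed

section \<open>The avoidance game\<close>

text \<open>The game of height \<open>n\<close>: on row \<open>p < n\<close>, starting from the top, an opponent names countably many
  classes (a pair \<open>(d, i)\<close> stands for the \<open>R i\<close>-class of \<open>d\<close>), and one answers by changing the data of
  level at most \<open>p\<close>; from then on the row \<open>p\<close> leaves have to avoid these classes. The relation
  \<open>sim p\<close> says that all data of level greater than \<open>p\<close> agree. The sets that are not live at \<open>c\<close>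
  form a \<open>\<sigma>\<close>-ideal.\<close>

definition miss :: "(nat \<Rightarrow> ('x \<times> 'x) set) \<Rightarrow> ('x \<times> nat) set \<Rightarrow> ('x \<times> nat) set \<Rightarrow> bool" where
  "miss R L D \<longleftrightarrow> (\<forall>x i d. (x, i) \<in> L \<longrightarrow> (d, i) \<in> D \<longrightarrow> (d, x) \<notin> R i)"

primrec live :: "(nat \<Rightarrow> 'c \<Rightarrow> 'c \<Rightarrow> bool) \<Rightarrow> (nat \<Rightarrow> 'c \<Rightarrow> ('x \<times> nat) set) \<Rightarrow> (nat \<Rightarrow> ('x \<times> 'x) set)
    \<Rightarrow> nat \<Rightarrow> 'c set \<Rightarrow> 'c \<Rightarrow> bool" where
  "live sim lv R 0 A c \<longleftrightarrow> c \<in> A"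
| "live sim lv R (Suc p) A c \<longleftrightarrow>
    (\<forall>D. countable D \<longrightarrow> (\<exists>c'. sim p c c' \<and> live sim lv R p {a\<in>A. miss R (lv p a) D} c'))"

lemma live_SucI:
  assumes "\<And>D. countable D \<Longrightarrow> \<exists>c'. sim p c c' \<and> live sim lv R p {a\<in>A. miss R (lv p a) D} c'"
  shows "live sim lv R (Suc p) A c"
  using assms by simp

lemma live_SucE:
  assumes "live sim lv R (Suc p) A c" "countable D"
  obtains c' where "sim p c c'" "live sim lv R p {a\<in>A. miss R (lv p a) D} c'"
  using assms by auto

lemma miss_mono: "miss R L D \<Longrightarrow> L' \<subseteq> L \<Longrightarrow> D' \<subseteq> D \<Longrightarrow> miss R L' D'"
  unfolding miss_def by blast

lemma miss_Un: "miss R (L \<union> L') D \<longleftrightarrow> miss R L D \<and> miss R L' D"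
  unfolding miss_def by blast

lemma live_mono:
  fixes lv :: "nat \<Rightarrow> 'c \<Rightarrow> ('x \<times> nat) set"
  shows "live sim lv R n A c \<Longrightarrow> A \<subseteq> B \<Longrightarrow> live sim lv R n B c"
proof (induction n arbitrary: A B c)
  case (Suc n)
  show ?case
  proof (rule live_SucI)
    fix D :: "('x \<times> nat) set" assume "countable D"
    then obtain c' where c': "sim n c c'" "live sim lv R n {a\<in>A. miss R (lv n a) D} c'"
      using Suc.prems(1) by auto
    have "live sim lv R n {a\<in>B. miss R (lv n a) D} c'"
      by (rule Suc.IH[OF c'(2)]) (use Suc.prems(2) in auto)
    with c'(1) show "\<exists>c'. sim n c c' \<and> live sim lv R n {a\<in>B. miss R (lv n a) D} c'" by blast
  qed
qed auto

lemma live_empty: "\<not> live sim lv R n {} c"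
  by (induction n arbitrary: c) auto

lemma live_nonempty: "live sim lv R n A c \<Longrightarrow> A \<noteq> {}"
  by (auto simp: live_empty)

text \<open>Each piece that is not live is beaten by a first move \<open>D i\<close>. The union of
  these countable families is again a legitimate move, and a good answer to it reduces the claim to
  the next height. This is why moves are countable families rather than single classes.\<close>

lemma live_UN:
  assumes "countable I" "live sim lv R n (\<Union>i\<in>I. A i) c"
  shows "\<exists>i\<in>I. live sim lv R n (A i) c"
  using assms(2)
proof (induction n arbitrary: A c)
  case (Suc n)
  show ?case
  proof (rule ccontr)
    assume "\<not> ?thesis"
    then have "\<forall>i\<in>I. \<exists>D. countable D \<and> (\<forall>c'. sim n c c' \<longrightarrow> \<not> live sim lv R n {a\<in>A i. miss R (lv n a) D} c')"
      by auto
    then obtain D where D: "\<And>i. i \<in> I \<Longrightarrow> countable (D i)"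
      "\<And>i c'. i \<in> I \<Longrightarrow> sim n c c' \<Longrightarrow> \<not> live sim lv R n {a\<in>A i. miss R (lv n a) (D i)} c'" by metis
    have "countable (\<Union>i\<in>I. D i)" using D(1) assms(1) by blast
    then obtain c' where c': "sim n c c'"
      "live sim lv R n {a\<in>(\<Union>i\<in>I. A i). miss R (lv n a) (\<Union>i\<in>I. D i)} c'"
      using Suc.prems by (auto simp del: UN_iff)
    have "{a\<in>(\<Union>i\<in>I. A i). miss R (lv n a) (\<Union>i\<in>I. D i)} \<subseteq> (\<Union>i\<in>I. {a\<in>A i. miss R (lv n a) (D i)})"
    proof
      fix a assume "a \<in> {a\<in>(\<Union>i\<in>I. A i). miss R (lv n a) (\<Union>i\<in>I. D i)}"
      then obtain i where "i \<in> I" "a \<in> A i" "miss R (lv n a) (\<Union>i\<in>I. D i)" by auto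
      then show "a \<in> (\<Union>i\<in>I. {a\<in>A i. miss R (lv n a) (D i)})"
        by (auto intro: miss_mono)
    qed
    then have "live sim lv R n (\<Union>i\<in>I. {a\<in>A i. miss R (lv n a) (D i)}) c'"
      by (rule live_mono[OF c'(2)])
    from Suc.IH[OF this] obtain i where i: "i \<in> I" "live sim lv R n {a\<in>A i. miss R (lv n a) (D i)} c'"
      by (rule bexE)
    show False using D(2)[OF i(1) c'(1)] i(2) by (rule notE)
  qed
qed auto

lemma live_Un:
  assumes "live sim lv R n (A \<union> B) c"
  shows "live sim lv R n A c \<or> live sim lv R n B c"
proof -
  have "A \<union> B = (\<Union>b\<in>{True, False}. if b then A else B)" by auto
  then have "live sim lv R n (\<Union>b\<in>{True, False}. if b then A else B) c" using assms by simp
  then have "\<exists>b\<in>{True, False}. live sim lv R n (if b then A else B) c" by (intro live_UN) auto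
  then show ?thesis by auto
qed

lemma live_Diff:
  assumes "live sim lv R n A c" "\<not> live sim lv R n {a\<in>A. P a} c"
  shows "live sim lv R n {a\<in>A. \<not> P a} c"
proof -
  have "A = {a\<in>A. P a} \<union> {a\<in>A. \<not> P a}" by auto
  then show ?thesis using live_Un[of sim lv R n "{a\<in>A. P a}" "{a\<in>A. \<not> P a}" c] assms by auto
qed

lemma live_Diff_finite:
  assumes "finite I" "live sim lv R n A c" "\<And>i. i \<in> I \<Longrightarrow> \<not> live sim lv R n {a\<in>A. P i a} c"
  shows "live sim lv R n {a\<in>A. \<forall>i\<in>I. \<not> P i a} c"
  using assms(1,3)
proof (induction I)
  case (insert i I)
  have "\<not> live sim lv R n {a\<in>{a\<in>A. \<forall>i\<in>I. \<not> P i a}. P i a} c"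
    using insert.prems[of i] live_mono[of sim lv R n "{a\<in>{a\<in>A. \<forall>i\<in>I. \<not> P i a}. P i a}" c "{a\<in>A. P i a}"] by auto
  then have "live sim lv R n {a\<in>{a\<in>A. \<forall>i\<in>I. \<not> P i a}. \<not> P i a} c" using insert by (intro live_Diff) auto
  then show ?case by (rule live_mono) auto
qed (use assms(2) in simp)

text \<open>Answers are transported along \<open>h\<close>. Fewer leaves mean fewer classes to
  avoid, so it is enough that the leaves of an image occur among those of its source.\<close>

lemma live_map:
  fixes lv :: "nat \<Rightarrow> 'c \<Rightarrow> ('x \<times> nat) set"
  assumes "\<And>p c d. p < n \<Longrightarrow> sim p c d \<Longrightarrow> sim' p (h c) (h d)"
    and "\<And>p a. p < n \<Longrightarrow> a \<in> A \<Longrightarrow> lv' p (h a) \<subseteq> lv p a"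
    and "live sim lv R n A c"
  shows "live sim' lv' R n (h ` A) (h c)"
  using assms
proof (induction n arbitrary: A c)
  case (Suc n)
  show ?case
  proof (rule live_SucI)
    fix D :: "('x \<times> nat) set" assume "countable D"
    then obtain c' where c': "sim n c c'" "live sim lv R n {a\<in>A. miss R (lv n a) D} c'"
      using Suc.prems(3) by auto
    have "live sim' lv' R n (h ` {a\<in>A. miss R (lv n a) D}) (h c')"
      by (rule Suc.IH[OF _ _ c'(2)]) (use Suc.prems in auto)
    moreover have "h ` {a\<in>A. miss R (lv n a) D} \<subseteq> {b\<in>h ` A. miss R (lv' n b) D}"
    proof (intro image_subsetI CollectI conjI)
      fix a assume a: "a \<in> {a\<in>A. miss R (lv n a) D}"
      then show "h a \<in> h ` A" by simp
      show "miss R (lv' n (h a)) D"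
        by (rule miss_mono[of R "lv n a" D]) (use a Suc.prems(2)[of n a] in auto)
    qed
    ultimately have "live sim' lv' R n {b\<in>h ` A. miss R (lv' n b) D} (h c')" by (rule live_mono)
    moreover have "sim' n (h c) (h c')" using Suc.prems(1)[of n] c'(1) by simp
    ultimately show "\<exists>c'. sim' n (h c) c' \<and> live sim' lv' R n {b\<in>h ` A. miss R (lv' n b) D} c'" by blast
  qed
qed auto

definition level_sim :: "(nat \<Rightarrow> 'c \<Rightarrow> 'c \<Rightarrow> bool) \<Rightarrow> bool" where
  "level_sim sim \<longleftrightarrow> (\<forall>p. equivp (sim p)) \<and> (\<forall>p q c d. p \<le> q \<longrightarrow> sim p c d \<longrightarrow> sim q c d)"

lemma level_simD:
  assumes "level_sim sim"
  shows level_sim_sym: "sim p c d \<Longrightarrow> sim p d c"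
    and level_sim_trans: "sim p c d \<Longrightarrow> sim p d e \<Longrightarrow> sim p c e"
    and level_sim_mono: "p \<le> q \<Longrightarrow> sim p c d \<Longrightarrow> sim q c d"
proof -
  have "equivp (sim p)" using assms by (simp add: level_sim_def)
  then show "sim p c d \<Longrightarrow> sim p d c" "sim p c d \<Longrightarrow> sim p d e \<Longrightarrow> sim p c e"
    by (auto intro: equivp_symp equivp_transp)
  show "p \<le> q \<Longrightarrow> sim p c d \<Longrightarrow> sim q c d" using assms by (auto simp: level_sim_def)
qed

text \<open>The relations \<open>sim p\<close> grow with \<open>p\<close>, so every answer in a game
  of height \<open>Suc p\<close> stays in the \<open>sim p\<close>-class of the start.\<close>

lemma live_restrict_sim:
  fixes lv :: "nat \<Rightarrow> 'c \<Rightarrow> ('x \<times> nat) set"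
  assumes s: "level_sim sim"
  shows "live sim lv R (Suc p) A c \<Longrightarrow> live sim lv R (Suc p) {a\<in>A. sim p c a} c"
proof (induction p arbitrary: A c)
  case 0
  then show ?case by auto
next
  case (Suc p)
  show ?case
  proof (rule live_SucI)
    fix D :: "('x \<times> nat) set" assume "countable D"
    obtain c' where c': "sim (Suc p) c c'" "live sim lv R (Suc p) {a\<in>A. miss R (lv (Suc p) a) D} c'"
      by (rule live_SucE[OF Suc.prems \<open>countable D\<close>])
    have "live sim lv R (Suc p) {a\<in>{a\<in>A. miss R (lv (Suc p) a) D}. sim p c' a} c'"
      by (rule Suc.IH[OF c'(2)])
    moreover have "sim (Suc p) c a" if "sim p c' a" for a
      using level_sim_trans[OF s c'(1)] level_sim_mono[OF s _ that, of "Suc p"] by simp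
    ultimately have "live sim lv R (Suc p) {a\<in>{a\<in>A. sim (Suc p) c a}. miss R (lv (Suc p) a) D} c'"
      by (elim live_mono) auto
    with c'(1) show "\<exists>c'. sim (Suc p) c c' \<and>
        live sim lv R (Suc p) {a\<in>{a\<in>A. sim (Suc p) c a}. miss R (lv (Suc p) a) D} c'" by blast
  qed
qed

text \<open>The start enters only through the first answer, which may be anything in its
  \<open>sim p\<close>-class. So liveness at height \<open>Suc p\<close> depends on this class
  alone.\<close>

lemma live_cong_top:
  fixes lv :: "nat \<Rightarrow> 'c \<Rightarrow> ('x \<times> nat) set"
  assumes s: "level_sim sim" and "sim p c d" "live sim lv R (Suc p) A c"
  shows "live sim lv R (Suc p) A d"

proof (rule live_SucI)
  fix D :: "('x \<times> nat) set" assume "countable D"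
  then obtain c' where "sim p c c'" "live sim lv R p {a\<in>A. miss R (lv p a) D} c'"
    using assms(3) by auto
  then show "\<exists>c'. sim p d c' \<and> live sim lv R p {a\<in>A. miss R (lv p a) D} c'"
    using level_sim_trans[OF s] level_sim_sym[OF s assms(2)] by blast
qed

text \<open>The relations are treated one after the other: if some class is live, shrink to it. Both
  alternatives survive further shrinking, so earlier gains are kept.\<close>

lemma live_pure:
  assumes "finite I" "live sim lv R n A c"
  shows "\<exists>A'\<subseteq>A. live sim lv R n A' c \<and>
    (\<forall>i\<in>I. (\<exists>w. \<forall>a\<in>A'. rel i w a) \<or> (\<forall>w. \<not> live sim lv R n {a\<in>A'. rel i w a} c))"
  using assms(1)
proof (induction I)
  case empty
  then show ?case using assms(2) by auto
next
  case (insert i I)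
  then obtain A' where A': "A' \<subseteq> A" "live sim lv R n A' c"
    "\<forall>i\<in>I. (\<exists>w. \<forall>a\<in>A'. rel i w a) \<or> (\<forall>w. \<not> live sim lv R n {a\<in>A'. rel i w a} c)" by auto
  show ?case
  proof (cases "\<exists>w. live sim lv R n {a\<in>A'. rel i w a} c")
    case True
    then obtain w where w: "live sim lv R n {a\<in>A'. rel i w a} c" by blast
    let ?A = "{a\<in>A'. rel i w a}"
    have "(\<exists>w. \<forall>a\<in>?A. rel j w a) \<or> (\<forall>w. \<not> live sim lv R n {a\<in>?A. rel j w a} c)" if "j \<in> I" for j
    proof -
      from A'(3) that consider "\<exists>w. \<forall>a\<in>A'. rel j w a" | "\<forall>w. \<not> live sim lv R n {a\<in>A'. rel j w a} c" by blast
      then show ?thesis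
      proof cases
        case 2
        have "\<not> live sim lv R n {a\<in>?A. rel j w a} c" for w
          using 2 live_mono[of sim lv R n "{a\<in>?A. rel j w a}" c "{a\<in>A'. rel j w a}"] by auto
        then show ?thesis by blast
      qed auto
    qed
    moreover have "\<exists>w. \<forall>a\<in>?A. rel i w a" by auto
    ultimately have "\<forall>j\<in>insert i I. (\<exists>w. \<forall>a\<in>?A. rel j w a) \<or> (\<forall>w. \<not> live sim lv R n {a\<in>?A. rel j w a} c)"
      by blast
    then show ?thesis using w A'(1) by (intro exI[of _ ?A]) auto
  next
    case False
    then show ?thesis using A' by (intro exI[of _ A']) auto
  qed
qed

section \<open>Products and amalgamation of live sets\<close>

definition sim2 :: "(nat \<Rightarrow> 'c \<Rightarrow> 'c \<Rightarrow> bool) \<Rightarrow> nat \<Rightarrow> 'c \<times> 'c \<Rightarrow> 'c \<times> 'c \<Rightarrow> bool" where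
  "sim2 sim p x y \<longleftrightarrow> sim p (fst x) (fst y) \<and> sim p (snd x) (snd y)"

definition lv2 :: "(nat \<Rightarrow> 'c \<Rightarrow> 'l set) \<Rightarrow> nat \<Rightarrow> 'c \<times> 'c \<Rightarrow> 'l set" where
  "lv2 lv p x = lv p (fst x) \<union> lv p (snd x)"

text \<open>Both coordinates answer the same families. The danger is that both plays are driven into
  one \<open>rel i\<close>-class. The invariant prevents it: for each \<open>i\<close> either no
  related pairs are left, or no single class is live on the side of \<open>A\<close>. In each round,
  a side found to be confined to one class makes the other side give up that class, which costs only
  finitely many sets that are not live.\<close>

lemma live_prod:
  fixes lv :: "nat \<Rightarrow> 'c \<Rightarrow> ('x \<times> nat) set"
  assumes "finite I" and eq: "\<And>i. i \<in> I \<Longrightarrow> equivp (rel i)"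
    and "live sim lv R n A c" "live sim lv R n B d"
    and "\<And>i. i \<in> I \<Longrightarrow> (\<forall>a\<in>A. \<forall>b\<in>B. \<not> rel i a b) \<or> (\<forall>w. \<not> live sim lv R n {a\<in>A. rel i w a} c)"
  shows "live (sim2 sim) (lv2 lv) R n {(a, b). a \<in> A \<and> b \<in> B \<and> (\<forall>i\<in>I. \<not> rel i a b)} (c, d)"
  using assms(3-)
proof (induction n arbitrary: A B c d)
  case 0
  \<comment> \<open>At height \<open>0\<close> the class of \<open>c\<close> is live, since it
    contains \<open>c\<close>; only the first alternative can hold.\<close>
  have "\<not> rel i c d" if "i \<in> I" for i
  proof -
    have "rel i c c" using eq[OF that] by (rule equivp_reflp)
    then show ?thesis using 0 that by auto
  qed
  then show ?case using 0 by auto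
next
  case (Suc n)
  let ?L = "live sim lv R"
  show ?case
  proof (rule live_SucI)
    fix D :: "('x \<times> nat) set" assume "countable D"
    obtain d' where d': "sim n d d'" "?L n {b\<in>B. miss R (lv n b) D} d'"
      using Suc.prems(2) \<open>countable D\<close> by auto
    obtain B' where B': "B' \<subseteq> {b\<in>B. miss R (lv n b) D}" "?L n B' d'"
      "\<And>i. i \<in> I \<Longrightarrow> (\<exists>w. \<forall>b\<in>B'. rel i w b) \<or> (\<forall>w. \<not> ?L n {b\<in>B'. rel i w b} d')"
      using live_pure[OF assms(1) d'(2), of rel] by blast
    \<comment> \<open>The side of \<open>B\<close> has moved first. \<open>J\<close> collects the
      relations that confine it to one class while no class is live in \<open>A\<close>; that class
      is removed from \<open>A\<close> before the side of \<open>A\<close> answers.\<close>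
    define J where "J = {i\<in>I. (\<exists>w. \<forall>b\<in>B'. rel i w b) \<and> (\<forall>w. \<not> ?L (Suc n) {a\<in>A. rel i w a} c)}"
    have "\<forall>i\<in>J. \<exists>w. \<forall>b\<in>B'. rel i w b" by (auto simp: J_def)
    then obtain w where w: "\<And>i b. i \<in> J \<Longrightarrow> b \<in> B' \<Longrightarrow> rel i (w i) b" by metis
    have "?L (Suc n) {a\<in>A. \<forall>i\<in>J. \<not> rel i (w i) a} c"
    proof (rule live_Diff_finite[OF _ Suc.prems(1)])
      show "finite J" using assms(1) by (auto simp: J_def)
      fix i assume "i \<in> J"
      then show "\<not> ?L (Suc n) {a\<in>A. rel i (w i) a} c" unfolding J_def by blast
    qed
    then obtain c' where c': "sim n c c'" "?L n {a\<in>{a\<in>A. \<forall>i\<in>J. \<not> rel i (w i) a}. miss R (lv n a) D} c'"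
      using \<open>countable D\<close> by auto
    obtain A' where A': "A' \<subseteq> {a\<in>{a\<in>A. \<forall>i\<in>J. \<not> rel i (w i) a}. miss R (lv n a) D}" "?L n A' c'"
      "\<And>i. i \<in> I \<Longrightarrow> (\<exists>w. \<forall>a\<in>A'. rel i w a) \<or> (\<forall>w. \<not> ?L n {a\<in>A'. rel i w a} c')"
      using live_pure[OF assms(1) c'(2), of rel] by blast
    \<comment> \<open>The converse correction: \<open>K\<close> collects the relations where the
      side of \<open>A\<close> ended up in one class while no class is live in \<open>B'\<close>,
      and that class is taken out of \<open>B'\<close>.\<close>
    define K where "K = {i\<in>I. (\<exists>w. \<forall>a\<in>A'. rel i w a) \<and> (\<forall>w. \<not> ?L n {b\<in>B'. rel i w b} d')}"
    have "\<forall>i\<in>K. \<exists>w. \<forall>a\<in>A'. rel i w a" by (auto simp: K_def)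
    then obtain v where v: "\<And>i a. i \<in> K \<Longrightarrow> a \<in> A' \<Longrightarrow> rel i (v i) a" by metis
    define B'' where "B'' = {b\<in>B'. \<forall>i\<in>K. \<not> rel i (v i) b}"
    have B'': "?L n B'' d'" unfolding B''_def
    proof (rule live_Diff_finite[OF _ B'(2)])
      show "finite K" using assms(1) by (auto simp: K_def)
      fix i assume "i \<in> K"
      then show "\<not> ?L n {b\<in>B'. rel i (v i) b} d'" unfolding K_def by blast
    qed
    have A'D: "a \<in> A" "miss R (lv n a) D" "i \<in> J \<Longrightarrow> \<not> rel i (w i) a" if "a \<in> A'" for a i
      using subsetD[OF A'(1) that] by auto
    have B'D: "b \<in> B" "miss R (lv n b) D" if "b \<in> B'" for b
      using subsetD[OF B'(1) that] by auto
    have alt: "(\<forall>a\<in>A'. \<forall>b\<in>B''. \<not> rel i a b) \<or> (\<forall>w. \<not> ?L n {a\<in>A'. rel i w a} c')" if "i \<in> I" for i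
    proof (rule disjCI)
      assume "\<not> (\<forall>w. \<not> ?L n {a\<in>A'. rel i w a} c')"
      then have conc: "\<exists>w. \<forall>a\<in>A'. rel i w a" using A'(3)[OF that] by blast
      from Suc.prems(3)[OF that] show "\<forall>a\<in>A'. \<forall>b\<in>B''. \<not> rel i a b"
      proof
        assume "\<forall>a\<in>A. \<forall>b\<in>B. \<not> rel i a b"
        then show ?thesis using A'D B'D by (auto simp: B''_def)
      next
        assume dead: "\<forall>w. \<not> ?L (Suc n) {a\<in>A. rel i w a} c"
        show ?thesis
        proof (intro ballI notI)
          fix a b assume ab: "a \<in> A'" "b \<in> B''" "rel i a b"
          from B'(3)[OF that] show False
          proof
            assume "\<exists>w. \<forall>b\<in>B'. rel i w b"
            then have "i \<in> J" using that dead unfolding J_def by blast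
            then have "rel i (w i) b" using w ab(2) by (simp add: B''_def)
            then have "rel i (w i) a" using ab(3) eq[OF that] by (meson equivp_symp equivp_transp)
            then show False using A'D(3) ab(1) \<open>i \<in> J\<close> by blast
          next
            assume "\<forall>w. \<not> ?L n {b\<in>B'. rel i w b} d'"
            then have "i \<in> K" using that conc unfolding K_def by blast
            then have "rel i (v i) a" using v ab(1) by blast
            then have "rel i (v i) b" using ab(3) eq[OF that] by (meson equivp_transp)
            then show False using ab(2) \<open>i \<in> K\<close> by (simp add: B''_def)
          qed
        qed
      qed
    qed
    have "live (sim2 sim) (lv2 lv) R n {(a, b). a \<in> A' \<and> b \<in> B'' \<and> (\<forall>i\<in>I. \<not> rel i a b)} (c', d')"
      by (rule Suc.IH[OF A'(2) B'' alt])
    moreover have "{(a, b). a \<in> A' \<and> b \<in> B'' \<and> (\<forall>i\<in>I. \<not> rel i a b)} \<subseteq>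
        {x \<in> {(a, b). a \<in> A \<and> b \<in> B \<and> (\<forall>i\<in>I. \<not> rel i a b)}. miss R (lv2 lv n x) D}"
      using A'D B'D by (auto simp: B''_def lv2_def miss_Un)
    ultimately have "live (sim2 sim) (lv2 lv) R n
        {x \<in> {(a, b). a \<in> A \<and> b \<in> B \<and> (\<forall>i\<in>I. \<not> rel i a b)}. miss R (lv2 lv n x) D} (c', d')"
      by (rule live_mono)
    moreover have "sim2 sim n (c, d) (c', d')" using c'(1) d'(1) by (simp add: sim2_def)
    ultimately show "\<exists>x'. sim2 sim n (c, d) x' \<and> live (sim2 sim) (lv2 lv) R n
        {x \<in> {(a, b). a \<in> A \<and> b \<in> B \<and> (\<forall>i\<in>I. \<not> rel i a b)}. miss R (lv2 lv n x) D} x'" by blast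
  qed
qed

text \<open>This is the source of the edges. Above row \<open>p\<close> both copies make the same
  moves. At row \<open>p\<close> they are separated by the product lemma, whose hypothesis holds
  because the opponent can name any single class of a row \<open>p\<close> leaf, so that no such
  class is live.\<close>

lemma live_amalgam:
  fixes lv :: "nat \<Rightarrow> 'c \<Rightarrow> ('x \<times> nat) set"
  assumes s: "level_sim sim" and "finite I" "p < n"
    and R: "\<And>i. equiv UNIV (R i)"
    and lv: "\<And>i a. i \<in> I \<Longrightarrow> (f i a, e i) \<in> lv p a"
    and "live sim lv R n A c"
  shows "live (sim2 sim) (lv2 lv) R n
    {(a, b). a \<in> A \<and> b \<in> A \<and> sim p a b \<and> (\<forall>i\<in>I. (f i a, f i b) \<notin> R (e i))} (c, c)"
  using assms(3,6)
proof (induction n arbitrary: A c)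
  case (Suc n)
  let ?rel = "\<lambda>i a b. (f i a, f i b) \<in> R (e i)"
  have eqv: "equivp (?rel i)" for i
  proof (rule equivpI)
    show "reflp (?rel i)" using R[of "e i"] by (auto simp: reflp_def equiv_def refl_on_def)
    show "symp (?rel i)" using R[of "e i"] by (auto simp: symp_def equiv_def sym_def)
    show "transp (?rel i)" using R[of "e i"] unfolding transp_def equiv_def trans_def by blast
  qed
  show ?case
  proof (cases "p = n")
    case True
    have A: "live sim lv R (Suc p) {a\<in>A. sim p c a} c"
      by (rule live_restrict_sim[OF s]) (use Suc.prems True in simp)
    have "live (sim2 sim) (lv2 lv) R (Suc p)
      {(a, b). a \<in> {a\<in>A. sim p c a} \<and> b \<in> {a\<in>A. sim p c a} \<and> (\<forall>i\<in>I. \<not> ?rel i a b)} (c, c)"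
    proof (rule live_prod[OF assms(2) eqv A A], rule disjI2, intro allI notI)
      fix i w assume "i \<in> I" and l: "live sim lv R (Suc p) {a\<in>{a\<in>A. sim p c a}. ?rel i w a} c"
      have "countable {(f i w, e i)}" by simp
      with l obtain c' where l': "live sim lv R p
          {a\<in>{a\<in>{a\<in>A. sim p c a}. ?rel i w a}. miss R (lv p a) {(f i w, e i)}} c'"
        by (rule live_SucE)
      have empty: "{a\<in>{a\<in>{a\<in>A. sim p c a}. ?rel i w a}. miss R (lv p a) {(f i w, e i)}} = {}"
        using lv[OF \<open>i \<in> I\<close>] by (auto simp: miss_def)
      show False using l' unfolding empty by (rule notE[OF live_empty])
    qed
    then show ?thesis unfolding True[symmetric]
      by (rule live_mono) (auto intro: level_sim_trans[OF s] level_sim_sym[OF s])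
  next
    case False
    then have "p < n" using Suc.prems by simp
    show ?thesis
    proof (rule live_SucI)
      fix D :: "('x \<times> nat) set" assume "countable D"
      then obtain c' where c': "sim n c c'" "live sim lv R n {a\<in>A. miss R (lv n a) D} c'"
        using Suc.prems(2) by auto
      note Suc.IH[OF \<open>p < n\<close> c'(2)]
      then have "live (sim2 sim) (lv2 lv) R n {x \<in> {(a, b). a \<in> A \<and> b \<in> A \<and> sim p a b \<and>
          (\<forall>i\<in>I. (f i a, f i b) \<notin> R (e i))}. miss R (lv2 lv n x) D} (c', c')"
        by (rule live_mono) (auto simp: lv2_def miss_Un)
      moreover have "sim2 sim n (c, c) (c', c')" using c'(1) by (simp add: sim2_def)
      ultimately show "\<exists>x'. sim2 sim n (c, c) x' \<and> live (sim2 sim) (lv2 lv) R n {x \<in> {(a, b). a \<in> A \<and> b \<in> A \<and> sim p a b \<and>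
          (\<forall>i\<in>I. (f i a, f i b) \<notin> R (e i))}. miss R (lv2 lv n x) D} x'" by blast
    qed
  qed
qed simp

section \<open>Category\<close>

text \<open>General factors \<open>S k\<close> allow one treatment of Cantor space and of the spaces
  of pairs given by \<open>prow\<close> below.\<close>

definition seqs :: "(nat \<Rightarrow> 'f set) \<Rightarrow> (nat \<Rightarrow> 'f) set" where
  "seqs S = {z. \<forall>k. z k \<in> S k}"

definition seqbox :: "(nat \<Rightarrow> 'f set) \<Rightarrow> nat \<Rightarrow> (nat \<Rightarrow> 'f) \<Rightarrow> (nat \<Rightarrow> 'f) set" where
  "seqbox S n z = {z'\<in>seqs S. \<forall>i<n. z' i = z i}"

text \<open>Relative to the box of \<open>z0\<close> of length \<open>n0\<close>, this says that
  \<open>D\<close> contains a dense open set. The box is carried along because a nonmeager Borel set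
  is only known to be comeager in some box.\<close>

definition dense_below :: "(nat \<Rightarrow> 'f set) \<Rightarrow> nat \<Rightarrow> (nat \<Rightarrow> 'f) \<Rightarrow> (nat \<Rightarrow> 'f) set \<Rightarrow> bool" where
  "dense_below S n0 z0 D \<longleftrightarrow> (\<forall>n z. n0 \<le> n \<longrightarrow> z \<in> seqbox S n0 z0 \<longrightarrow>
     (\<exists>m z'. n \<le> m \<and> z' \<in> seqbox S n z \<and> seqbox S m z' \<subseteq> D))"

lemma box_self: "z \<in> seqs S \<Longrightarrow> z \<in> seqbox S n z"
  by (simp add: seqbox_def)

lemma box_sub: "n \<le> m \<Longrightarrow> z' \<in> seqbox S n z \<Longrightarrow> seqbox S m z' \<subseteq> seqbox S n z"
  by (auto simp: seqbox_def)

lemma dense_below_UNIV: "dense_below S n0 z0 UNIV"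
  unfolding dense_below_def
proof (intro allI impI)
  fix n z assume "z \<in> seqbox S n0 z0"
  then have "z \<in> seqbox S n z" by (auto simp: seqbox_def)
  then show "\<exists>m z'. n \<le> m \<and> z' \<in> seqbox S n z \<and> seqbox S m z' \<subseteq> UNIV" by blast
qed

lemma dense_below_sub:
  assumes "dense_below S n0 z0 D" "n0 \<le> n" "z \<in> seqbox S n0 z0"
  shows "dense_below S n z D"
  unfolding dense_below_def
proof (intro allI impI)
  fix m z' assume "n \<le> m" "z' \<in> seqbox S n z"
  then have "z' \<in> seqbox S n0 z0" using box_sub[OF assms(2,3)] by auto
  then show "\<exists>m' z''. m \<le> m' \<and> z'' \<in> seqbox S m z' \<and> seqbox S m' z'' \<subseteq> D"
    using assms(1,2) \<open>n \<le> m\<close> unfolding dense_below_def by (meson order_trans)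
qed

lemma dense_below_baire:
  assumes "\<And>i::nat. dense_below S n0 z0 (D i)" "z0 \<in> seqs S"
  shows "\<exists>z\<in>seqbox S n0 z0. \<forall>i. z \<in> D i"
proof -
  \<comment> \<open>The demand that stage \<open>i\<close> has length at least \<open>n0 + i\<close>
    makes the prefixes determine a full limit.\<close>
  define P where "P = (\<lambda>(i::nat) (q :: nat \<times> (nat \<Rightarrow> 'a)). n0 + i \<le> fst q \<and> snd q \<in> seqbox S n0 z0)"
  define Q where "Q = (\<lambda>i (q :: nat \<times> (nat \<Rightarrow> 'a)) r. fst q \<le> fst r \<and> snd r \<in> seqbox S (fst q) (snd q) \<and>
    seqbox S (fst r) (snd r) \<subseteq> D i)"
  have "\<exists>f. \<forall>n. P n (f n) \<and> Q n (f n) (f (Suc n))"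
  proof (rule dependent_nat_choice)
    show "\<exists>q. P 0 q" using box_self[OF assms(2)] by (intro exI[of _ "(n0, z0)"]) (simp add: P_def)
  next
    fix q i assume q: "P i q"
    then have "n0 \<le> fst q + 1" "snd q \<in> seqbox S n0 z0" by (auto simp: P_def)
    then obtain m z' where m: "fst q + 1 \<le> m" "z' \<in> seqbox S (fst q + 1) (snd q)" "seqbox S m z' \<subseteq> D i"
      using assms(1)[of i] unfolding dense_below_def by blast
    then have "z' \<in> seqbox S (fst q) (snd q)" by (auto simp: seqbox_def)
    moreover have "z' \<in> seqbox S n0 z0"
      using calculation q box_sub[of n0 "fst q" "snd q" S z0] by (auto simp: P_def)
    ultimately have "P (Suc i) (m, z') \<and> Q i q (m, z')" using m q by (simp add: P_def Q_def)
    then show "\<exists>r. P (Suc i) r \<and> Q i q r" by blast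
  qed
  then obtain f where f: "\<And>n. P n (f n)" "\<And>n. Q n (f n) (f (Suc n))" by blast
  have mono: "seqbox S (fst (f n)) (snd (f n)) \<subseteq> seqbox S (fst (f m)) (snd (f m)) \<and> fst (f m) \<le> fst (f n) \<and>
      snd (f n) \<in> seqbox S (fst (f m)) (snd (f m))" if "m \<le> n" for m n
    using that
  proof (induction n rule: dec_induct)
    case base
    have "snd (f m) \<in> seqs S" using f(1)[of m] by (auto simp: P_def seqbox_def)
    then show ?case by (simp add: box_self)
  next
    case (step n)
    have "fst (f n) \<le> fst (f (Suc n))" "snd (f (Suc n)) \<in> seqbox S (fst (f n)) (snd (f n))"
      using f(2)[of n] by (auto simp: Q_def)
    moreover from this have "seqbox S (fst (f (Suc n))) (snd (f (Suc n))) \<subseteq> seqbox S (fst (f n)) (snd (f n))"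
      by (rule box_sub)
    ultimately show ?case using step.IH by auto
  qed
  have len: "n < fst (f (Suc n))" for n using f(1)[of "Suc n"] by (simp add: P_def)
  define z where "z k = snd (f (Suc k)) k" for k
  have zk: "snd (f n) k = z k" if "k < fst (f n)" for k n
  proof (cases "n \<le> Suc k")
    case True
    then show ?thesis using mono[OF True] that by (auto simp: z_def seqbox_def)
  next
    case False
    then show ?thesis using mono[of "Suc k" n] len[of k] by (auto simp: z_def seqbox_def)
  qed
  have "z \<in> seqs S" unfolding seqs_def
  proof (intro CollectI allI)
    fix k
    have "snd (f (Suc k)) \<in> seqs S" using f(1)[of "Suc k"] by (auto simp: P_def seqbox_def)
    then show "z k \<in> S k" by (simp add: seqs_def z_def)
  qed
  then have zb: "z \<in> seqbox S (fst (f n)) (snd (f n))" for n using zk[of _ n] by (simp add: seqbox_def)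
  have "z \<in> D i" for i using zb[of "Suc i"] f(2)[of i] by (auto simp: Q_def)
  moreover have "z \<in> seqbox S n0 z0"
    using zb[of 0] f(1)[of 0] box_sub[of n0 "fst (f 0)" "snd (f 0)" S z0] by (auto simp: P_def)
  ultimately show ?thesis by blast
qed

section \<open>The Baire property and meager relations\<close>

definition box_open :: "(nat \<Rightarrow> 'f set) \<Rightarrow> (nat \<Rightarrow> 'f) set \<Rightarrow> bool" where
  "box_open S U \<longleftrightarrow> (\<forall>z\<in>U \<inter> seqs S. \<exists>n. seqbox S n z \<subseteq> U)"

lemma borel_baire_property:
  fixes A :: "(nat \<Rightarrow> 'f::topological_space) set"
  assumes "A \<in> sets borel"
  shows "\<exists>U D. box_open S U \<and> (\<forall>i::nat. \<forall>z0. dense_below S 0 z0 (D i)) \<and>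
    (\<forall>z\<in>seqs S. (\<forall>i. z \<in> D i) \<longrightarrow> (z \<in> A \<longleftrightarrow> z \<in> U))"
proof -
  have "A \<in> sigma_sets UNIV {S. open S}" using assms by (simp add: borel_def)
  then show ?thesis
  proof induction
    case (Basic A)
    have "box_open S A" unfolding box_open_def
    proof
      fix z assume "z \<in> A \<inter> seqs S"
      then obtain n where "\<And>z'. (\<And>i. i < n \<Longrightarrow> z' i = z i) \<Longrightarrow> z' \<in> A"
        using open_fun_nhd[of A z] Basic by auto
      then show "\<exists>n. seqbox S n z \<subseteq> A" by (intro exI[of _ n]) (auto simp: seqbox_def)
    qed
    then show ?case using dense_below_UNIV by (intro exI[of _ A] exI[of _ "\<lambda>_. UNIV"]) auto
  next
    case Empty
    show ?case using dense_below_UNIV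
      by (intro exI[of _ "{}"] exI[of _ "\<lambda>_. UNIV"]) (auto simp: box_open_def)
  next
    case (Compl A)
    then obtain U D where U: "box_open S U" "\<And>(i::nat) z0. dense_below S 0 z0 (D i)"
      "\<And>z. z \<in> seqs S \<Longrightarrow> (\<And>i. z \<in> D i) \<Longrightarrow> (z \<in> A \<longleftrightarrow> z \<in> U)" by blast
    \<comment> \<open>\<open>V\<close> is the exterior of \<open>U\<close>. The union of
      \<open>U\<close> and \<open>V\<close> is open and dense, so only the boundary is
      neglected.\<close>
    define V where "V = {z. \<exists>n. seqbox S n z \<inter> U = {}}"
    define D' where "D' i = (case i of 0 \<Rightarrow> U \<union> V | Suc j \<Rightarrow> D j)" for i
    have "box_open S V" unfolding box_open_def
    proof
      fix z assume "z \<in> V \<inter> seqs S"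
      then obtain n where n: "seqbox S n z \<inter> U = {}" by (auto simp: V_def)
      have "seqbox S n z' \<inter> U = {}" if "z' \<in> seqbox S n z" for z'
        using box_sub[OF order_refl that] n by auto
      then show "\<exists>n. seqbox S n z \<subseteq> V" unfolding V_def by blast
    qed
    moreover have "dense_below S 0 z0 (U \<union> V)" for z0 unfolding dense_below_def
    proof (intro allI impI)
      fix n z assume z: "z \<in> seqbox S 0 z0"
      show "\<exists>m z'. n \<le> m \<and> z' \<in> seqbox S n z \<and> seqbox S m z' \<subseteq> U \<union> V"
      proof (cases "seqbox S n z \<inter> U = {}")
        case True
        have "seqbox S n z \<subseteq> V"
        proof
          fix z' assume "z' \<in> seqbox S n z"
          then have "seqbox S n z' \<inter> U = {}" using box_sub[OF order_refl] True by blast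
          then show "z' \<in> V" by (auto simp: V_def)
        qed
        moreover have "z \<in> seqbox S n z" using z by (auto simp: seqbox_def)
        ultimately show ?thesis by blast
      next
        case False
        then obtain z' where z': "z' \<in> seqbox S n z" "z' \<in> U" by auto
        then have "z' \<in> seqs S" by (auto simp: seqbox_def)
        then obtain m where "seqbox S m z' \<subseteq> U" using U(1) z'(2) by (auto simp: box_open_def)
        then have "seqbox S (max n m) z' \<subseteq> U" by (auto simp: seqbox_def)
        then show ?thesis using z' by (intro exI[of _ "max n m"] exI[of _ z']) auto
      qed
    qed
    then have "dense_below S 0 z0 (D' i)" for i z0 using U(2) by (cases i) (auto simp: D'_def)
    moreover have "z \<in> UNIV - A \<longleftrightarrow> z \<in> V" if "z \<in> seqs S" "\<And>i. z \<in> D' i" for z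
    proof -
      have "z \<in> D i" for i using that(2)[of "Suc i"] by (simp add: D'_def)
      then have "z \<in> A \<longleftrightarrow> z \<in> U" using U(3) that(1) by blast
      moreover have "z \<in> U \<union> V" using that(2)[of 0] by (simp add: D'_def)
      moreover have "z \<notin> V" if "z \<in> U" using that box_self[OF \<open>z \<in> seqs S\<close>] by (auto simp: V_def)
      ultimately show ?thesis by auto
    qed
    ultimately show ?case by (intro exI[of _ V] exI[of _ D']) blast
  next
    case (Union A)
    then obtain U D where U: "\<And>n. box_open S (U n)" "\<And>n (i::nat) z0. dense_below S 0 z0 (D n i)"
      "\<And>n z. z \<in> seqs S \<Longrightarrow> (\<And>i. z \<in> D n i) \<Longrightarrow> (z \<in> A n \<longleftrightarrow> z \<in> U n)" by metis
    have "box_open S (\<Union>n. U n)" unfolding box_open_def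
    proof
      fix z assume "z \<in> (\<Union>n. U n) \<inter> seqs S"
      then obtain n where "z \<in> U n \<inter> seqs S" by auto
      then obtain m where "seqbox S m z \<subseteq> U n" using U(1)[of n] unfolding box_open_def by auto
      then have "seqbox S m z \<subseteq> (\<Union>n. U n)" by auto
      then show "\<exists>m. seqbox S m z \<subseteq> (\<Union>n. U n)" by (rule exI)
    qed
    moreover have "z \<in> (\<Union>n. A n) \<longleftrightarrow> z \<in> (\<Union>n. U n)"
      if "z \<in> seqs S" "\<And>i. z \<in> D (fst (prod_decode i)) (snd (prod_decode i))" for z
    proof -
      have "z \<in> D n i" for n i using that(2)[of "prod_encode (n, i)"] by simp
      then have "z \<in> A n \<longleftrightarrow> z \<in> U n" for n using U(3)[OF that(1)] by simp
      then show ?thesis by simp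
    qed
    ultimately have "box_open S (\<Union>n. U n) \<and>
        (\<forall>(i::nat) z0. dense_below S 0 z0 (D (fst (prod_decode i)) (snd (prod_decode i)))) \<and>
        (\<forall>z\<in>seqs S. (\<forall>i. z \<in> D (fst (prod_decode i)) (snd (prod_decode i))) \<longrightarrow> (z \<in> (\<Union>n. A n)) = (z \<in> (\<Union>n. U n)))"
      using U(2) by simp
    then show ?case
      by (rule exI[THEN exI[of _ "\<Union>n. U n"], of _ "\<lambda>i. D (fst (prod_decode i)) (snd (prod_decode i))"])
  qed
qed

text \<open>\<open>seqs (prow rw p)\<close> is the space of pairs of binary sequences that agree on
  all coordinates of rows above \<open>p\<close>. Genericity of pairs is meant in this space, since
  in the full square such pairs may be negligible.\<close>

definition prow :: "(nat \<Rightarrow> nat) \<Rightarrow> nat \<Rightarrow> nat \<Rightarrow> (bool \<times> bool) set" where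
  "prow rw p k = {(a, b). p < rw k \<longrightarrow> a = b}"

text \<open>If \<open>R\<close> were not meager in the space of pairs, it would be comeager in some
  box. Flipping a coordinate \<open>k\<close> of row \<open>p\<close> in the first component is a
  homeomorphism of this space, so some pair and its flip both lie in \<open>R\<close>. They share
  the second component, hence symmetry and transitivity put an edge into \<open>R\<close>.\<close>

lemma meager_relation:
  fixes R :: "((nat \<Rightarrow> bool) \<times> (nat \<Rightarrow> bool)) set"
  assumes borel: "{z. (\<lambda>k. fst (z k), \<lambda>k. snd (z k)) \<in> R} \<in> sets borel"
    and "sym R" "trans R"
    and flip: "\<And>k x. rw k = p \<Longrightarrow> (\<And>i. i < k \<Longrightarrow> x i = sq k i) \<Longrightarrow> (x(k := False), x(k := True)) \<notin> R"
    and dense: "\<And>n x. \<exists>k\<ge>n. rw k = p \<and> (\<forall>i<n. sq k i = x i)"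
  shows "\<exists>D. (\<forall>i::nat. \<forall>z0. dense_below (prow rw p) 0 z0 (D i)) \<and>
    (\<forall>z\<in>seqs (prow rw p). (\<forall>i. z \<in> D i) \<longrightarrow> (\<lambda>k. fst (z k), \<lambda>k. snd (z k)) \<notin> R)"
proof -
  let ?S = "prow rw p"
  let ?R = "{z. (\<lambda>k. fst (z k), \<lambda>k. snd (z k)) \<in> R}"
  obtain U D where U: "box_open ?S U" "\<And>(i::nat) z0. dense_below ?S 0 z0 (D i)"
    "\<And>z. z \<in> seqs ?S \<Longrightarrow> (\<And>i. z \<in> D i) \<Longrightarrow> (z \<in> ?R \<longleftrightarrow> z \<in> U)"
    using borel_baire_property[OF borel, of ?S] by blast
  have "z \<notin> U" if z: "z \<in> seqs ?S" for z
  proof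
    assume "z \<in> U"
    then obtain n where n: "seqbox ?S n z \<subseteq> U" using U(1) z by (auto simp: box_open_def)
    obtain k where k: "n \<le> k" "rw k = p" "\<And>i. i < n \<Longrightarrow> sq k i = fst (z i)"
      using dense[of n "\<lambda>i. fst (z i)"] by auto
    define w where "w i = (if i < n then z i else if i < k then (sq k i, sq k i)
      else if i = k then (False, False) else z i)" for i
    define h where "h z' = z'(k := (\<not> fst (z' k), snd (z' k)))" for z' :: "nat \<Rightarrow> bool \<times> bool"
    have hh: "h (h z') = z'" for z' by (simp add: h_def)
    have hS: "h z' \<in> seqs ?S" if "z' \<in> seqs ?S" for z'
      using that k(2) by (auto simp: seqs_def prow_def h_def)
    have w: "w \<in> seqs ?S" using z by (auto simp: seqs_def prow_def w_def)
    have hbox: "h z'' \<in> seqbox ?S m (h z')" if "z'' \<in> seqbox ?S m z'" "k < m" for z' z'' m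
      using that hS[of z''] by (auto simp: seqbox_def h_def)
    have wn: "w \<in> seqbox ?S n z" using w k(1) by (auto simp: seqbox_def w_def)
    then have wU: "seqbox ?S (Suc k) w \<subseteq> U" using box_sub[of n "Suc k" w ?S z] k(1) n by auto
    \<comment> \<open>Even indices make the pair generic, odd indices its flip.\<close>
    define G where "G i = (if even i then D (i div 2) else h -` D (i div 2))" for i :: nat
    have "dense_below ?S (Suc k) w (G i)" for i
    proof (cases "even i")
      case True
      have "w \<in> seqbox ?S 0 w" using w by (rule box_self)
      then show ?thesis using True dense_below_sub[OF U(2)[of w "i div 2"]] by (simp add: G_def)
    next
      case False
      show ?thesis unfolding dense_below_def
      proof (intro allI impI)
        fix m z' assume m: "Suc k \<le> m" "z' \<in> seqbox ?S (Suc k) w"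
        then have "h z' \<in> seqbox ?S 0 (h z')" using hS by (auto simp: seqbox_def)
        then obtain m' z'' where m': "m \<le> m'" "z'' \<in> seqbox ?S m (h z')" "seqbox ?S m' z'' \<subseteq> D (i div 2)"
          using U(2)[of "h z'" "i div 2"] unfolding dense_below_def by blast
        have "h z'' \<in> seqbox ?S m z'" using hbox[OF m'(2)] m(1) by (simp add: hh)
        moreover have "seqbox ?S m' (h z'') \<subseteq> h -` D (i div 2)"
        proof
          fix y assume "y \<in> seqbox ?S m' (h z'')"
          then have "h y \<in> seqbox ?S m' z''" using hbox[of y m' "h z''"] m(1) m'(1) by (simp add: hh)
          then show "y \<in> h -` D (i div 2)" using m'(3) by auto
        qed
        ultimately show "\<exists>m' z''. m \<le> m' \<and> z'' \<in> seqbox ?S m z' \<and> seqbox ?S m' z'' \<subseteq> G i"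
          using m'(1) False by (auto simp: G_def)
      qed
    qed
    then obtain y where y: "y \<in> seqbox ?S (Suc k) w" "\<And>i. y \<in> G i"
      using dense_below_baire[of ?S "Suc k" w G] w by blast
    have yD: "y \<in> D i" "h y \<in> D i" for i
      using y(2)[of "2 * i"] y(2)[of "2 * i + 1"] by (auto simp: G_def)
    have yS: "y \<in> seqs ?S" using y(1) by (simp add: seqbox_def)
    have "y \<in> U" using wU y(1) by auto
    then have 1: "y \<in> ?R" using U(3)[OF yS yD(1)] by simp
    have yk: "y k = (False, False)" "\<And>i. i < k \<Longrightarrow> fst (y i) = sq k i"
      using y(1) k(1,3) by (auto simp: seqbox_def w_def)
    have "h y \<in> U"
    proof -
      have "h y \<in> seqbox ?S n z"
      proof -
        have "h y \<in> seqs ?S" using hS yS by blast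
        moreover have "h y i = z i" if "i < n" for i
          using that k(1) y(1) by (auto simp: h_def seqbox_def w_def)
        ultimately show ?thesis by (simp add: seqbox_def)
      qed
      then show ?thesis using n by auto
    qed
    then have 2: "h y \<in> ?R" using U(3)[OF hS[OF yS] yD(2)] by simp
    define x where "x i = fst (y i)" for i
    have "(\<lambda>i. fst (y i)) = x(k := False)" "(\<lambda>i. fst (h y i)) = x(k := True)"
      "(\<lambda>i. snd (h y i)) = (\<lambda>i. snd (y i))"
      using yk(1) by (auto simp: x_def h_def fun_eq_iff)
    then have "(x(k := False), \<lambda>i. snd (y i)) \<in> R" "(x(k := True), \<lambda>i. snd (y i)) \<in> R"
      using 1 2 by auto
    then have "(x(k := False), x(k := True)) \<in> R" using assms(2,3) by (meson symD transD)
    moreover have "(x(k := False), x(k := True)) \<notin> R"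
      by (rule flip) (use k(2) yk(2) in \<open>auto simp: x_def\<close>)
    ultimately show False by simp
  qed
  then have "\<forall>z\<in>seqs ?S. (\<forall>i. z \<in> D i) \<longrightarrow> (\<lambda>k. fst (z k), \<lambda>k. snd (z k)) \<notin> R"
    using U(3) by auto
  then show ?thesis using U(2) by blast
qed

section \<open>A Mycielski map that respects rows\<close>

definition agree :: "nat \<Rightarrow> nat \<Rightarrow> (nat \<Rightarrow> nat \<Rightarrow> 'b) \<Rightarrow> (nat \<Rightarrow> nat \<Rightarrow> 'b) \<Rightarrow> bool" where
  "agree N q X Y \<longleftrightarrow> (\<forall>a b. q \<le> a \<longrightarrow> a < N \<longrightarrow> b < N \<longrightarrow> X a b = Y a b)"

lemma agree_sym: "agree N q X Y \<Longrightarrow> agree N q Y X"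
  by (simp add: agree_def)

lemma agree_trans: "agree N q X Y \<Longrightarrow> agree N q Y Z \<Longrightarrow> agree N q X Z"
  by (simp add: agree_def)

lemma agree_mono: "agree N q X Y \<Longrightarrow> M \<le> N \<Longrightarrow> q \<le> r \<Longrightarrow> agree M r X Y"
  by (simp add: agree_def)

context
  fixes rw :: "nat \<Rightarrow> nat" and P :: "nat set" and n0 :: nat and u :: "nat \<Rightarrow> bool"
    and D :: "nat \<Rightarrow> nat \<Rightarrow> (nat \<Rightarrow> bool \<times> bool) set"
begin

text \<open>\<open>r\<close> gives the first \<open>L\<close> bits of the images of all
  \<open>X\<close> and reads only the upper left \<open>N\<close> by \<open>N\<close> square of
  \<open>X\<close>. Bit \<open>k\<close> sees only rows from \<open>rw k\<close> on, which is the
  coherence wanted of the limit. The first \<open>n0\<close> bits are fixed in order to stay in a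
  prescribed box.\<close>

definition approx :: "nat \<Rightarrow> nat \<Rightarrow> ((nat \<Rightarrow> nat \<Rightarrow> bool) \<Rightarrow> nat \<Rightarrow> bool) \<Rightarrow> bool" where
  "approx N L r \<longleftrightarrow> n0 \<le> L \<and> (\<forall>X k. k < n0 \<longrightarrow> r X k = u k) \<and>
     (\<forall>k<L. \<forall>X Y. agree N (rw k) X Y \<longrightarrow> r X k = r Y k)"

definition meets :: "nat \<Rightarrow> ((nat \<Rightarrow> nat \<Rightarrow> bool) \<Rightarrow> nat \<Rightarrow> bool) \<Rightarrow>
    nat \<times> nat \<times> (nat \<Rightarrow> nat \<Rightarrow> bool) \<times> (nat \<Rightarrow> nat \<Rightarrow> bool) \<Rightarrow> bool" where
  "meets L r t \<longleftrightarrow> (case t of (p, i, X, Y) \<Rightarrow> seqbox (prow rw p) L (\<lambda>k. (r X k, r Y k)) \<subseteq> D p i)"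

text \<open>Pairs of squares whose highest differing row is \<open>p\<close>. The value
  \<open>False\<close> outside the square picks one representative of each, so that there are
  finitely many tasks.\<close>

definition tasks :: "nat \<Rightarrow> (nat \<times> nat \<times> (nat \<Rightarrow> nat \<Rightarrow> bool) \<times> (nat \<Rightarrow> nat \<Rightarrow> bool)) set" where
  "tasks N = {(p, i, X, Y). p \<in> P \<and> p < N \<and> i < N \<and> agree N (Suc p) X Y \<and> \<not> agree N p X Y \<and>
     (\<forall>a b. \<not> (a < N \<and> b < N) \<longrightarrow> X a b = False) \<and> (\<forall>a b. \<not> (a < N \<and> b < N) \<longrightarrow> Y a b = False)}"

lemma finite_tasks: "finite (tasks N)"
proof -
  let ?F = "{X :: nat \<Rightarrow> nat \<Rightarrow> bool. \<forall>a b. \<not> (a < N \<and> b < N) \<longrightarrow> X a b = False}"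
  have "?F \<subseteq> (\<lambda>A a b. (a, b) \<in> A) ` Pow ({..<N} \<times> {..<N})"
  proof
    fix X assume "X \<in> ?F"
    then have "{(a, b). X a b} \<in> Pow ({..<N} \<times> {..<N})" by auto
    moreover have "X = (\<lambda>A a b. (a, b) \<in> A) {(a, b). X a b}" by simp
    ultimately show "X \<in> (\<lambda>A a b. (a, b) \<in> A) ` Pow ({..<N} \<times> {..<N})" by blast
  qed
  then have "finite ?F" by (rule finite_subset) simp
  then have "finite ({..<N} \<times> {..<N} \<times> ?F \<times> ?F)" by simp
  moreover have "tasks N \<subseteq> {..<N} \<times> {..<N} \<times> ?F \<times> ?F" by (auto simp: tasks_def)
  ultimately show ?thesis by (rule finite_subset[rotated])
qed

context
  assumes dense: "\<And>p i. p \<in> P \<Longrightarrow> dense_below (prow rw p) n0 (\<lambda>k. (u k, u k)) (D p i)"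
begin

lemma one_task:
  assumes r: "approx N L r" and t: "t \<in> tasks N"
  shows "\<exists>L'\<ge>L. \<exists>r'. approx N L' r' \<and> (\<forall>X. \<forall>k<L. r' X k = r X k) \<and> meets L' r' t"
proof -
  obtain p i X0 Y0 where tt: "t = (p, i, X0, Y0)" by (cases t)
  have p: "p \<in> P" "agree N (Suc p) X0 Y0" "\<not> agree N p X0 Y0" using t by (auto simp: tt tasks_def)
  define z where "z k = (if k < L then (r X0 k, r Y0 k) else (False, False))" for k
  have rxy: "r X0 k = r Y0 k" if "k < L" "p < rw k" for k
    using r that agree_mono[OF p(2), of N "rw k"] by (auto simp: approx_def)
  have "z \<in> seqbox (prow rw p) n0 (\<lambda>k. (u k, u k))"
    using r rxy by (auto simp: seqbox_def seqs_def prow_def z_def approx_def)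
  moreover have "n0 \<le> L" using r by (simp add: approx_def)
  ultimately obtain m z' where m: "L \<le> m" "z' \<in> seqbox (prow rw p) L z" "seqbox (prow rw p) m z' \<subseteq> D p i"
    using dense[OF p(1), of i] unfolding dense_below_def by blast
  \<comment> \<open>Inputs are told apart only from row \<open>rw k\<close> on. Where
    \<open>X0\<close> and \<open>Y0\<close> look the same in this sense, \<open>rw k\<close> exceeds
    \<open>p\<close> and \<open>z' k\<close> lies on the diagonal, so the two clauses do not
    conflict; all other inputs get \<open>False\<close>.\<close>
  define r' where "r' X k = (if k < L then r X k else if agree N (rw k) X X0 then fst (z' k)
     else if agree N (rw k) X Y0 then snd (z' k) else False)" for X k
  have "approx N m r'" unfolding approx_def
  proof (intro conjI allI impI)
    show "n0 \<le> m" using \<open>n0 \<le> L\<close> m(1) by simp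
    show "r' X k = u k" if "k < n0" for X k using that r \<open>n0 \<le> L\<close> by (auto simp: r'_def approx_def)
    fix k and X Y :: "nat \<Rightarrow> nat \<Rightarrow> bool" assume "k < m" and a: "agree N (rw k) X Y"
    have iff: "agree N (rw k) X Z \<longleftrightarrow> agree N (rw k) Y Z" for Z
      using a agree_sym agree_trans by blast
    show "r' X k = r' Y k"
    proof (cases "k < L")
      case True
      then have "r X k = r Y k" using r a by (simp add: approx_def)
      then show ?thesis using True by (simp add: r'_def)
    next
      case False
      then show ?thesis using iff[of X0] iff[of Y0] by (simp add: r'_def)
    qed
  qed
  moreover have "meets m r' t"
  proof -
    have "(r' X0 k, r' Y0 k) = z' k" if "k < m" for k
    proof (cases "k < L")
      case True
      then show ?thesis using m(2) by (auto simp: seqbox_def z_def r'_def)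
    next
      case False
      have "fst (z' k) = snd (z' k)" if "agree N (rw k) Y0 X0"
      proof -
        have "p < rw k"
        proof (rule ccontr)
          assume "\<not> p < rw k"
          then show False using p(3) agree_mono[OF agree_sym[OF that], of N p] by simp
        qed
        moreover have "z' k \<in> prow rw p k" using m(2) by (auto simp: seqbox_def seqs_def)
        ultimately show ?thesis by (auto simp: prow_def)
      qed
      moreover have "agree N (rw k) X0 X0" "agree N (rw k) Y0 Y0" by (auto simp: agree_def)
      ultimately show ?thesis using False by (auto simp: r'_def prod_eq_iff)
    qed
    then have "seqbox (prow rw p) m (\<lambda>k. (r' X0 k, r' Y0 k)) = seqbox (prow rw p) m z'"
      by (auto simp: seqbox_def)
    then show ?thesis using m(3) by (simp add: meets_def tt)
  qed
  ultimately show ?thesis using m(1) by (intro exI[of _ m] conjI exI[of _ r']) (auto simp: r'_def)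
qed

lemma meets_mono:
  assumes "meets L r t" "L \<le> L'" "\<And>X k. k < L \<Longrightarrow> r' X k = r X k"
  shows "meets L' r' t"
proof -
  obtain p i X0 Y0 where t: "t = (p, i, X0, Y0)" by (cases t)
  have "seqbox (prow rw p) L' (\<lambda>k. (r' X0 k, r' Y0 k)) \<subseteq> seqbox (prow rw p) L (\<lambda>k. (r X0 k, r Y0 k))"
    using assms(2,3) by (auto simp: seqbox_def)
  then show ?thesis using assms(1) by (auto simp: meets_def t)
qed

lemma finite_many_tasks:
  assumes "finite T" "T \<subseteq> tasks N" "approx N L r"
  shows "\<exists>L'\<ge>L. \<exists>r'. approx N L' r' \<and> (\<forall>X. \<forall>k<L. r' X k = r X k) \<and> (\<forall>t\<in>T. meets L' r' t)"
  using assms(1,2)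
proof (induction T)
  case empty
  then show ?case using assms(3) by auto
next
  case (insert t T)
  then obtain L1 r1 where 1: "L \<le> L1" "approx N L1 r1" "\<forall>X. \<forall>k<L. r1 X k = r X k" "\<forall>t\<in>T. meets L1 r1 t"
    by auto
  obtain L2 r2 where 2: "L1 \<le> L2" "approx N L2 r2" "\<forall>X. \<forall>k<L1. r2 X k = r1 X k" "meets L2 r2 t"
    using one_task[OF 1(2), of t] insert.prems by auto
  have "meets L2 r2 s" if "s \<in> T" for s
    by (rule meets_mono[OF _ 2(1)]) (use 1(4) 2(3) that in auto)
  then show ?case using 1 2 by (intro exI[of _ L2] conjI exI[of _ r2]) auto
qed

lemma stage_step:
  assumes "approx N L r"
  shows "\<exists>L'>L. \<exists>r'. approx (Suc N) L' r' \<and> (\<forall>X. \<forall>k<L. r' X k = r X k) \<and> (\<forall>t\<in>tasks (Suc N). meets L' r' t)"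
proof -
  define r1 where "r1 X k = (if k < L then r X k else False)" for X k
  have "approx (Suc N) (Suc L) r1" unfolding approx_def
  proof (intro conjI allI impI)
    show "n0 \<le> Suc L" using assms by (auto simp: approx_def)
    show "r1 X k = u k" if "k < n0" for X k using assms that by (auto simp: approx_def r1_def)
    fix k and X Y :: "nat \<Rightarrow> nat \<Rightarrow> bool" assume "agree (Suc N) (rw k) X Y"
    then have "agree N (rw k) X Y" by (rule agree_mono) auto
    then show "r1 X k = r1 Y k" using assms by (auto simp: approx_def r1_def)
  qed
  from finite_many_tasks[OF finite_tasks order_refl this] obtain L' r'
    where "Suc L \<le> L'" "approx (Suc N) L' r'" "\<forall>X. \<forall>k<Suc L. r' X k = r1 X k"
      "\<forall>t\<in>tasks (Suc N). meets L' r' t" by auto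
  then show ?thesis by (intro exI[of _ L'] conjI exI[of _ r']) (auto simp: r1_def)
qed

text \<open>Two points whose highest differing row is \<open>p\<close> become a generic pair for
  that row. Each stage is extended to meet the finitely many requirements on squares of its size,
  and every pair of points is caught by all large squares.\<close>

theorem mycielski_rows:
  "\<exists>\<rho> :: (nat \<Rightarrow> nat \<Rightarrow> bool) \<Rightarrow> nat \<Rightarrow> bool.
     (\<forall>X k. k < n0 \<longrightarrow> \<rho> X k = u k) \<and>
     (\<forall>k X Y. agree (Suc k) (rw k) X Y \<longrightarrow> \<rho> X k = \<rho> Y k) \<and>
     (\<forall>p X Y i. p \<in> P \<longrightarrow> (\<forall>r>p. X r = Y r) \<longrightarrow> X p \<noteq> Y p \<longrightarrow> (\<lambda>k. (\<rho> X k, \<rho> Y k)) \<in> D p i)"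
proof -
  have "\<exists>f. \<forall>N. (approx N (fst (f N)) (snd (f N)) \<and> N \<le> fst (f N) \<and> (\<forall>t\<in>tasks N. meets (fst (f N)) (snd (f N)) t)) \<and>
      (fst (f N) < fst (f (Suc N)) \<and> (\<forall>X. \<forall>k<fst (f N). snd (f (Suc N)) X k = snd (f N) X k))"
  proof (rule dependent_nat_choice)
    show "\<exists>q. approx 0 (fst q) (snd q) \<and> 0 \<le> fst q \<and> (\<forall>t\<in>tasks 0. meets (fst q) (snd q) t)"
      by (intro exI[of _ "(n0, \<lambda>X k. u k)"]) (auto simp: approx_def tasks_def)
  next
    fix q N assume q: "approx N (fst q) (snd q) \<and> N \<le> fst q \<and> (\<forall>t\<in>tasks N. meets (fst q) (snd q) t)"
    then obtain L' r' where "fst q < L'" "approx (Suc N) L' r'" "\<forall>X. \<forall>k<fst q. r' X k = snd q X k"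
      "\<forall>t\<in>tasks (Suc N). meets L' r' t" using stage_step[of N "fst q" "snd q"] by auto
    then show "\<exists>q'. (approx (Suc N) (fst q') (snd q') \<and> Suc N \<le> fst q' \<and> (\<forall>t\<in>tasks (Suc N). meets (fst q') (snd q') t)) \<and>
      fst q < fst q' \<and> (\<forall>X. \<forall>k<fst q. snd q' X k = snd q X k)"
      using q by (intro exI[of _ "(L', r')"]) auto
  qed
  then obtain f where f: "\<And>N. approx N (fst (f N)) (snd (f N))" "\<And>N. N \<le> fst (f N)"
    "\<And>N t. t \<in> tasks N \<Longrightarrow> meets (fst (f N)) (snd (f N)) t" "\<And>N. fst (f N) < fst (f (Suc N))"
    "\<And>N X k. k < fst (f N) \<Longrightarrow> snd (f (Suc N)) X k = snd (f N) X k" by metis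
  have ext: "snd (f M) X k = snd (f N) X k \<and> fst (f N) \<le> fst (f M)" if "N \<le> M" "k < fst (f N)" for N M X k
    using that
  proof (induction M rule: dec_induct)
    case (step M)
    then show ?case using f(5)[of k M X] f(4)[of M] by auto
  qed simp
  \<comment> \<open>Stage \<open>Suc k\<close> has at least \<open>Suc k\<close> bits and reads
    \<open>Suc k\<close> rows and columns, whence the bound in the coherence clause.\<close>
  define \<rho> where "\<rho> X k = snd (f (Suc k)) X k" for X k
  have rho: "\<rho> X k = snd (f N) X k" if "k < fst (f N)" for X k N
  proof (cases "N \<le> Suc k")
    case True
    then show ?thesis using ext[OF True that] by (simp add: \<rho>_def)
  next
    case False
    have "k < fst (f (Suc k))" using f(2)[of "Suc k"] by simp
    then show ?thesis using ext[of "Suc k" N k X] False by (simp add: \<rho>_def)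
  qed
  have cons: "\<rho> X k = \<rho> Y k" if "agree (Suc k) (rw k) X Y" for X Y k
    using f(1)[of "Suc k"] f(2)[of "Suc k"] that by (auto simp: \<rho>_def approx_def)
  have "(\<lambda>k. (\<rho> X k, \<rho> Y k)) \<in> D p i" if p: "p \<in> P" and eq: "\<forall>r>p. X r = Y r" and ne: "X p \<noteq> Y p" for p X Y i
  proof -
    obtain b where b: "X p b \<noteq> Y p b" using ne by auto
    \<comment> \<open>Large enough to see row \<open>p\<close>, a column where the points differ
      there, and the requirement \<open>i\<close>.\<close>
    define N where "N = Suc (max p (max i b))"
    define cut where "cut Z = (\<lambda>a b. if a < N \<and> b < N then Z a b else False)" for Z :: "nat \<Rightarrow> nat \<Rightarrow> bool"
    have cut: "agree N q (cut Z) Z" for q Z by (auto simp: agree_def cut_def)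
    have "agree N (Suc p) X Y" using eq by (auto simp: agree_def)
    then have "agree N (Suc p) (cut X) (cut Y)" using cut agree_sym agree_trans by blast
    moreover have "\<not> agree N p (cut X) (cut Y)"
    proof
      assume "agree N p (cut X) (cut Y)"
      moreover have "p < N" "b < N" by (auto simp: N_def)
      ultimately have "cut X p b = cut Y p b" unfolding agree_def by blast
      then show False using b \<open>p < N\<close> \<open>b < N\<close> by (simp add: cut_def)
    qed
    ultimately have "(p, i, cut X, cut Y) \<in> tasks N" using p by (auto simp: tasks_def cut_def N_def)
    from f(3)[OF this] have sub: "seqbox (prow rw p) (fst (f N)) (\<lambda>k. (snd (f N) (cut X) k, snd (f N) (cut Y) k)) \<subseteq> D p i"
      by (simp add: meets_def)
    have "snd (f N) (cut Z) k = \<rho> Z k" if "k < fst (f N)" for Z k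
      using rho[OF that, of Z] f(1)[of N] cut[of "rw k" Z] that unfolding approx_def by metis
    moreover have "(\<lambda>k. (\<rho> X k, \<rho> Y k)) \<in> seqs (prow rw p)"
    proof -
      have "\<rho> X k = \<rho> Y k" if "p < rw k" for k
        by (rule cons) (use eq that in \<open>auto simp: agree_def\<close>)
      then show ?thesis by (auto simp: seqs_def prow_def)
    qed
    ultimately have "(\<lambda>k. (\<rho> X k, \<rho> Y k)) \<in> seqbox (prow rw p) (fst (f N)) (\<lambda>k. (snd (f N) (cut X) k, snd (f N) (cut Y) k))"
      by (simp add: seqbox_def)
    then show ?thesis using sub by auto
  qed
  moreover have "\<rho> X k = u k" if "k < n0" for X k using f(1)[of "Suc k"] that by (auto simp: \<rho>_def approx_def)
  ultimately show ?thesis using cons by (intro exI[of _ \<rho>]) blast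
qed

end
end

lemma continuous_rows:
  assumes "\<And>k X Y. agree (Suc k) (rw k) X Y \<Longrightarrow> \<rho> X k = \<rho> Y k"
  shows "continuous_on UNIV (\<rho> :: (nat \<Rightarrow> nat \<Rightarrow> bool) \<Rightarrow> nat \<Rightarrow> bool)"
proof (rule continuous_on_coordinatewise_then_product)
  fix k
  define V where "V X = {Y :: nat \<Rightarrow> nat \<Rightarrow> bool. \<forall>a\<le>k. \<forall>b\<le>k. Y a b = X a b}" for X
  have rV: "\<rho> X k = \<rho> Y k" if "Y \<in> V X" for X Y
    by (rule assms) (use that in \<open>auto simp: agree_def V_def less_Suc_eq_le\<close>)
  show "continuous_on UNIV (\<lambda>X. \<rho> X k)"
  proof (rule continuous_on_locally[where U = V])
    fix X :: "nat \<Rightarrow> nat \<Rightarrow> bool"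
    have "open {Y :: nat \<Rightarrow> nat \<Rightarrow> bool. Y a b = X a b}" for a b
    proof -
      have "open ((\<lambda>Y :: nat \<Rightarrow> nat \<Rightarrow> bool. Y a b) -` {X a b})"
        by (rule open_vimage[OF open_discrete])
          (rule continuous_on_product_then_coordinatewise[OF continuous_on_coord])
      then show ?thesis by (simp add: vimage_def)
    qed
    then have "open (\<Inter>a\<in>{..k}. \<Inter>b\<in>{..k}. {Y. Y a b = X a b})" by (intro open_INT) auto
    moreover have "(\<Inter>a\<in>{..k}. \<Inter>b\<in>{..k}. {Y. Y a b = X a b}) = V X" by (auto simp: V_def)
    ultimately show "open (V X)" by simp
    show "X \<in> V X" by (simp add: V_def)
    have "continuous_on (UNIV \<inter> V X) (\<lambda>Y. \<rho> X k)" by (rule continuous_on_const)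
    then show "continuous_on (UNIV \<inter> V X) (\<lambda>X. \<rho> X k)" by (rule continuous_on_eq) (simp add: rV)
  qed
qed

section \<open>Frames\<close>

definition pre :: "(nat \<Rightarrow> bool) \<Rightarrow> nat \<Rightarrow> bool list" where
  "pre x K = map x [0..<K]"

lemma length_pre [simp]: "length (pre x K) = K"
  by (simp add: pre_def)

lemma nth_pre [simp]: "k < K \<Longrightarrow> pre x K ! k = x k"
  by (simp add: pre_def)

lemma pre_Suc: "pre x (Suc K) = pre x K @ [x K]"
  by (simp add: pre_def)

lemma take_pre: "k \<le> K \<Longrightarrow> take k (pre x K) = pre x k"
  by (simp add: pre_def take_map)

lemma pre_cong: "(\<And>i. i < K \<Longrightarrow> x i = y i) \<Longrightarrow> pre x K = pre y K"
  by (simp add: pre_def)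

lemma pre_eq_iff: "pre x K = pre y K \<longleftrightarrow> (\<forall>i<K. x i = y i)"
  by (auto simp: pre_def)

lemma pre_fun_upd: "k < K \<Longrightarrow> pre (x(k := b)) K = (pre x K)[k := b]"
  by (rule nth_equalityI) (auto simp: nth_list_update)

text \<open>\<open>Inl j\<close> holds coordinate \<open>j\<close> of the code of a point.
  \<open>Inr (k, n, m)\<close> holds entry \<open>m\<close> of a witness that an edge of stage
  \<open>k\<close> separates the \<open>n\<close>-th leaf function of its row. Storing witnesses
  turns inequivalence, which is only Borel, into a closed condition.\<close>

type_synonym 'j cell = "'j + nat \<times> nat \<times> nat"
type_synonym 'j config = "bool list \<Rightarrow> 'j cell \<Rightarrow> nat"

definition base :: "('j cell \<Rightarrow> nat) \<Rightarrow> 'j \<Rightarrow> nat" where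
  "base c j = c (Inl j)"

definition simL :: "('j \<Rightarrow> nat) \<Rightarrow> nat \<Rightarrow> ('j \<Rightarrow> nat) \<Rightarrow> ('j \<Rightarrow> nat) \<Rightarrow> bool" where
  "simL lev p c c' \<longleftrightarrow> (\<forall>j. p < lev j \<longrightarrow> c j = c' j)"

definition lvL :: "(nat \<Rightarrow> (('c \<Rightarrow> 'x) \<times> nat) list) \<Rightarrow> nat \<Rightarrow> 'c \<Rightarrow> ('x \<times> nat) set" where
  "lvL Lf p c = (\<lambda>(l, i). (l c, i)) ` set (Lf p)"

lemma level_sim_simL: "level_sim (simL lev)"
  unfolding level_sim_def
proof (intro conjI allI impI)
  fix p
  show "equivp (simL lev p)" by (rule equivpI) (auto simp: reflp_def symp_def transp_def simL_def)
qed (auto simp: simL_def)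

text \<open>A frame is a closed set of codes whose coordinates carry levels, together with finitely many
  leaf functions for every row; a point of the frame on row \<open>p\<close> has to avoid equivalence classes of its
  leaves. The sets \<open>DR i\<close> and maps \<open>gR i\<close> code the complement of \<open>R i\<close>. The coordinate \<open>k\<close> of a finite
  binary string belongs to row \<open>rw k\<close>; an edge of stage \<open>k\<close> joins two strings that extend \<open>sq k\<close> and
  differ exactly at \<open>k\<close>.\<close>

locale frame =
  fixes lev :: "'j::countable \<Rightarrow> nat"
    and A :: "('j \<Rightarrow> nat) set"
    and Lf :: "nat \<Rightarrow> ((('j \<Rightarrow> nat) \<Rightarrow> 'x::polish_space) \<times> nat) list"
    and R :: "nat \<Rightarrow> ('x \<times> 'x) set"
    and DR :: "nat \<Rightarrow> (nat \<Rightarrow> nat) set"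
    and gR :: "nat \<Rightarrow> (nat \<Rightarrow> nat) \<Rightarrow> 'x \<times> 'x"
    and rw :: "nat \<Rightarrow> nat" and sq :: "nat \<Rightarrow> nat \<Rightarrow> bool" and act :: "nat \<Rightarrow> 'j set"
  assumes closed_A: "closed A"
    and cont_Lf: "\<And>p l i. (l, i) \<in> set (Lf p) \<Longrightarrow> continuous_on A l"
    and equiv_R: "\<And>i. equiv UNIV (R i)"
    and borel_R: "\<And>i. R i \<in> sets borel"
    and closed_DR: "\<And>i. closed (DR i)"
    and cont_gR: "\<And>i. continuous_on (DR i) (gR i)"
    and image_gR: "\<And>i. gR i ` DR i = - R i"
    and act: "\<And>j. \<exists>K0. \<forall>K\<ge>K0. j \<in> act K"
begin

definition edge :: "nat \<Rightarrow> ('j cell \<Rightarrow> nat) \<Rightarrow> ('j cell \<Rightarrow> nat) \<Rightarrow> bool" where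
  "edge k c d \<longleftrightarrow> (\<forall>n<length (Lf (rw k)). case Lf (rw k) ! n of (l, i) \<Rightarrow>
     (\<lambda>m. c (Inr (k, n, m))) \<in> DR i \<and> gR i (\<lambda>m. c (Inr (k, n, m))) = (l (base c), l (base d)))"

text \<open>The middle clause is coherence: coordinate \<open>j\<close> may depend only on bits of
  rows at or above its level. It lets points whose upper rows agree share their upper data.\<close>

definition legal :: "nat \<Rightarrow> 'j config \<Rightarrow> bool" where
  "legal K \<Gamma> \<longleftrightarrow>
     (\<forall>u. length u = K \<longrightarrow> base (\<Gamma> u) \<in> A) \<and>
     (\<forall>u v j. length u = K \<longrightarrow> length v = K \<longrightarrow> (\<forall>k<K. lev j \<le> rw k \<longrightarrow> u ! k = v ! k) \<longrightarrow>
        \<Gamma> u (Inl j) = \<Gamma> v (Inl j)) \<and>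
     (\<forall>k u. k < K \<longrightarrow> length u = K \<longrightarrow> take k u = pre (sq k) k \<longrightarrow> \<not> u ! k \<longrightarrow> edge k (\<Gamma> u) (\<Gamma> (u[k := True])))"

text \<open>Only finitely many cells are frozen at stage \<open>K\<close>, and \<open>act\<close>
  can delay the freezing of coordinates. Witness cells for an edge of stage \<open>k\<close> are
  frozen only at stages after \<open>k\<close>.\<close>

definition W :: "nat \<Rightarrow> 'j cell set" where
  "W K = {c. to_nat c < K \<and> (case c of Inl j \<Rightarrow> j \<in> act K | Inr (k, n, m) \<Rightarrow> k < K)}"

definition win :: "nat \<Rightarrow> 'j config \<Rightarrow> 'j config set" where
  "win K \<Gamma> = {\<Gamma>'. \<forall>u c. length u = K \<longrightarrow> c \<in> W K \<longrightarrow> \<Gamma>' u c = \<Gamma> u c}"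

definition NB :: "nat \<Rightarrow> 'j config \<Rightarrow> (('j \<Rightarrow> nat) \<Rightarrow> bool) \<Rightarrow> 'j config set" where
  "NB K \<Gamma> Q = {\<Gamma>'\<in>win K \<Gamma>. legal K \<Gamma>' \<and> (\<forall>u. length u = K \<longrightarrow> Q (base (\<Gamma>' u)))}"

definition dbl :: "nat \<Rightarrow> 'j config \<Rightarrow> (('j \<Rightarrow> nat) \<Rightarrow> bool) \<Rightarrow> 'j config set" where
  "dbl K \<Gamma> Q = {\<Gamma>'. legal (Suc K) \<Gamma>' \<and>
     (\<forall>u b c. length u = K \<longrightarrow> c \<in> W K \<longrightarrow> \<Gamma>' (u @ [b]) c = \<Gamma> u c) \<and>
     (\<forall>u. length u = Suc K \<longrightarrow> Q (base (\<Gamma>' u)))}"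

definition simS :: "nat \<Rightarrow> 'j config \<Rightarrow> 'j config \<Rightarrow> bool" where
  "simS p \<Gamma> \<Gamma>' \<longleftrightarrow> (\<forall>u j. p < lev j \<longrightarrow> \<Gamma> u (Inl j) = \<Gamma>' u (Inl j))"

definition lvS :: "nat \<Rightarrow> nat \<Rightarrow> 'j config \<Rightarrow> ('x \<times> nat) set" where
  "lvS K p \<Gamma> = (\<Union>u\<in>{u. length u = K}. lvL Lf p (base (\<Gamma> u)))"

lemma level_sim_simS: "level_sim simS"
  unfolding level_sim_def
proof (intro conjI allI impI)
  fix p
  show "equivp (simS p)" by (rule equivpI) (auto simp: reflp_def symp_def transp_def simS_def)
qed (auto simp: simS_def)

lemma win_refl: "\<Gamma> \<in> win K \<Gamma>"
  by (simp add: win_def)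

lemma win_eq: "\<Gamma>' \<in> win K \<Gamma> \<Longrightarrow> win K \<Gamma>' = win K \<Gamma>"
  by (auto simp: win_def)

lemma finite_W: "finite (W K)"
proof -
  have "W K \<subseteq> to_nat -` {..<K}" by (auto simp: W_def)
  moreover have "finite (to_nat -` {..<K} :: 'j cell set)" by (rule finite_vimageI) auto
  ultimately show ?thesis by (rule finite_subset)
qed

lemma countable_win: "countable (range (win K))"
proof -
  let ?I = "{u :: bool list. length u = K} \<times> W K"
  let ?g = "\<lambda>f. {\<Gamma> :: 'j config. \<forall>u c. length u = K \<longrightarrow> c \<in> W K \<longrightarrow> \<Gamma> u c = f (u, c)}"
  have "finite {u :: bool list. length u = K}" using finite_lists_length_eq[of "UNIV :: bool set" K] by simp
  then have "finite ?I" using finite_W by simp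
  then have "countable (PiE ?I (\<lambda>_. UNIV :: nat set))" by (rule countable_PiE) simp
  then have "countable (?g ` PiE ?I (\<lambda>_. UNIV))" by simp
  moreover have "range (win K) \<subseteq> ?g ` PiE ?I (\<lambda>_. UNIV)"
  proof
    fix w assume "w \<in> range (win K)"
    then obtain \<Gamma> where w: "w = win K \<Gamma>" by auto
    let ?f = "restrict (\<lambda>(u, c). \<Gamma> u c) ?I"
    have "?f \<in> PiE ?I (\<lambda>_. UNIV)" by auto
    moreover have "w = ?g ?f" by (auto simp: w win_def)
    ultimately show "w \<in> ?g ` PiE ?I (\<lambda>_. UNIV)" by blast
  qed
  ultimately show ?thesis by (rule countable_subset[rotated])
qed

lemma live_refine:
  assumes "live sim lv R' H S c"
  shows "\<exists>\<Gamma>'\<in>S. live sim lv R' H (S \<inter> win K \<Gamma>') c"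
proof -
  have "S = (\<Union>w\<in>range (win K). S \<inter> w)" using win_refl by auto
  then have "live sim lv R' H (\<Union>w\<in>range (win K). S \<inter> w) c" using assms by simp
  from live_UN[OF countable_win this] obtain \<Gamma> where *: "live sim lv R' H (S \<inter> win K \<Gamma>) c" by auto
  from live_nonempty[OF this] obtain \<Gamma>' where "\<Gamma>' \<in> S" "\<Gamma>' \<in> win K \<Gamma>" by auto
  then show ?thesis using * win_eq[of \<Gamma>' K \<Gamma>] by (intro bexI[of _ \<Gamma>']) auto
qed

text \<open>Strings ending in \<open>False\<close> copy the first configuration, those ending in
  \<open>True\<close> the second. Old edges are inherited; the only new edge joins the two copies of
  \<open>sq K\<close>, and its witness is chosen here. The cells of this witness lie outside
  \<open>W K\<close>, so the common window is not disturbed.\<close>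

definition joinc :: "nat \<Rightarrow> 'j config \<times> 'j config \<Rightarrow> 'j config" where
  "joinc K a = (\<lambda>v c. case c of
       Inl j \<Rightarrow> (if last v then snd a else fst a) (butlast v) (Inl j)
     | Inr (k, n, m) \<Rightarrow> if k = K \<and> v = pre (sq K) K @ [False]
         then (case Lf (rw K) ! n of (l, i) \<Rightarrow>
           (SOME e. e \<in> DR i \<and> gR i e = (l (base (fst a (pre (sq K) K))), l (base (snd a (pre (sq K) K)))))) m
         else (if last v then snd a else fst a) (butlast v) (Inr (k, n, m)))"

lemma base_joinc: "base (joinc K a v) = base ((if last v then snd a else fst a) (butlast v))"
  by (auto simp: base_def joinc_def fun_eq_iff)

lemma joinc_dbl:
  assumes a: "fst a \<in> NB K \<Gamma> Q" "snd a \<in> NB K \<Gamma> Q" and sim: "simS (rw K) (fst a) (snd a)"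
    and sep: "\<And>l i. (l, i) \<in> set (Lf (rw K)) \<Longrightarrow>
      (l (base (fst a (pre (sq K) K))), l (base (snd a (pre (sq K) K)))) \<notin> R i"
  shows "joinc K a \<in> dbl K \<Gamma> Q"
proof -
  let ?h = "joinc K a"
  let ?b = "\<lambda>v. (if last v then snd a else fst a)"
  have leg: "legal K (?b v)" for v using a by (auto simp: NB_def)
  have "legal (Suc K) ?h" unfolding legal_def
  proof (intro conjI allI impI)
    fix u :: "bool list" assume "length u = Suc K"
    then show "base (?h u) \<in> A" using leg[of u] by (simp add: base_joinc legal_def)
  next
    fix u v :: "bool list" and j
    assume uv: "length u = Suc K" "length v = Suc K" and eq: "\<forall>k<Suc K. lev j \<le> rw k \<longrightarrow> u ! k = v ! k"
    have "butlast u ! k = butlast v ! k" if "k < K" "lev j \<le> rw k" for k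
      using that uv eq by (simp add: nth_butlast)
    then have same: "\<Gamma>' (butlast u) (Inl j) = \<Gamma>' (butlast v) (Inl j)" if "legal K \<Gamma>'" for \<Gamma>'
      using that uv unfolding legal_def by simp
    show "?h u (Inl j) = ?h v (Inl j)"
    proof (cases "lev j \<le> rw K")
      case True
      have "u \<noteq> []" "v \<noteq> []" using uv by auto
      then have "last u = last v" using True eq uv by (simp add: last_conv_nth)
      then show ?thesis using same[OF leg[of u]] by (simp add: joinc_def)
    next
      case False
      then have "fst a w (Inl j) = snd a w (Inl j)" for w using sim by (simp add: simS_def)
      then show ?thesis using same[OF leg[of u]] by (simp add: joinc_def)
    qed
  next
    fix k u assume k: "k < Suc K" "length u = Suc K" "take k u = pre (sq k) k" "\<not> u ! k"
    obtain w b where u: "u = w @ [b]" "length w = K" using k(2) by (metis length_Suc_conv_rev)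
    show "edge k (?h u) (?h (u[k := True]))"
    proof (cases "k = K")
      case True
      then have u': "u = pre (sq K) K @ [False]" "u[k := True] = pre (sq K) K @ [True]"
        using k(3,4) u by (simp_all add: list_update_append nth_append)
      show ?thesis unfolding edge_def
      proof (intro allI impI)
        fix n assume "n < length (Lf (rw k))"
        obtain l i where li: "Lf (rw k) ! n = (l, i)" by (cases "Lf (rw k) ! n")
        then have "(l, i) \<in> set (Lf (rw K))" using \<open>n < length (Lf (rw k))\<close> True by (metis nth_mem)
        let ?P = "\<lambda>e. e \<in> DR i \<and> gR i e = (l (base (fst a (pre (sq K) K))), l (base (snd a (pre (sq K) K))))"
        have "(l (base (fst a (pre (sq K) K))), l (base (snd a (pre (sq K) K)))) \<in> gR i ` DR i"
          using sep[OF \<open>(l, i) \<in> set (Lf (rw K))\<close>] image_gR by simp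
        then have "\<exists>e. ?P e" by auto
        then have "?P (SOME e. ?P e)" by (rule someI_ex)
        moreover have "(\<lambda>m. ?h u (Inr (k, n, m))) = (SOME e. ?P e)"
          using True li u' by (simp add: joinc_def)
        ultimately show "case Lf (rw k) ! n of (l, i) \<Rightarrow> (\<lambda>m. ?h u (Inr (k, n, m))) \<in> DR i \<and>
            gR i (\<lambda>m. ?h u (Inr (k, n, m))) = (l (base (?h u)), l (base (?h (u[k := True]))))"
          using li u' by (simp add: base_joinc)
      qed
    next
      case False
      then have "k < K" using k(1) by simp
      then have uk: "u[k := True] = w[k := True] @ [b]" using u by (simp add: list_update_append)
      have "take k w = pre (sq k) k" "\<not> w ! k" using k(3,4) u \<open>k < K\<close> by (auto simp: nth_append)
      then have "edge k (?b u w) (?b u (w[k := True]))"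
        using leg[of u] \<open>k < K\<close> u(2) by (simp add: legal_def)
      moreover have "(\<lambda>m. ?h u (Inr (k, n, m))) = (\<lambda>m. ?b u w (Inr (k, n, m)))" for n
        using False u by (auto simp: joinc_def)
      moreover have "base (?h u) = base (?b u w)" by (simp add: base_joinc u(1))
      moreover have "base (?h (u[k := True])) = base (?b u (w[k := True]))"
        unfolding uk by (simp add: base_joinc u(1))
      ultimately show ?thesis by (simp add: edge_def)
    qed
  qed
  moreover have "?h (u @ [b]) c = \<Gamma> u c" if "length u = K" "c \<in> W K" for u b c
  proof -
    have "?b [b] u c = \<Gamma> u c" using a that by (auto simp: NB_def win_def)
    moreover have "?h (u @ [b]) c = ?b [b] u c"
      using that(2) by (auto simp: joinc_def W_def split: sum.splits prod.splits)
    ultimately show ?thesis by simp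
  qed
  moreover have "Q (base (?h u))" if "length u = Suc K" for u
    using a that by (auto simp: base_joinc NB_def)
  ultimately show ?thesis by (simp add: dbl_def)
qed

text \<open>Amalgamation at level \<open>rw K\<close> provides pairs that share all data above this
  level and have inequivalent leaves at \<open>sq K\<close>, exactly what joining requires. The
  height is preserved because each leaf of the join is a leaf of one of the copies.\<close>

lemma live_double:
  assumes "rw K < H" "live simS (lvS K) R H (NB K \<Gamma> Q) c"
  shows "live simS (lvS (Suc K)) R H (dbl K \<Gamma> Q) (joinc K (c, c))"
proof -
  let ?p = "rw K" and ?s = "pre (sq K) K"
  let ?I = "{..<length (Lf ?p)}"
  let ?f = "\<lambda>n \<Gamma>. fst (Lf ?p ! n) (base (\<Gamma> ?s))" and ?e = "\<lambda>n. snd (Lf ?p ! n)"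
  let ?S = "{(a, b). a \<in> NB K \<Gamma> Q \<and> b \<in> NB K \<Gamma> Q \<and> simS ?p a b \<and> (\<forall>n\<in>?I. (?f n a, ?f n b) \<notin> R (?e n))}"
  have "live (sim2 simS) (lv2 (lvS K)) R H ?S (c, c)"
  proof (rule live_amalgam[OF level_sim_simS _ assms(1) equiv_R _ assms(2)])
    fix n a assume "n \<in> ?I"
    then have "Lf ?p ! n \<in> set (Lf ?p)" by simp
    then have "(?f n a, ?e n) \<in> lvL Lf ?p (base (a ?s))" unfolding lvL_def by (force simp: case_prod_beta)
    then show "(?f n a, ?e n) \<in> lvS K ?p a" unfolding lvS_def by (intro UN_I[of ?s]) auto
  qed simp
  then have "live simS (lvS (Suc K)) R H (joinc K ` ?S) (joinc K (c, c))"
  proof (rule live_map[rotated 2])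
    fix p and x y :: "'j config \<times> 'j config" assume "sim2 simS p x y"
    then show "simS p (joinc K x) (joinc K y)" by (auto simp: sim2_def simS_def joinc_def)
  next
    fix p and x :: "'j config \<times> 'j config"
    show "lvS (Suc K) p (joinc K x) \<subseteq> lv2 (lvS K) p x"
      unfolding lvS_def lv2_def
    proof
      fix z assume "z \<in> (\<Union>u\<in>{u. length u = Suc K}. lvL Lf p (base (joinc K x u)))"
      then obtain u where "length u = Suc K" "z \<in> lvL Lf p (base ((if last u then snd x else fst x) (butlast u)))"
        by (auto simp: base_joinc)
      moreover from this have "length (butlast u) = K" by simp
      ultimately show "z \<in> (\<Union>u\<in>{u. length u = K}. lvL Lf p (base (fst x u))) \<union>
          (\<Union>u\<in>{u. length u = K}. lvL Lf p (base (snd x u)))" by (auto split: if_splits)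
    qed
  qed
  moreover have "joinc K ` ?S \<subseteq> dbl K \<Gamma> Q"
  proof (intro image_subsetI)
    fix x assume x: "x \<in> ?S"
    show "joinc K x \<in> dbl K \<Gamma> Q"
    proof (rule joinc_dbl)
      show "(l (base (fst x ?s)), l (base (snd x ?s))) \<notin> R i" if li: "(l, i) \<in> set (Lf ?p)" for l i
      proof -
        obtain n where "n < length (Lf ?p)" "Lf ?p ! n = (l, i)" using li unfolding in_set_conv_nth by metis
        moreover have "\<forall>n<length (Lf ?p). (?f n (fst x), ?f n (snd x)) \<notin> R (?e n)" using x by auto
        ultimately show ?thesis by fastforce
      qed
    qed (use x in auto)
  qed
  ultimately show ?thesis by (rule live_mono)
qed

lemma dbl_win_NB: "\<Gamma>' \<in> dbl K \<Gamma> Q \<Longrightarrow> dbl K \<Gamma> Q \<inter> win (Suc K) \<Gamma>' \<subseteq> NB (Suc K) \<Gamma>' Q"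
  by (auto simp: dbl_def NB_def)

end

section \<open>Limits of configurations and codes of trees\<close>

lemma tendsto_fun_eventually_eq:
  fixes f :: "nat \<Rightarrow> 'i \<Rightarrow> 'b::topological_space"
  assumes "\<And>i. \<forall>\<^sub>F n in sequentially. f n i = g i"
  shows "f \<longlonglongrightarrow> g"
proof (rule topological_tendstoI)
  fix U :: "('i \<Rightarrow> 'b) set" assume "open U" "g \<in> U"
  have "openin (product_topology (\<lambda>i. euclidean) UNIV) U"
    using \<open>open U\<close> by (simp add: open_fun_def)
  then obtain X where X: "g \<in> (\<Pi>\<^sub>E i\<in>UNIV. X i)" "\<And>i. openin euclidean (X i)"
    "finite {i. X i \<noteq> topspace euclidean}" "(\<Pi>\<^sub>E i\<in>UNIV. X i) \<subseteq> U"
    using product_topology_open_contains_basis[OF _ \<open>g \<in> U\<close>] by blast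
  have "\<forall>\<^sub>F n in sequentially. \<forall>i\<in>{i. X i \<noteq> topspace euclidean}. f n i = g i"
    by (rule eventually_ball_finite[OF X(3)]) (use assms in auto)
  then show "\<forall>\<^sub>F n in sequentially. f n \<in> U"
  proof (rule eventually_mono)
    fix n assume *: "\<forall>i\<in>{i. X i \<noteq> topspace euclidean}. f n i = g i"
    have "f n i \<in> X i" for i using X(1) * by (cases "X i = UNIV") (auto simp: PiE_iff)
    then have "f n \<in> (\<Pi>\<^sub>E i\<in>UNIV. X i)" by auto
    then show "f n \<in> U" by (rule subsetD[OF X(4)])
  qed
qed

lemma continuous_finite_dep:
  fixes f :: "(nat \<Rightarrow> 'a::discrete_topology) \<Rightarrow> 'b::topological_space"
  assumes "\<And>x y. (\<And>i. i < N \<Longrightarrow> x i = y i) \<Longrightarrow> f x = f y"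
  shows "continuous_on UNIV f"
proof (rule continuous_on_locally[where U = "\<lambda>x. {y. \<forall>i<N. y i = x i}"])
  fix x :: "nat \<Rightarrow> 'a"
  have "open ((\<lambda>y :: nat \<Rightarrow> 'a. y i) -` {x i})" for i
    by (rule open_vimage[OF open_discrete continuous_on_coord])
  then have "open (\<Inter>i\<in>{..<N}. (\<lambda>y :: nat \<Rightarrow> 'a. y i) -` {x i})" by (intro open_INT) auto
  moreover have "(\<Inter>i\<in>{..<N}. (\<lambda>y :: nat \<Rightarrow> 'a. y i) -` {x i}) = {y. \<forall>i<N. y i = x i}" by auto
  ultimately show "open {y. \<forall>i<N. y i = x i}" by simp
  have "continuous_on (UNIV \<inter> {y. \<forall>i<N. y i = x i}) (\<lambda>y. f x)" by (rule continuous_on_const)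
  then show "continuous_on (UNIV \<inter> {y. \<forall>i<N. y i = x i}) f"
    by (rule continuous_on_eq) (auto intro: assms)
qed auto

context frame
begin

definition thr :: "'j cell \<Rightarrow> nat" where
  "thr c = (LEAST K0. \<forall>K\<ge>K0. c \<in> W K)"

lemma thr: "thr c \<le> K \<Longrightarrow> c \<in> W K"
proof -
  have "\<exists>K0. \<forall>K\<ge>K0. c \<in> W K"
  proof (cases c)
    case (Inl j)
    obtain K0 where "\<forall>K\<ge>K0. j \<in> act K" using act by blast
    then show ?thesis by (intro exI[of _ "max K0 (Suc (to_nat c))"]) (auto simp: W_def Inl)
  next
    case (Inr t)
    obtain k n m where "t = (k, n, m)" by (cases t)
    then show ?thesis using Inr by (intro exI[of _ "max (Suc k) (Suc (to_nat c))"]) (auto simp: W_def)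
  qed
  then have "\<forall>K\<ge>thr c. c \<in> W K" unfolding thr_def by (rule LeastI_ex)
  then show "thr c \<le> K \<Longrightarrow> c \<in> W K" by blast
qed

text \<open>One sequence \<theta> codes a whole family of points indexed by Cantor space. Cell
  \<open>c\<close> is read from the first \<open>thr c\<close> bits of \<open>x\<close>, for it is
  frozen from that stage on; so it depends on one entry of \<theta> and on finitely many bits of
  \<open>x\<close>.\<close>

definition tab :: "(nat \<Rightarrow> nat) \<Rightarrow> (nat \<Rightarrow> bool) \<Rightarrow> 'j cell \<Rightarrow> nat" where
  "tab \<theta> x c = \<theta> (to_nat (pre x (thr c), c))"

definition coherent :: "((nat \<Rightarrow> bool) \<Rightarrow> 'j cell \<Rightarrow> nat) \<Rightarrow> bool" where
  "coherent \<Phi> \<longleftrightarrow> (\<forall>x y j. (\<forall>k. lev j \<le> rw k \<longrightarrow> x k = y k) \<longrightarrow> \<Phi> x (Inl j) = \<Phi> y (Inl j))"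

definition codes :: "(nat \<Rightarrow> nat) set" where
  "codes = {\<theta>. (\<forall>x. base (tab \<theta> x) \<in> A) \<and> coherent (tab \<theta>) \<and>
     (\<forall>k x. (\<forall>i<k. x i = sq k i) \<longrightarrow> \<not> x k \<longrightarrow> edge k (tab \<theta> x) (tab \<theta> (x(k := True))))}"

lemma cont_tab: "continuous_on S (\<lambda>\<theta>. tab \<theta> x)"
  unfolding tab_def by (rule continuous_on_comp_index)

lemma cont_base_tab: "continuous_on S (\<lambda>\<theta>. base (tab \<theta> x))"
  unfolding tab_def base_def by (rule continuous_on_comp_index)

lemma closed_codes: "closed codes"
proof -
  let ?K1 = "\<Inter>x. {\<theta>\<in>UNIV. base (tab \<theta> x) \<in> A}"
  have K1: "closed ?K1" by (intro closed_INT ballI closed_pre closed_A cont_base_tab) auto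
  have c1: "continuous_on S (\<lambda>\<theta>. l (base (tab \<theta> x)))" if "S \<subseteq> ?K1" "(l, i) \<in> set (Lf p)" for S x l i p
  proof -
    have "continuous_on S (l \<circ> (\<lambda>\<theta>. base (tab \<theta> x)))"
      by (rule continuous_on_compose[OF cont_base_tab continuous_on_subset[OF cont_Lf[OF that(2)]]])
        (use that(1) in auto)
    then show ?thesis by (simp add: o_def)
  qed
  define E where "E k x n = (case Lf (rw k) ! n of (l, i) \<Rightarrow> {\<theta>\<in>{\<theta>\<in>?K1. (\<lambda>m. tab \<theta> x (Inr (k, n, m))) \<in> DR i}.
     gR i (\<lambda>m. tab \<theta> x (Inr (k, n, m))) = (l (base (tab \<theta> x)), l (base (tab \<theta> (x(k := True)))))})" for k x n
  have "closed (E k x n)" if "n < length (Lf (rw k))" for k x n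
  proof -
    obtain l i where li: "Lf (rw k) ! n = (l, i)" by (cases "Lf (rw k) ! n")
    then have mem: "(l, i) \<in> set (Lf (rw k))" using that by (metis nth_mem)
    have cc: "continuous_on S (\<lambda>\<theta> m. tab \<theta> x (Inr (k, n, m)))" for S
      unfolding tab_def by (rule continuous_on_comp_index)
    let ?K2 = "{\<theta>\<in>?K1. (\<lambda>m. tab \<theta> x (Inr (k, n, m))) \<in> DR i}"
    have "closed ?K2" by (rule closed_pre[OF K1 closed_DR cc])
    moreover have "continuous_on ?K2 (\<lambda>\<theta>. gR i (\<lambda>m. tab \<theta> x (Inr (k, n, m))))"
      using continuous_on_compose[OF cc[of ?K2], of "gR i"] continuous_on_subset[OF cont_gR, of _ i]
      by (auto simp: o_def image_subset_iff)
    moreover have "continuous_on ?K2 (\<lambda>\<theta>. (l (base (tab \<theta> x)), l (base (tab \<theta> (x(k := True))))))"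
      by (intro continuous_on_Pair c1[OF _ mem]) auto
    ultimately show ?thesis unfolding E_def li prod.case by (rule closed_agree)
  qed
  then have cE: "closed (\<Inter>k. \<Inter>x\<in>{x. (\<forall>i<k. x i = sq k i) \<and> \<not> x k}. \<Inter>n\<in>{..<length (Lf (rw k))}. E k x n)"
    by (intro closed_INT ballI) auto
  have "closed {\<theta>\<in>UNIV. tab \<theta> x (Inl j) = tab \<theta> y (Inl j)}" for x y j
    by (intro closed_agree continuous_on_product_then_coordinatewise[OF cont_tab]) auto
  then have cC: "closed (\<Inter>j. \<Inter>x. \<Inter>y\<in>{y. \<forall>k. lev j \<le> rw k \<longrightarrow> x k = y k}. {\<theta>\<in>UNIV. tab \<theta> x (Inl j) = tab \<theta> y (Inl j)})"
    by (intro closed_INT ballI)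
  have "codes = ?K1 \<inter> ((\<Inter>j. \<Inter>x. \<Inter>y\<in>{y. \<forall>k. lev j \<le> rw k \<longrightarrow> x k = y k}. {\<theta>\<in>UNIV. tab \<theta> x (Inl j) = tab \<theta> y (Inl j)}) \<inter>
      (\<Inter>k. \<Inter>x\<in>{x. (\<forall>i<k. x i = sq k i) \<and> \<not> x k}. \<Inter>n\<in>{..<length (Lf (rw k))}. E k x n))"
    (is "_ = ?K1 \<inter> (?C \<inter> ?E)")
  proof (intro equalityI subsetI)
    fix \<theta> assume t: "\<theta> \<in> codes"
    then have "\<theta> \<in> ?K1" by (simp add: codes_def)
    moreover have "\<theta> \<in> ?C" using t by (auto simp: codes_def coherent_def)
    moreover have "\<theta> \<in> E k x n" if "\<forall>i<k. x i = sq k i" "\<not> x k" "n < length (Lf (rw k))" for k x n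
    proof -
      have "edge k (tab \<theta> x) (tab \<theta> (x(k := True)))" using t that by (simp add: codes_def)
      then show ?thesis using that(3) \<open>\<theta> \<in> ?K1\<close> by (auto simp: edge_def E_def split: prod.splits)
    qed
    ultimately show "\<theta> \<in> ?K1 \<inter> (?C \<inter> ?E)" by auto
  next
    fix \<theta> assume t: "\<theta> \<in> ?K1 \<inter> (?C \<inter> ?E)"
    then have "\<forall>x. base (tab \<theta> x) \<in> A" by auto
    moreover have "coherent (tab \<theta>)" using t by (auto simp: coherent_def)
    moreover have "edge k (tab \<theta> x) (tab \<theta> (x(k := True)))" if "\<forall>i<k. x i = sq k i" "\<not> x k" for k x
      unfolding edge_def
    proof (intro allI impI)
      fix n assume "n < length (Lf (rw k))"
      then have "\<theta> \<in> E k x n" using t that by auto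
      then show "case Lf (rw k) ! n of (l, i) \<Rightarrow> (\<lambda>m. tab \<theta> x (Inr (k, n, m))) \<in> DR i \<and>
          gR i (\<lambda>m. tab \<theta> x (Inr (k, n, m))) = (l (base (tab \<theta> x)), l (base (tab \<theta> (x(k := True)))))"
        by (auto simp: E_def split: prod.splits)
    qed
    ultimately show "\<theta> \<in> codes" by (simp add: codes_def)
  qed
  then show ?thesis using K1 cC cE by (simp add: closed_Int)
qed

text \<open>Each cell is eventually frozen, so the configurations along \<open>x\<close> converge.
  Membership in \<open>A\<close> and the witnesses for edges pass to the limit because
  \<open>A\<close> and \<open>DR i\<close> are closed and the maps are continuous on them.\<close>

lemma scheme:
  assumes leg: "\<And>K. legal K (\<Gamma> K)"
    and ext: "\<And>K u b c. length u = K \<Longrightarrow> c \<in> W K \<Longrightarrow> \<Gamma> (Suc K) (u @ [b]) c = \<Gamma> K u c"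
  shows "\<exists>\<theta>\<in>codes. \<forall>x c K. thr c \<le> K \<longrightarrow> tab \<theta> x c = \<Gamma> K (pre x K) c"
proof -
  define \<theta> where "\<theta> n = (case from_nat n of (u, c) \<Rightarrow> \<Gamma> (length u) u c)" for n
  have tab: "tab \<theta> x c = \<Gamma> K (pre x K) c" if "thr c \<le> K" for x c K
    using that
  proof (induction K rule: dec_induct)
    case base
    show ?case by (simp add: tab_def \<theta>_def)
  next
    case (step K)
    then show ?case using ext[of "pre x K" K c "x K"] thr[of c K] by (simp add: pre_Suc)
  qed
  have ev: "\<forall>\<^sub>F K in sequentially. \<Gamma> K (pre x K) c = tab \<theta> x c" for x c
    using tab[of c _ x] by (intro eventually_sequentiallyI[of "thr c"]) simp
  have limB: "(\<lambda>K. base (\<Gamma> K (pre x K))) \<longlonglongrightarrow> base (tab \<theta> x)" for x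
    by (rule tendsto_fun_eventually_eq) (use ev in \<open>simp add: base_def\<close>)
  have inA: "base (\<Gamma> K (pre x K)) \<in> A" for K x using leg[of K] by (simp add: legal_def)
  have A: "base (tab \<theta> x) \<in> A" for x
    using closed_sequentially[OF closed_A inA limB] .
  have "coherent (tab \<theta>)" unfolding coherent_def
  proof (intro allI impI)
    fix x y :: "nat \<Rightarrow> bool" and j assume "\<forall>k. lev j \<le> rw k \<longrightarrow> x k = y k"
    then show "tab \<theta> x (Inl j) = tab \<theta> y (Inl j)"
      using leg[of "thr (Inl j)"] tab[of "Inl j" "thr (Inl j)"] by (simp add: legal_def)
  qed
  moreover have "edge k (tab \<theta> x) (tab \<theta> (x(k := True)))" if x: "\<forall>i<k. x i = sq k i" "\<not> x k" for k x
    unfolding edge_def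
  proof (intro allI impI)
    fix n assume n: "n < length (Lf (rw k))"
    obtain l i where li: "Lf (rw k) ! n = (l, i)" by (cases "Lf (rw k) ! n")
    then have mem: "(l, i) \<in> set (Lf (rw k))" using n by (metis nth_mem)
    let ?y = "x(k := True)"
    define e where "e K = (\<lambda>m. \<Gamma> K (pre x K) (Inr (k, n, m)))" for K
    have "edge k (\<Gamma> K (pre x K)) (\<Gamma> K (pre ?y K))" if "k < K" for K
    proof -
      have "take k (pre x K) = pre (sq k) k" using that x(1) by (simp add: take_pre pre_eq_iff)
      moreover have "\<not> pre x K ! k" using that x(2) by simp
      ultimately show ?thesis using leg[of K] that by (simp add: legal_def pre_fun_upd)
    qed
    then have eK: "e K \<in> DR i \<and> gR i (e K) = (l (base (\<Gamma> K (pre x K))), l (base (\<Gamma> K (pre ?y K))))"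
      if "k < K" for K using that n li by (fastforce simp: edge_def e_def)
    define e' where "e' m = tab \<theta> x (Inr (k, n, m))" for m
    have lim_e: "e \<longlonglongrightarrow> e'"
      by (rule tendsto_fun_eventually_eq) (use ev in \<open>simp add: e_def e'_def\<close>)
    have evk: "\<forall>\<^sub>F K in sequentially. k < K" by (rule eventually_gt_at_top)
    have evD: "\<forall>\<^sub>F K in sequentially. e K \<in> DR i" using evk by (rule eventually_mono) (use eK in blast)
    have D: "e' \<in> DR i"
      by (rule Lim_in_closed_set[OF closed_DR evD _ lim_e]) simp
    have "(\<lambda>K. gR i (e K)) \<longlonglongrightarrow> gR i e'"
      by (rule continuous_on_tendsto_compose[OF cont_gR lim_e D evD])
    moreover have ll: "(\<lambda>K. l (base (\<Gamma> K (pre z K)))) \<longlonglongrightarrow> l (base (tab \<theta> z))" for z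
      by (rule continuous_on_tendsto_compose[OF cont_Lf[OF mem] limB A]) (use inA in simp)
    have "(\<lambda>K. (l (base (\<Gamma> K (pre x K))), l (base (\<Gamma> K (pre ?y K))))) \<longlonglongrightarrow> (l (base (tab \<theta> x)), l (base (tab \<theta> ?y)))"
      by (intro tendsto_Pair ll)
    then have "(\<lambda>K. gR i (e K)) \<longlonglongrightarrow> (l (base (tab \<theta> x)), l (base (tab \<theta> ?y)))"
      by (rule Lim_transform_eventually) (use evk in \<open>rule eventually_mono\<close>, use eK in auto)
    ultimately have "gR i e' = (l (base (tab \<theta> x)), l (base (tab \<theta> ?y)))" by (rule LIMSEQ_unique)
    then show "case Lf (rw k) ! n of (l, i) \<Rightarrow> (\<lambda>m. tab \<theta> x (Inr (k, n, m))) \<in> DR i \<and>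
        gR i (\<lambda>m. tab \<theta> x (Inr (k, n, m))) = (l (base (tab \<theta> x)), l (base (tab \<theta> ?y)))"
      using D li by (simp add: e'_def[abs_def])
  qed
  ultimately have "\<theta> \<in> codes" using A by (simp add: codes_def)
  then show ?thesis using tab by blast
qed

lemma cont_limit: "continuous_on UNIV (\<lambda>x. base (tab \<theta> x))"
proof (rule continuous_on_coordinatewise_then_product)
  fix j
  show "continuous_on UNIV (\<lambda>x. base (tab \<theta> x) j)"
    by (rule continuous_finite_dep[where N = "thr (Inl j)"]) (simp add: base_def tab_def cong: pre_cong)
qed

definition rich :: "nat set \<Rightarrow> bool" where
  "rich P \<longleftrightarrow> (\<forall>p\<in>P. \<forall>n x. \<exists>k\<ge>n. rw k = p \<and> (\<forall>i<n. sq k i = x i))"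

text \<open>Dense edges of row \<open>p\<close> make the equivalence of leaves meager among pairs
  that agree above row \<open>p\<close>. The Mycielski map sends any two inputs with highest
  differing row \<open>p\<close> to pairs that are generic for it, and coherence of the code becomes
  coherence of \<Psi>.\<close>

theorem thinning:
  assumes \<theta>: "\<theta> \<in> codes" and "rich P"
  shows "\<exists>\<Psi> :: (nat \<Rightarrow> nat \<Rightarrow> bool) \<Rightarrow> 'j \<Rightarrow> nat. continuous_on UNIV \<Psi> \<and>
    (\<forall>X. \<exists>x. \<Psi> X = base (tab \<theta> x)) \<and>
    (\<forall>X Y j. (\<forall>r\<ge>lev j. X r = Y r) \<longrightarrow> \<Psi> X j = \<Psi> Y j) \<and>
    (\<forall>p\<in>P. \<forall>X Y. (\<forall>r>p. X r = Y r) \<longrightarrow> X p \<noteq> Y p \<longrightarrow>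
       (\<forall>(l, i)\<in>set (Lf p). (l (\<Psi> X), l (\<Psi> Y)) \<notin> R i))"
proof -
  define \<phi> where "\<phi> x = base (tab \<theta> x)" for x
  have A: "\<phi> x \<in> A" for x using \<theta> by (simp add: codes_def \<phi>_def)
  have cont: "continuous_on UNIV \<phi>" using cont_limit by (simp add: \<phi>_def[abs_def])
  have "\<exists>D. (\<forall>i::nat. \<forall>z0. dense_below (prow rw p) 0 z0 (D i)) \<and>
      (\<forall>z\<in>seqs (prow rw p). (\<forall>i. z \<in> D i) \<longrightarrow> (l (\<phi> (\<lambda>k. fst (z k))), l (\<phi> (\<lambda>k. snd (z k)))) \<notin> R i)"
    if p: "p \<in> P" and li: "(l, i) \<in> set (Lf p)" for p l i
  proof -
    let ?Q = "{(x, y). (l (\<phi> x), l (\<phi> y)) \<in> R i}"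
    have cl: "continuous_on UNIV (\<lambda>z. l (\<phi> (\<lambda>k. h (z k))))"
      if "\<And>S. continuous_on S h" for h :: "bool \<times> bool \<Rightarrow> bool"
    proof -
      have "continuous_on UNIV (\<lambda>z :: nat \<Rightarrow> bool \<times> bool. \<lambda>k. h (z k))"
      proof (rule continuous_on_coordinatewise_then_product)
        fix k
        have "continuous_on UNIV (h \<circ> (\<lambda>z :: nat \<Rightarrow> bool \<times> bool. z k))"
          by (rule continuous_on_compose[OF continuous_on_coord that])
        then show "continuous_on UNIV (\<lambda>z :: nat \<Rightarrow> bool \<times> bool. h (z k))" by (simp add: o_def)
      qed
      then have "continuous_on UNIV (\<phi> \<circ> (\<lambda>z :: nat \<Rightarrow> bool \<times> bool. \<lambda>k. h (z k)))"
        by (rule continuous_on_compose) (rule continuous_on_subset[OF cont], simp)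
      then have "continuous_on UNIV (l \<circ> (\<phi> \<circ> (\<lambda>z :: nat \<Rightarrow> bool \<times> bool. \<lambda>k. h (z k))))"
        by (rule continuous_on_compose) (rule continuous_on_subset[OF cont_Lf[OF li]], use A in auto)
      then show ?thesis by (simp add: o_def)
    qed
    have "(\<lambda>z. (l (\<phi> (\<lambda>k. fst (z k))), l (\<phi> (\<lambda>k. snd (z k))))) \<in> borel_measurable borel"
      by (intro borel_measurable_continuous_onI continuous_on_Pair cl continuous_on_fst continuous_on_snd continuous_on_id)
    then have "(\<lambda>z. (l (\<phi> (\<lambda>k. fst (z k))), l (\<phi> (\<lambda>k. snd (z k))))) -` R i \<inter> space borel \<in> sets borel"
      using borel_R by (rule measurable_sets)
    moreover have "(\<lambda>z. (l (\<phi> (\<lambda>k. fst (z k))), l (\<phi> (\<lambda>k. snd (z k))))) -` R i \<inter> space borel =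
        {z. (\<lambda>k. fst (z k), \<lambda>k. snd (z k)) \<in> ?Q}" by auto
    ultimately have borel: "{z. (\<lambda>k. fst (z k), \<lambda>k. snd (z k)) \<in> ?Q} \<in> sets borel" by simp
    have "\<exists>D. (\<forall>i::nat. \<forall>z0. dense_below (prow rw p) 0 z0 (D i)) \<and>
      (\<forall>z\<in>seqs (prow rw p). (\<forall>i. z \<in> D i) \<longrightarrow> (\<lambda>k. fst (z k), \<lambda>k. snd (z k)) \<notin> ?Q)"
    proof (rule meager_relation[OF borel, where sq = sq])
      show "sym ?Q" using equiv_R[of i] by (auto simp: sym_def equiv_def)
      show "trans ?Q" unfolding trans_def
        using equiv_R[of i] by (auto simp: equiv_def dest: transD)
      show "\<exists>k\<ge>n. rw k = p \<and> (\<forall>i<n. sq k i = x i)" for n x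
        using assms(2) p by (simp add: rich_def)
      fix k and x :: "nat \<Rightarrow> bool" assume k: "rw k = p" "\<And>i. i < k \<Longrightarrow> x i = sq k i"
      let ?x = "x(k := False)"
      have all: "\<forall>k x. (\<forall>i<k. x i = sq k i) \<longrightarrow> \<not> x k \<longrightarrow> edge k (tab \<theta> x) (tab \<theta> (x(k := True)))"
        using \<theta> by (simp add: codes_def)
      have xt: "?x(k := True) = x(k := True)" by simp
      have "edge k (tab \<theta> ?x) (tab \<theta> (?x(k := True)))"
        by (rule all[rule_format]) (use k(2) in auto)
      then have ed: "edge k (tab \<theta> ?x) (tab \<theta> (x(k := True)))" by (simp only: xt)
      obtain n where n: "n < length (Lf p)" "Lf p ! n = (l, i)" using li unfolding in_set_conv_nth by blast
      then have "(l (\<phi> ?x), l (\<phi> (x(k := True)))) \<in> gR i ` DR i"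
        using ed k(1) unfolding edge_def \<phi>_def by (force simp: image_iff)
      then show "(?x, x(k := True)) \<notin> ?Q" using image_gR by simp
    qed
    then show ?thesis by simp
  qed
  then have "\<forall>p\<in>P. \<forall>q\<in>set (Lf p). \<exists>D. (\<forall>i::nat. \<forall>z0. dense_below (prow rw p) 0 z0 (D i)) \<and>
      (\<forall>z\<in>seqs (prow rw p). (\<forall>i. z \<in> D i) \<longrightarrow> (fst q (\<phi> (\<lambda>k. fst (z k))), fst q (\<phi> (\<lambda>k. snd (z k)))) \<notin> R (snd q))"
    by (metis prod.collapse)
  then obtain D where D: "\<And>p q (i::nat) z0. p \<in> P \<Longrightarrow> q \<in> set (Lf p) \<Longrightarrow> dense_below (prow rw p) 0 z0 (D p q i)"
    "\<And>p q z. p \<in> P \<Longrightarrow> q \<in> set (Lf p) \<Longrightarrow> z \<in> seqs (prow rw p) \<Longrightarrow> (\<And>i. z \<in> D p q i) \<Longrightarrow>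
      (fst q (\<phi> (\<lambda>k. fst (z k))), fst q (\<phi> (\<lambda>k. snd (z k)))) \<notin> R (snd q)"
    by metis
  \<comment> \<open>One sequence of dense sets handles all leaf functions of row \<open>p\<close>;
    indices beyond the list get the trivial requirement.\<close>
  define D' where "D' p i = (case prod_decode i of (n, i') \<Rightarrow> if n < length (Lf p) then D p (Lf p ! n) i' else UNIV)" for p i
  have dD': "dense_below (prow rw p) 0 z0 (D' p i)" if "p \<in> P" for p i z0
    using D(1)[OF that] dense_below_UNIV by (auto simp: D'_def split: prod.splits)
  obtain \<rho> :: "(nat \<Rightarrow> nat \<Rightarrow> bool) \<Rightarrow> nat \<Rightarrow> bool" where
    rho: "(\<forall>X k. k < 0 \<longrightarrow> \<rho> X k = False) \<and> (\<forall>k X Y. agree (Suc k) (rw k) X Y \<longrightarrow> \<rho> X k = \<rho> Y k) \<and>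
      (\<forall>p X Y i. p \<in> P \<longrightarrow> (\<forall>r>p. X r = Y r) \<longrightarrow> X p \<noteq> Y p \<longrightarrow> (\<lambda>k. (\<rho> X k, \<rho> Y k)) \<in> D' p i)"
    using mycielski_rows[of P rw 0 "\<lambda>_. False" D', OF dD'] by (rule exE)
  have \<rho>: "\<And>k X Y. agree (Suc k) (rw k) X Y \<Longrightarrow> \<rho> X k = \<rho> Y k"
      "\<And>p X Y i. p \<in> P \<Longrightarrow> (\<forall>r>p. X r = Y r) \<Longrightarrow> X p \<noteq> Y p \<Longrightarrow> (\<lambda>k. (\<rho> X k, \<rho> Y k)) \<in> D' p i"
    using rho by simp_all
  have "continuous_on UNIV (\<phi> \<circ> \<rho>)"
    by (rule continuous_on_compose[OF continuous_rows[OF \<rho>(1)]]) (auto intro: continuous_on_subset[OF cont])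
  moreover have "\<phi> (\<rho> X) j = \<phi> (\<rho> Y) j" if "\<forall>r\<ge>lev j. X r = Y r" for X Y j
  proof -
    have "\<rho> X k = \<rho> Y k" if "lev j \<le> rw k" for k
      by (rule \<rho>(1)) (use \<open>\<forall>r\<ge>lev j. X r = Y r\<close> that in \<open>auto simp: agree_def\<close>)
    moreover have "coherent (tab \<theta>)" using \<theta> by (simp add: codes_def)
    ultimately show ?thesis unfolding coherent_def \<phi>_def base_def by blast
  qed
  moreover have "(l (\<phi> (\<rho> X)), l (\<phi> (\<rho> Y))) \<notin> R i"
    if p: "p \<in> P" and XY: "\<forall>r>p. X r = Y r" "X p \<noteq> Y p" and li: "(l, i) \<in> set (Lf p)" for p X Y l i
  proof -
    obtain n where n: "n < length (Lf p)" "Lf p ! n = (l, i)" using li unfolding in_set_conv_nth by blast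
    have "(\<lambda>k. (\<rho> X k, \<rho> Y k)) \<in> D p (l, i) i'" for i'
      using \<rho>(2)[OF p XY, of "prod_encode (n, i')"] n by (simp add: D'_def)
    moreover have "(\<lambda>k. (\<rho> X k, \<rho> Y k)) \<in> seqs (prow rw p)"
    proof -
      have "\<rho> X k = \<rho> Y k" if "p < rw k" for k
        by (rule \<rho>(1)) (use XY(1) that in \<open>auto simp: agree_def\<close>)
      then show ?thesis by (auto simp: seqs_def prow_def)
    qed
    ultimately show ?thesis using D(2)[OF p li, of "\<lambda>k. (\<rho> X k, \<rho> Y k)"] by simp
  qed
  ultimately show ?thesis by (intro exI[of _ "\<phi> \<circ> \<rho>"]) (auto simp: \<phi>_def)
qed

end

section \<open>Analyticity of live sets\<close>

lemma uncountable_cantor: "uncountable (UNIV :: (nat \<Rightarrow> bool) set)"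
proof
  assume "countable (UNIV :: (nat \<Rightarrow> bool) set)"
  then obtain f :: "nat \<Rightarrow> nat \<Rightarrow> bool" where f: "range f = UNIV"
    by (metis range_from_nat_into UNIV_not_empty)
  then obtain n where "f n = (\<lambda>m. \<not> f m m)" by (metis UNIV_I image_iff)
  then have "f n n = (\<not> f n n)" by metis
  then show False by simp
qed

context frame
begin

text \<open>Row \<open>n\<close> of the game is answered by changing row \<open>n\<close> of the
  input. Different values of that row give inequivalent leaves, so a named class rules out at most
  one value for each leaf function. Only countably many values are ruled out in total, and Cantor
  space is uncountable.\<close>

lemma live_of_structure:
  fixes \<Psi> :: "(nat \<Rightarrow> nat \<Rightarrow> bool) \<Rightarrow> 'j \<Rightarrow> nat"
  assumes coh: "\<And>X Y j. (\<forall>r\<ge>lev j. X r = Y r) \<Longrightarrow> \<Psi> X j = \<Psi> Y j"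
    and sep: "\<And>p X Y l i. p < H \<Longrightarrow> (\<forall>r>p. X r = Y r) \<Longrightarrow> X p \<noteq> Y p \<Longrightarrow> (l, i) \<in> set (Lf p) \<Longrightarrow>
      (l (\<Psi> X), l (\<Psi> Y)) \<notin> R i"
  shows "n \<le> H \<Longrightarrow> (\<And>Y. (\<forall>r\<ge>n. Y r = X r) \<Longrightarrow> \<Psi> Y \<in> S) \<Longrightarrow> live (simL lev) (lvL Lf) R n S (\<Psi> X)"
proof (induction n arbitrary: X S)
  case 0
  show ?case using "0.prems"(2)[of X] by simp
next
  case (Suc n)
  show ?case
  proof (rule live_SucI)
    fix D :: "('x \<times> nat) set" assume D: "countable D"
    define bad where "bad d q = {\<xi>. \<exists>Y. (\<forall>r>n. Y r = X r) \<and> Y n = \<xi> \<and> (fst d, fst q (\<Psi> Y)) \<in> R (snd q)}"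
      for d :: "'x \<times> nat" and q :: "(('j \<Rightarrow> nat) \<Rightarrow> 'x) \<times> nat"
    have "countable (bad d q)" if "q \<in> set (Lf n)" for d q
    proof -
      have "\<xi> = \<xi>'" if in_bad: "\<xi> \<in> bad d q" "\<xi>' \<in> bad d q" for \<xi> \<xi>'
      proof (rule ccontr)
        assume "\<xi> \<noteq> \<xi>'"
        obtain Y Y' where Y: "\<forall>r>n. Y r = X r" "Y n = \<xi>" "(fst d, fst q (\<Psi> Y)) \<in> R (snd q)"
          "\<forall>r>n. Y' r = X r" "Y' n = \<xi>'" "(fst d, fst q (\<Psi> Y')) \<in> R (snd q)"
          using in_bad unfolding bad_def by blast
        have "sym (R (snd q))" "trans (R (snd q))" using equiv_R[of "snd q"] by (auto simp: equiv_def)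
        then have "(fst q (\<Psi> Y), fst q (\<Psi> Y')) \<in> R (snd q)" using Y(3,6) by (meson symD transD)
        moreover have "(fst q, snd q) \<in> set (Lf n)" using \<open>q \<in> set (Lf n)\<close> by simp
        ultimately show False
          using sep[of n Y Y' "fst q" "snd q"] Y Suc.prems(1) \<open>\<xi> \<noteq> \<xi>'\<close> by simp
      qed
      then obtain \<xi> where "bad d q \<subseteq> {\<xi>}" by blast
      then show ?thesis by (rule countable_subset) simp
    qed
    then have "countable (\<Union>d\<in>D. \<Union>q\<in>set (Lf n). bad d q)" using D by (intro countable_UN) (auto intro: countable_finite)
    then obtain \<xi> where \<xi>: "\<xi> \<notin> (\<Union>d\<in>D. \<Union>q\<in>set (Lf n). bad d q)" using uncountable_cantor by (metis UNIV_eq_I)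
    define X' where "X' = X(n := \<xi>)"
    have "live (simL lev) (lvL Lf) R n {a\<in>S. miss R (lvL Lf n a) D} (\<Psi> X')"
    proof (rule Suc.IH)
      fix Y assume Y: "\<forall>r\<ge>n. Y r = X' r"
      then have YX: "\<forall>r>n. Y r = X r" "Y n = \<xi>" by (auto simp: X'_def)
      then have "\<Psi> Y \<in> S" using Suc.prems(2)[of Y] by auto
      moreover have "miss R (lvL Lf n (\<Psi> Y)) D" unfolding miss_def
      proof (intro allI impI notI)
        fix x i d assume h: "(x, i) \<in> lvL Lf n (\<Psi> Y)" "(d, i) \<in> D" "(d, x) \<in> R i"
        then obtain l where "(l, i) \<in> set (Lf n)" "x = l (\<Psi> Y)" by (auto simp: lvL_def)
        then have "\<xi> \<in> bad (d, i) (l, i)" unfolding bad_def using YX h(3) by auto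
        then show False using \<xi> h(2) \<open>(l, i) \<in> set (Lf n)\<close> by blast
      qed
      ultimately show "\<Psi> Y \<in> {a\<in>S. miss R (lvL Lf n a) D}" by simp
    qed (use Suc.prems(1) in simp)
    moreover have "simL lev n (\<Psi> X) (\<Psi> X')" unfolding simL_def
      by (intro allI impI coh) (simp add: X'_def)
    ultimately show "\<exists>c'. simL lev n (\<Psi> X) c' \<and> live (simL lev) (lvL Lf) R n {a\<in>S. miss R (lvL Lf n a) D} c'"
      by blast
  qed
qed

text \<open>Thinning may miss the given branch \<open>x\<close>, but only the data of level at least
  \<open>H\<close> matter at the start. They are the same for all branches because every row is
  below \<open>H\<close>.\<close>

lemma live_of_code:
  assumes \<theta>: "\<theta> \<in> codes" and H: "\<And>k. rw k < H" "rich {..<H}"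
  shows "live (simL lev) (lvL Lf) R H A (base (tab \<theta> x))"
proof -
  obtain \<Psi> :: "(nat \<Rightarrow> nat \<Rightarrow> bool) \<Rightarrow> 'j \<Rightarrow> nat" where \<Psi>: "continuous_on UNIV \<Psi> \<and>
    (\<forall>X. \<exists>x. \<Psi> X = base (tab \<theta> x)) \<and>
    (\<forall>X Y j. (\<forall>r\<ge>lev j. X r = Y r) \<longrightarrow> \<Psi> X j = \<Psi> Y j) \<and>
    (\<forall>p\<in>{..<H}. \<forall>X Y. (\<forall>r>p. X r = Y r) \<longrightarrow> X p \<noteq> Y p \<longrightarrow>
       (\<forall>(l, i)\<in>set (Lf p). (l (\<Psi> X), l (\<Psi> Y)) \<notin> R i))"
    using thinning[OF \<theta> H(2)] by (rule exE)
  have "\<Psi> X \<in> A" for X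
  proof -
    obtain x where "\<Psi> X = base (tab \<theta> x)" using \<Psi> by blast
    then show ?thesis using \<theta> by (simp add: codes_def)
  qed
  moreover have "\<Psi> X j = \<Psi> Y j" if "\<forall>r\<ge>lev j. X r = Y r" for X Y j using \<Psi> that by blast
  moreover have "(l (\<Psi> X), l (\<Psi> Y)) \<notin> R i"
    if p: "p < H" "\<forall>r>p. X r = Y r" "X p \<noteq> Y p" and li: "(l, i) \<in> set (Lf p)" for p X Y l i
  proof -
    have "\<forall>(l, i)\<in>set (Lf p). (l (\<Psi> X), l (\<Psi> Y)) \<notin> R i" using \<Psi> p by simp
    then show ?thesis using li by blast
  qed
  ultimately have L: "live (simL lev) (lvL Lf) R H A (\<Psi> X)" for X
    by (intro live_of_structure[of \<Psi> H]) (assumption | simp)+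
  obtain y where y: "\<Psi> (\<lambda>_ _. False) = base (tab \<theta> y)" using \<Psi> by blast
  obtain p where p: "H = Suc p" using H(1)[of 0] by (cases H) auto
  have "simL lev p (base (tab \<theta> y)) (base (tab \<theta> x))"
  proof -
    have "coherent (tab \<theta>)" using \<theta> by (simp add: codes_def)
    moreover have "\<not> lev j \<le> rw k" if "p < lev j" for j k using H(1)[of k] that p by simp
    ultimately show ?thesis unfolding simL_def coherent_def base_def by blast
  qed
  then show ?thesis using live_cong_top[OF level_sim_simL, of lev p] L[of "\<lambda>_ _. False"] y p by metis
qed

text \<open>All rows are below \<open>H\<close>, so doubling can be repeated forever at the constant
  height \<open>H\<close>. Restricting to the class of the start keeps the data of level at least
  \<open>H\<close> equal to those of \<open>c\<close>.\<close>

lemma code_of_live: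
  assumes H: "\<And>k. rw k < H" and L: "live (simL lev) (lvL Lf) R H A c"
  shows "\<exists>\<theta>\<in>codes. \<forall>x j. H \<le> lev j \<longrightarrow> base (tab \<theta> x) j = c j"
proof -
  obtain p where p: "H = Suc p" using H[of 0] by (cases H) auto
  define top where "top \<Gamma> \<longleftrightarrow> (\<forall>u j. H \<le> lev j \<longrightarrow> \<Gamma> u (Inl j) = c j)" for \<Gamma> :: "'j config"
  define good where "good K \<Gamma> \<longleftrightarrow> legal K \<Gamma> \<and> top \<Gamma> \<and>
    (\<exists>c'. top c' \<and> live simS (lvS K) R H (NB K \<Gamma> (\<lambda>_. True)) c')" for K \<Gamma>
  have top_sim: "top b" if "top a" "simS p a b" for a b
    using that p unfolding top_def simS_def by (metis Suc_le_eq)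
  have "\<exists>\<Gamma>. \<forall>K. good K (\<Gamma> K) \<and> (\<forall>u b d. length u = K \<longrightarrow> d \<in> W K \<longrightarrow> \<Gamma> (Suc K) (u @ [b]) d = \<Gamma> K u d)"
  proof (rule dependent_nat_choice)
    define h where "h a = (\<lambda>u :: bool list. \<lambda>d :: 'j cell. case d of Inl j \<Rightarrow> a j | Inr _ \<Rightarrow> 0)" for a :: "'j \<Rightarrow> nat"
    have bh: "base (h a u) = a" for a u by (simp add: base_def h_def fun_eq_iff)
    have L0: "live simS (lvS 0) R H (h ` A) (h c)"
    proof (rule live_map[OF _ _ L])
      show "simS q (h a) (h b)" if "simL lev q a b" for q a b
        using that by (simp add: simS_def simL_def h_def)
      show "lvS 0 q (h a) \<subseteq> lvL Lf q a" for q a by (auto simp: lvS_def bh)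
    qed
    have leg0: "legal 0 (h a)" if "a \<in> A" for a using that bh by (simp add: legal_def h_def)
    then have sub: "h ` A \<subseteq> NB 0 \<Gamma> (\<lambda>_. True)" for \<Gamma> by (auto simp: NB_def win_def W_def)
    have "live simS (lvS 0) R (Suc p) {a\<in>h ` A. simS p (h c) a} (h c)"
      by (rule live_restrict_sim[OF level_sim_simS]) (use L0 p in simp)
    from live_nonempty[OF this] obtain a where a: "a \<in> A" "simS p (h c) (h a)" by auto
    have "top (h c)" by (simp add: top_def h_def)
    then have "good 0 (h a)" unfolding good_def
      using leg0[OF a(1)] top_sim a(2) live_mono[OF L0 sub] by blast
    then show "\<exists>\<Gamma>. good 0 \<Gamma>" by blast
  next
    fix \<Gamma> K assume "good K \<Gamma>"
    then obtain c' where c': "top c'" "live simS (lvS K) R H (NB K \<Gamma> (\<lambda>_. True)) c'"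
      by (auto simp: good_def)
    let ?c = "joinc K (c', c')"
    have L1: "live simS (lvS (Suc K)) R H (dbl K \<Gamma> (\<lambda>_. True)) ?c"
      by (rule live_double[OF H c'(2)])
    have tc: "top ?c" using c'(1) by (auto simp: top_def joinc_def)
    have "live simS (lvS (Suc K)) R H {a\<in>dbl K \<Gamma> (\<lambda>_. True). simS p ?c a} ?c"
      unfolding p by (rule live_restrict_sim[OF level_sim_simS L1[unfolded p]])
    from live_refine[OF this] obtain \<Gamma>' where \<Gamma>': "\<Gamma>' \<in> dbl K \<Gamma> (\<lambda>_. True)" "simS p ?c \<Gamma>'"
      "live simS (lvS (Suc K)) R H ({a\<in>dbl K \<Gamma> (\<lambda>_. True). simS p ?c a} \<inter> win (Suc K) \<Gamma>') ?c" by auto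
    have "{a\<in>dbl K \<Gamma> (\<lambda>_. True). simS p ?c a} \<inter> win (Suc K) \<Gamma>' \<subseteq> NB (Suc K) \<Gamma>' (\<lambda>_. True)"
      using dbl_win_NB[OF \<Gamma>'(1)] by auto
    from live_mono[OF \<Gamma>'(3) this] have "good (Suc K) \<Gamma>'"
      unfolding good_def using tc \<Gamma>'(1) top_sim[OF tc \<Gamma>'(2)] by (auto simp: dbl_def)
    moreover have "\<forall>u b d. length u = K \<longrightarrow> d \<in> W K \<longrightarrow> \<Gamma>' (u @ [b]) d = \<Gamma> u d"
      using \<Gamma>'(1) by (simp add: dbl_def)
    ultimately show "\<exists>\<Gamma>'. good (Suc K) \<Gamma>' \<and> (\<forall>u b d. length u = K \<longrightarrow> d \<in> W K \<longrightarrow> \<Gamma>' (u @ [b]) d = \<Gamma> u d)"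
      by blast
  qed
  then obtain \<Gamma> where \<Gamma>: "\<And>K. good K (\<Gamma> K)"
    "\<And>K u b d. length u = K \<Longrightarrow> d \<in> W K \<Longrightarrow> \<Gamma> (Suc K) (u @ [b]) d = \<Gamma> K u d" by blast
  have "\<exists>\<theta>\<in>codes. \<forall>x d K. thr d \<le> K \<longrightarrow> tab \<theta> x d = \<Gamma> K (pre x K) d"
    by (rule scheme) (use \<Gamma> in \<open>auto simp: good_def\<close>)
  then obtain \<theta> where \<theta>: "\<theta> \<in> codes" "\<And>x d K. thr d \<le> K \<Longrightarrow> tab \<theta> x d = \<Gamma> K (pre x K) d" by blast
  have "base (tab \<theta> x) j = c j" if "H \<le> lev j" for x j
    using \<theta>(2)[of "Inl j" "thr (Inl j)" x] \<Gamma>(1)[of "thr (Inl j)"] that by (simp add: base_def good_def top_def)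
  then show ?thesis using \<theta>(1) by blast
qed

text \<open>The definition of liveness quantifies over all countable families and looks far from
  analytic. By the two preceding lemmas it amounts to the existence of a code with the same data of
  level at least \<open>H\<close>; hence the assumption that \<zeta> depends on these data
  only.\<close>

lemma analytic_live_closed:
  assumes H: "\<And>k. rw k < H" "rich {..<H}"
    and \<zeta>: "continuous_on A \<zeta>" "\<And>c d. (\<And>j. H \<le> lev j \<Longrightarrow> c j = d j) \<Longrightarrow> \<zeta> c = \<zeta> d"
  shows "analytic_set {\<zeta> c |c. live (simL lev) (lvL Lf) R H A c}"
proof (rule analytic_setI[OF closed_codes])
  let ?g = "\<lambda>\<theta>. base (tab \<theta> (\<lambda>_. False))"
  have "continuous_on codes (\<zeta> \<circ> ?g)"
    by (rule continuous_on_compose[OF cont_base_tab continuous_on_subset[OF \<zeta>(1)]]) (auto simp: codes_def)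
  then show "continuous_on codes (\<lambda>\<theta>. \<zeta> (?g \<theta>))" by (simp add: o_def)
  show "(\<lambda>\<theta>. \<zeta> (?g \<theta>)) ` codes = {\<zeta> c |c. live (simL lev) (lvL Lf) R H A c}"
  proof (intro equalityI subsetI)
    fix y assume "y \<in> (\<lambda>\<theta>. \<zeta> (?g \<theta>)) ` codes"
    then show "y \<in> {\<zeta> c |c. live (simL lev) (lvL Lf) R H A c}" using live_of_code[OF _ H] by blast
  next
    fix y assume "y \<in> {\<zeta> c |c. live (simL lev) (lvL Lf) R H A c}"
    then obtain c where c: "y = \<zeta> c" "live (simL lev) (lvL Lf) R H A c" by blast
    obtain \<theta> where \<theta>: "\<theta> \<in> codes" "\<And>x j. H \<le> lev j \<Longrightarrow> base (tab \<theta> x) j = c j"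
      using code_of_live[OF H(1) c(2)] by blast
    then have "\<zeta> (?g \<theta>) = y" using \<zeta>(2)[of "?g \<theta>" c] c(1) by simp
    then show "y \<in> (\<lambda>\<theta>. \<zeta> (?g \<theta>)) ` codes" using \<theta>(1) by blast
  qed
qed

end

lemma rows_exist:
  "\<exists>(rw :: nat \<Rightarrow> nat) (sq :: nat \<Rightarrow> nat \<Rightarrow> bool). (\<forall>k. rw k \<le> k) \<and>
     (\<forall>p n x. \<exists>k\<ge>n. rw k = p \<and> (\<forall>i<n. sq k i = x i))"
proof -
  define f :: "nat \<Rightarrow> nat \<times> bool list" where "f k = from_nat (fst (prod_decode k))" for k
  define rw where "rw k = (if fst (f k) \<le> k then fst (f k) else 0)" for k
  define sq where "sq k i = (if i < length (snd (f k)) then snd (f k) ! i else False)" for k i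
  have "\<exists>k\<ge>n. rw k = p \<and> (\<forall>i<n. sq k i = x i)" for p n x
  proof -
    define k where "k = prod_encode (to_nat (p, pre x n), max n p)"
    have "max n p \<le> k" unfolding k_def by (rule le_prod_encode_2)
    moreover have "f k = (p, pre x n)" by (simp add: f_def k_def)
    ultimately show ?thesis by (intro exI[of _ k]) (simp add: rw_def sq_def)
  qed
  moreover have "rw k \<le> k" for k by (simp add: rw_def)
  ultimately show ?thesis by blast
qed

lemma borel_complement_codes:
  fixes R :: "nat \<Rightarrow> ('x::polish_space \<times> 'x) set"
  assumes "\<And>i. R i \<in> sets borel"
  shows "\<exists>DR gR. \<forall>i. closed (DR i :: (nat \<Rightarrow> nat) set) \<and> continuous_on (DR i) (gR i) \<and> gR i ` DR i = - R i"
proof -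
  have "analytic_set (- R i)" for i by (rule analytic_borel) (use assms in simp)
  then show ?thesis unfolding analytic_set_def by metis
qed

theorem analytic_live:
  fixes lev :: "'j::countable \<Rightarrow> nat" and R :: "nat \<Rightarrow> ('x::polish_space \<times> 'x) set"
  assumes A: "analytic_set A"
    and Lf: "\<And>p l i. (l, i) \<in> set (Lf p) \<Longrightarrow> continuous_on A l"
    and R: "\<And>i. equiv UNIV (R i)" "\<And>i. R i \<in> sets borel"
    and "0 < H"
    and \<zeta>: "continuous_on A \<zeta>" "\<And>c d. (\<And>j. H \<le> lev j \<Longrightarrow> c j = d j) \<Longrightarrow> \<zeta> c = \<zeta> d"
  shows "analytic_set {\<zeta> c |c. live (simL lev) (lvL Lf) R H A c}"
proof -
  obtain D g where D: "closed (D :: (nat \<Rightarrow> nat) set)" "continuous_on D g" "g ` D = A"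
    using A by (rule analytic_setE)
  obtain DR gR where DR: "\<forall>i. closed (DR i :: (nat \<Rightarrow> nat) set) \<and> continuous_on (DR i) (gR i) \<and> gR i ` DR i = - R i"
    using borel_complement_codes[of R, OF R(2)] by blast
  obtain rw0 :: "nat \<Rightarrow> nat" and sq :: "nat \<Rightarrow> nat \<Rightarrow> bool" where rw0: "\<And>p n x. \<exists>k\<ge>n. rw0 k = p \<and> (\<forall>i<n. sq k i = x i)"
    using rows_exist by blast
  \<comment> \<open>Reduction modulo \<open>H\<close> keeps all rows below \<open>H\<close> and
    leaves each of them densely represented.\<close>
  define rw where "rw k = rw0 k mod H" for k
  let ?il = "\<lambda>(c :: 'j + nat \<Rightarrow> nat) j. c (Inl j)" and ?ir = "\<lambda>(c :: 'j + nat \<Rightarrow> nat) j. c (Inr j)"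
  have cil: "continuous_on S ?il" "continuous_on S ?ir" for S by (rule continuous_on_comp_index)+
  define A' where "A' = {c\<in>{c\<in>UNIV. ?ir c \<in> D}. g (?ir c) = ?il c}"
  have K: "closed {c\<in>UNIV. ?ir c \<in> D}" by (rule closed_pre[OF _ D(1) cil(2)]) simp
  have "continuous_on {c\<in>UNIV. ?ir c \<in> D} (g \<circ> ?ir)"
    by (rule continuous_on_compose[OF cil(2) continuous_on_subset[OF D(2)]]) auto
  then have cg: "continuous_on {c\<in>UNIV. ?ir c \<in> D} (\<lambda>c. g (?ir c))" by (simp add: o_def)
  have "closed {c\<in>{c\<in>UNIV. ?ir c \<in> D}. g (?ir c) j = c (Inl j)}" for j
    by (rule closed_agree[OF K continuous_on_product_then_coordinatewise[OF cg] continuous_on_coord])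
  then have "closed (\<Inter>j. {c\<in>{c\<in>UNIV. ?ir c \<in> D}. g (?ir c) j = c (Inl j)})" by (intro closed_INT) simp
  moreover have "(\<Inter>j. {c\<in>{c\<in>UNIV. ?ir c \<in> D}. g (?ir c) j = c (Inl j)}) = A'"
    by (auto simp: A'_def fun_eq_iff)
  ultimately have cA': "closed A'" by simp
  have ilA: "?il c \<in> A" if "c \<in> A'" for c using that D(3) unfolding A'_def by (metis (mono_tags, lifting) imageI mem_Collect_eq)
  have comp: "continuous_on A' (\<lambda>c. l (?il c))" if "continuous_on A l" for l :: "('j \<Rightarrow> nat) \<Rightarrow> 'z::topological_space"
  proof -
    have "continuous_on A' (l \<circ> ?il)"
      by (rule continuous_on_compose[OF cil(1) continuous_on_subset[OF that]]) (use ilA in auto)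
    then show ?thesis by (simp add: o_def)
  qed
  \<comment> \<open>Codes for membership in \<open>A\<close> become coordinates of level
    \<open>0\<close>, so no answer is obliged to preserve them.\<close>
  define lev' where "lev' = case_sum lev (\<lambda>_::nat. 0)"
  define Lf' where "Lf' p = map (\<lambda>(l, i). ((\<lambda>c. l (?il c)), i)) (Lf p)" for p
  interpret frame lev' A' Lf' R DR gR rw sq "\<lambda>_. UNIV"
  proof
    fix p l i assume "(l, i) \<in> set (Lf' p)"
    then show "continuous_on A' l" using comp Lf by (auto simp: Lf'_def)
  qed (use cA' R DR in auto)
  have rwH: "rw k < H" for k using \<open>0 < H\<close> by (simp add: rw_def)
  have "rich {..<H}" unfolding rich_def
  proof (intro ballI allI)
    fix p n x assume "p \<in> {..<H}"
    then show "\<exists>k\<ge>n. rw k = p \<and> (\<forall>i<n. sq k i = x i)"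
      using rw0[of n p x] by (auto simp: rw_def)
  qed
  then have an: "analytic_set {\<zeta> (?il c) |c. live (simL lev') (lvL Lf') R H A' c}"
    using rwH comp[OF \<zeta>(1)] by (intro analytic_live_closed \<zeta>(2)) (auto simp: lev'_def)
  have lvl: "lvL Lf' p c = lvL Lf p (?il c)" for p c
    by (force simp: lvL_def Lf'_def)
  have "{\<zeta> (?il c) |c. live (simL lev') (lvL Lf') R H A' c} = {\<zeta> c |c. live (simL lev) (lvL Lf) R H A c}"
  proof (intro equalityI subsetI)
    fix y assume "y \<in> {\<zeta> (?il c) |c. live (simL lev') (lvL Lf') R H A' c}"
    then obtain c where c: "y = \<zeta> (?il c)" "live (simL lev') (lvL Lf') R H A' c" by blast
    have "live (simL lev) (lvL Lf) R H (?il ` A') (?il c)"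
    proof (rule live_map[OF _ _ c(2)])
      show "simL lev p (?il a) (?il b)" if "simL lev' p a b" for p a b
        using that unfolding simL_def lev'_def by (metis old.sum.simps(5))
    qed (simp add: lvl)
    then have "live (simL lev) (lvL Lf) R H A (?il c)" by (rule live_mono) (use ilA in auto)
    then show "y \<in> {\<zeta> c |c. live (simL lev) (lvL Lf) R H A c}" using c(1) by blast
  next
    fix y assume "y \<in> {\<zeta> c |c. live (simL lev) (lvL Lf) R H A c}"
    then obtain c where c: "y = \<zeta> c" "live (simL lev) (lvL Lf) R H A c" by blast
    define h where "h a = case_sum a (SOME e. e \<in> D \<and> g e = a)" for a :: "'j \<Rightarrow> nat"
    have ilh: "?il (h a) = a" for a by (simp add: h_def)
    have "live (simL lev') (lvL Lf') R H (h ` A) (h c)"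
    proof (rule live_map[OF _ _ c(2)])
      show "simL lev' p (h a) (h b)" if "simL lev p a b" for p a b
        using that by (auto simp: simL_def lev'_def h_def split: sum.splits)
    qed (simp add: lvl ilh)
    moreover have "h ` A \<subseteq> A'"
    proof
      fix z assume "z \<in> h ` A"
      then obtain a where a: "z = h a" "a \<in> A" by auto
      then have "\<exists>e. e \<in> D \<and> g e = a" using D(3) by auto
      then have "(SOME e. e \<in> D \<and> g e = a) \<in> D \<and> g (SOME e. e \<in> D \<and> g e = a) = a" by (rule someI_ex)
      then show "z \<in> A'" using a by (simp add: A'_def h_def)
    qed
    ultimately have "live (simL lev') (lvL Lf') R H A' (h c)" by (rule live_mono)
    then show "y \<in> {\<zeta> (?il c) |c. live (simL lev') (lvL Lf') R H A' c}" using c(1) ilh[of c] by (intro CollectI exI[of _ "h c"]) simp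
  qed
  then show ?thesis using an by simp
qed

section \<open>Thin sets\<close>

definition thin :: "('x \<times> 'x) set \<Rightarrow> ('x \<times> 'v) set \<Rightarrow> bool" where
  "thin F T \<longleftrightarrow> (\<forall>z z' v. (z, v) \<in> T \<longrightarrow> (z', v) \<in> T \<longrightarrow> (z, z') \<in> F)"

lemma analytic_separated_sections:
  fixes T :: "('x::polish_space \<times> 'v::polish_space) set" and F :: "('x \<times> 'x) set"
  assumes "analytic_set T" "F \<in> sets borel"
  shows "analytic_set {(z, v). \<exists>z'. (z', v) \<in> T \<and> (z', z) \<notin> F}"
proof -
  have "- F \<in> sets borel" using assms(2) sets.compl_sets[of F borel] by (simp add: Compl_eq_Diff_UNIV)
  then have TF: "analytic_set (T \<times> - F)" by (rule analytic_Times[OF assms(1) analytic_borel])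
  have "closed {p :: ('x \<times> 'v) \<times> 'x \<times> 'x. fst (fst p) = fst (snd p)}"
    using closed_agree[of UNIV "\<lambda>p :: ('x \<times> 'v) \<times> 'x \<times> 'x. fst (fst p)" "\<lambda>p. fst (snd p)"]
    by (simp add: continuous_on_fst continuous_on_snd continuous_on_id)
  then have an: "analytic_set {p :: ('x \<times> 'v) \<times> 'x \<times> 'x. fst (fst p) = fst (snd p)}"
    by (rule analytic_closed_subset[OF analytic_UNIV_polish])
  have "analytic_set ((T \<times> - F) \<inter> {p. fst (fst p) = fst (snd p)})" by (rule analytic_Int[OF TF an])
  then have "analytic_set ((\<lambda>p. (snd (snd p), snd (fst p))) ` ((T \<times> - F) \<inter> {p. fst (fst p) = fst (snd p)}))"
    by (rule analytic_image) (intro continuous_on_Pair continuous_on_fst continuous_on_snd continuous_on_id)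
  moreover have "(\<lambda>p. (snd (snd p), snd (fst p))) ` ((T \<times> - F) \<inter> {p. fst (fst p) = fst (snd p)}) =
      {(z, v). \<exists>z'. (z', v) \<in> T \<and> (z', z) \<notin> F}" by (force simp: image_iff)
  ultimately show ?thesis by simp
qed

text \<open>A direct form of reflection. A Borel set \<open>B\<close> separates \<open>T\<close>
  from the points that are inequivalent to some point of \<open>T\<close> in the same section.
  Discarding from \<open>B\<close> every point with an inequivalent companion in \<open>B\<close>
  leaves a thin set, and no point of \<open>T\<close> has such a companion.\<close>

lemma thin_coanalytic_superset:
  fixes T :: "('x::polish_space \<times> 'v::polish_space) set"
  assumes T: "analytic_set T" "thin F T" and F: "equiv UNIV F" "F \<in> sets borel"
  shows "\<exists>N. analytic_set (- N) \<and> thin F N \<and> T \<subseteq> N"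
proof -
  let ?U = "\<lambda>T. {(z, v). \<exists>z'. (z', v) \<in> T \<and> (z', z) \<notin> F}"
  have "T \<inter> ?U T = {}" using T(2) unfolding thin_def by blast
  then obtain B where B: "B \<in> sets borel" "T \<subseteq> B" "B \<inter> ?U T = {}"
    using lusin_separation[OF T(1) analytic_separated_sections[OF T(1) F(2)]] by blast
  let ?N = "B - ?U B"
  have "- B \<in> sets borel" using B(1) sets.compl_sets[of B borel] by (simp add: Compl_eq_Diff_UNIV)
  then have "analytic_set (- B)" "analytic_set B" using B(1) by (intro analytic_borel; simp)+
  then have "analytic_set (- B \<union> ?U B)" by (intro analytic_Un analytic_separated_sections F(2))
  moreover have "- ?N = - B \<union> ?U B" by auto
  moreover have "thin F ?N" unfolding thin_def
  proof (intro allI impI)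
    fix z z' v assume "(z, v) \<in> ?N" "(z', v) \<in> ?N"
    then show "(z, z') \<in> F" by auto
  qed
  moreover have "T \<subseteq> ?N"
  proof
    fix p assume p: "p \<in> T"
    obtain z v where zv: "p = (z, v)" by (cases p)
    have "(z', z) \<in> F" if "(z', v) \<in> B" for z'
    proof (rule ccontr)
      assume "(z', z) \<notin> F"
      then have "(z, z') \<notin> F" using F(1) by (meson equiv_def symD)
      then have "(z', v) \<in> ?U T" using p zv by blast
      then show False using that B(3) by blast
    qed
    then show "p \<in> ?N" using p zv B(2) by auto
  qed
  ultimately show ?thesis by (intro exI[of _ ?N]) simp
qed

context frame
begin

lemma cont_base: "continuous_on S (\<lambda>\<Gamma> :: 'j config. base (\<Gamma> u))"
  unfolding base_def
  by (intro continuous_on_coordinatewise_then_product continuous_on_product_then_coordinatewise[OF continuous_on_coord])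

lemma cont_cell: "continuous_on S (\<lambda>\<Gamma> :: 'j config. \<Gamma> u c)"
  by (rule continuous_on_product_then_coordinatewise[OF continuous_on_coord])

lemma cont_edge_cells: "continuous_on S (\<lambda>(\<Gamma> :: 'j config) m. \<Gamma> u (Inr (k, n, m)))"
  by (intro continuous_on_coordinatewise_then_product cont_cell)

lemma closed_legal: "closed {\<Gamma>. legal K \<Gamma>}"
proof -
  let ?L = "{u :: bool list. length u = K}"
  let ?K1 = "\<Inter>u\<in>?L. {\<Gamma> :: 'j config \<in> UNIV. base (\<Gamma> u) \<in> A}"
  have K1: "closed ?K1" by (intro closed_INT ballI closed_pre closed_A cont_base) auto
  have c1: "continuous_on S (\<lambda>\<Gamma>. l (base (\<Gamma> u)))" if "S \<subseteq> ?K1" "(l, i) \<in> set (Lf p)" "length u = K" for S u l i p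
  proof -
    have "continuous_on S (l \<circ> (\<lambda>\<Gamma>. base (\<Gamma> u)))"
      by (rule continuous_on_compose[OF cont_base continuous_on_subset[OF cont_Lf[OF that(2)]]])
        (use that(1,3) in auto)
    then show ?thesis by (simp add: o_def)
  qed
  define E where "E k u n = (case Lf (rw k) ! n of (l, i) \<Rightarrow>
     {\<Gamma>\<in>{\<Gamma>\<in>?K1. (\<lambda>m. \<Gamma> u (Inr (k, n, m))) \<in> DR i}.
     gR i (\<lambda>m. \<Gamma> u (Inr (k, n, m))) = (l (base (\<Gamma> u)), l (base (\<Gamma> (u[k := True]))))})" for k u n
  have "closed (E k u n)" if "n < length (Lf (rw k))" "length u = K" for k u n
  proof -
    obtain l i where li: "Lf (rw k) ! n = (l, i)" by (cases "Lf (rw k) ! n")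
    then have mem: "(l, i) \<in> set (Lf (rw k))" using that(1) by (metis nth_mem)
    let ?K2 = "{\<Gamma>\<in>?K1. (\<lambda>m. \<Gamma> u (Inr (k, n, m))) \<in> DR i}"
    have K2: "closed ?K2" by (rule closed_pre[OF K1 closed_DR cont_edge_cells])
    have "continuous_on ?K2 (gR i \<circ> (\<lambda>\<Gamma> m. \<Gamma> u (Inr (k, n, m))))"
      by (rule continuous_on_compose[OF cont_edge_cells continuous_on_subset[OF cont_gR]]) auto
    then have g: "continuous_on ?K2 (\<lambda>\<Gamma>. gR i (\<lambda>m. \<Gamma> u (Inr (k, n, m))))" by (simp add: o_def)
    have "continuous_on ?K2 (\<lambda>\<Gamma>. (l (base (\<Gamma> u)), l (base (\<Gamma> (u[k := True])))))"
      by (intro continuous_on_Pair c1[OF _ mem]) (use that(2) in auto)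
    then show ?thesis unfolding E_def li prod.case by (rule closed_agree[OF K2 g])
  qed
  then have cE: "closed (\<Inter>k\<in>{..<K}. \<Inter>u\<in>{u\<in>?L. take k u = pre (sq k) k \<and> \<not> u ! k}. \<Inter>n\<in>{..<length (Lf (rw k))}. E k u n)"
    (is "closed ?E") by (intro closed_INT ballI) auto
  have cJ: "closed {\<Gamma> :: 'j config \<in> UNIV. \<Gamma> u (Inl j) = \<Gamma> v (Inl j)}" for u v j
    by (intro closed_agree cont_cell) auto
  define C where "C = (\<Inter>j. \<Inter>u\<in>?L. \<Inter>v\<in>{v\<in>?L. \<forall>k<K. lev j \<le> rw k \<longrightarrow> u ! k = v ! k}.
      {\<Gamma> :: 'j config \<in> UNIV. \<Gamma> u (Inl j) = \<Gamma> v (Inl j)})"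
  have cC: "closed C" unfolding C_def by (intro closed_INT ballI cJ)
  have K1_iff: "\<Gamma> \<in> ?K1 \<longleftrightarrow> (\<forall>u. length u = K \<longrightarrow> base (\<Gamma> u) \<in> A)" for \<Gamma> by simp
  have C_iff: "\<Gamma> \<in> C \<longleftrightarrow> (\<forall>u v j. length u = K \<longrightarrow> length v = K \<longrightarrow>
      (\<forall>k<K. lev j \<le> rw k \<longrightarrow> u ! k = v ! k) \<longrightarrow> \<Gamma> u (Inl j) = \<Gamma> v (Inl j))" for \<Gamma>
    unfolding C_def by blast
  have E_iff: "(\<forall>n<length (Lf (rw k)). \<Gamma> \<in> E k u n) \<longleftrightarrow> edge k (\<Gamma> u) (\<Gamma> (u[k := True]))"
    if "\<Gamma> \<in> ?K1" for \<Gamma> k u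
    using that by (auto simp: edge_def E_def split: prod.splits)
  have "\<Gamma> \<in> {\<Gamma>. legal K \<Gamma>} \<longleftrightarrow> \<Gamma> \<in> ?K1 \<inter> (C \<inter> ?E)" for \<Gamma>
  proof (cases "\<Gamma> \<in> ?K1")
    case True
    have "\<Gamma> \<in> ?E \<longleftrightarrow> (\<forall>k u. k < K \<longrightarrow> length u = K \<longrightarrow> take k u = pre (sq k) k \<longrightarrow> \<not> u ! k \<longrightarrow>
        (\<forall>n<length (Lf (rw k)). \<Gamma> \<in> E k u n))" by blast
    then show ?thesis using True E_iff[OF True] C_iff[of \<Gamma>] K1_iff[of \<Gamma>] unfolding legal_def by simp
  next
    case False
    then show ?thesis using K1_iff[of \<Gamma>] unfolding legal_def by blast
  qed
  then have "{\<Gamma>. legal K \<Gamma>} = ?K1 \<inter> (C \<inter> ?E)" by blast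
  then show ?thesis using closed_Int[OF K1 closed_Int[OF cC cE]] by (simp only:)
qed

lemma closed_win: "closed (win K \<Gamma>)"
proof -
  have "closed (\<Inter>u\<in>{u. length u = K}. \<Inter>c\<in>W K. {\<Gamma>' :: 'j config \<in> UNIV. \<Gamma>' u c = \<Gamma> u c})"
    by (intro closed_INT ballI closed_agree cont_cell continuous_on_const) auto
  moreover have "(\<Inter>u\<in>{u. length u = K}. \<Inter>c\<in>W K. {\<Gamma>' :: 'j config \<in> UNIV. \<Gamma>' u c = \<Gamma> u c}) = win K \<Gamma>"
    by (auto simp: win_def)
  ultimately show ?thesis by simp
qed

lemma analytic_NB:
  fixes q :: "('j \<Rightarrow> nat) \<Rightarrow> 'y::t2_space"
  assumes q: "continuous_on A q" and Q: "analytic_set {y. Q y}"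
  shows "analytic_set (NB K \<Gamma> (\<lambda>c. Q (q c)))"
proof -
  let ?B = "{\<Gamma>. legal K \<Gamma>} \<inter> win K \<Gamma>" and ?L = "{u :: bool list. length u = K}"
  have "analytic_set ?B" by (intro analytic_closed_fun2 closed_Int closed_legal closed_win)
  moreover have "continuous_on ?B (\<lambda>\<Gamma>. q (base (\<Gamma> u)))" if "u \<in> ?L" for u
  proof -
    have "continuous_on ?B (q \<circ> (\<lambda>\<Gamma>. base (\<Gamma> u)))"
      by (rule continuous_on_compose[OF cont_base continuous_on_subset[OF q]])
        (use that in \<open>auto simp: legal_def\<close>)
    then show ?thesis by (simp add: o_def)
  qed
  ultimately have "analytic_set {\<Gamma>'\<in>?B. \<forall>u\<in>?L. q (base (\<Gamma>' u)) \<in> {y. Q y}}"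
    using finite_lists_length_eq[of "UNIV :: bool set" K] Q
    by (intro analytic_finite_preimages) simp_all
  moreover have "{\<Gamma>'\<in>?B. \<forall>u\<in>?L. q (base (\<Gamma>' u)) \<in> {y. Q y}} = NB K \<Gamma> (\<lambda>c. Q (q c))"
    by (auto simp: NB_def)
  ultimately show ?thesis by simp
qed

end

text \<open>If no countable family of coanalytic thin sets covers \<open>T\<close>, let \<open>N\<close> be the union of the families
  that make a window unable to split. There are only countably many windows, so a point of \<open>T\<close>
  outside \<open>N\<close> starts a tree of configurations whose branches give uncountably many classes in one
  section.\<close>

theorem thin_cover:
  fixes T :: "('x::polish_space \<times> 'v::polish_space) set"
  assumes T: "analytic_set T" and F: "equiv UNIV F" "F \<in> sets borel"
    and ctbl: "\<And>v. \<exists>D. countable D \<and> (\<forall>z. (z, v) \<in> T \<longrightarrow> (\<exists>d\<in>D. (d, z) \<in> F))"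
  shows "\<exists>\<N>. countable \<N> \<and> (\<forall>N\<in>\<N>. analytic_set (- N) \<and> thin F N) \<and> T \<subseteq> \<Union>\<N>"
proof -
  obtain D g where D: "closed (D :: (nat \<Rightarrow> nat) set)" "continuous_on D g" "g ` D = T"
    using T by (rule analytic_setE)
  obtain C h where C: "closed (C :: (nat \<Rightarrow> nat) set)" "continuous_on C h" "h ` C = (UNIV :: 'v set)"
    using analytic_UNIV_polish by (rule analytic_setE)
  obtain DR gR where DR: "\<forall>i::nat. closed (DR i :: (nat \<Rightarrow> nat) set) \<and> continuous_on (DR i) (gR i) \<and> gR i ` DR i = - F"
    using borel_complement_codes[of "\<lambda>_. F", OF F(2)] by blast
  obtain rw0 :: "nat \<Rightarrow> nat" and sq :: "nat \<Rightarrow> nat \<Rightarrow> bool" where sq: "\<And>p n x. \<exists>k\<ge>n. rw0 k = p \<and> (\<forall>i<n. sq k i = x i)"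
    using rows_exist by blast
  let ?il = "\<lambda>(c :: nat + nat \<Rightarrow> nat) j. c (Inl j)" and ?ir = "\<lambda>(c :: nat + nat \<Rightarrow> nat) j. c (Inr j)"
  have cil: "continuous_on S ?il" "continuous_on S ?ir" for S by (rule continuous_on_comp_index)+
  define K where "K = {c\<in>{c\<in>UNIV. ?il c \<in> D}. ?ir c \<in> C}"
  have K: "closed K" unfolding K_def by (intro closed_pre D(1) C(1) cil) simp
  have "continuous_on K (g \<circ> ?il)" "continuous_on K (h \<circ> ?ir)"
    by (rule continuous_on_compose[OF cil(1) continuous_on_subset[OF D(2)]], force simp: K_def)
      (rule continuous_on_compose[OF cil(2) continuous_on_subset[OF C(2)]], force simp: K_def)
  then have cK: "continuous_on K (\<lambda>c. g (?il c))" "continuous_on K (\<lambda>c. h (?ir c))" by (simp_all add: o_def)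
  define A where "A = {c\<in>K. snd (g (?il c)) = h (?ir c)}"
  have A: "closed A" unfolding A_def by (intro closed_agree K cK continuous_on_snd)
  have AD: "?il c \<in> D" "?ir c \<in> C" "snd (g (?il c)) = h (?ir c)" if "c \<in> A" for c
    using that by (auto simp: A_def K_def)
  define q where "q c = g (?il c)" for c
  have q: "continuous_on A q" unfolding q_def by (rule continuous_on_subset[OF cK(1)]) (auto simp: A_def)
  have qT: "q c \<in> T" if "c \<in> A" for c using AD(1)[OF that] D(3) by (auto simp: q_def)
  \<comment> \<open>The code of a point of \<open>T\<close> has level \<open>0\<close> and the code
    of \<open>v\<close> level \<open>1\<close>. All stages belong to row \<open>0\<close>, so within
    a tree the code of \<open>v\<close> is constant and the points vary inside one section.\<close>
  define lev where "lev = case_sum (\<lambda>_::nat. 0::nat) (\<lambda>_::nat. 1)"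
  define Lf where "Lf p = (if p = 0 then [((\<lambda>c. fst (q c)), 0::nat)] else [])" for p :: nat
  interpret frame lev A Lf "\<lambda>_. F" DR gR "\<lambda>_. 0" sq "\<lambda>_. UNIV"
  proof
    fix p l i assume "(l, i) \<in> set (Lf p)"
    then show "continuous_on A l" using q by (auto simp: Lf_def intro: continuous_on_fst split: if_splits)
  qed (use A F DR in auto)
  define ok where "ok N c \<longleftrightarrow> q c \<notin> \<Union>N" for N c
  \<comment> \<open>The values at the string where the next edge is to be placed, over all
    configurations in the window whose points avoid \<open>N\<close>. A thin spot is what prevents
    doubling.\<close>
  define spot where "spot K w N = (\<lambda>\<Gamma>. q (base (\<Gamma> (pre (sq K) K)))) ` {\<Gamma>\<in>w. legal K \<Gamma> \<and> (\<forall>u. length u = K \<longrightarrow> ok N (base (\<Gamma> u)))}"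
    for K w N
  define small where "small N \<longleftrightarrow> countable N \<and> (\<forall>M\<in>N. analytic_set (- M) \<and> thin F M)" for N :: "('x \<times> 'v) set set"
  have spot_mono: "spot K w N' \<subseteq> spot K w N" if "N \<subseteq> N'" for K w N N'
    using that unfolding spot_def ok_def by fast
  have spot_analytic: "analytic_set (spot K (win K \<Gamma>) N)" if "small N" for K \<Gamma> N
  proof -
    have "analytic_set {y. y \<notin> \<Union>N}"
    proof (cases "N = {}")
      case False
      then have N: "range (from_nat_into N) = N" using that by (simp add: small_def range_from_nat_into)
      have "from_nat_into N n \<in> N" for n using False by (rule from_nat_into)
      then have "analytic_set (\<Inter>n. - from_nat_into N n)"
        by (intro analytic_INT) (use that in \<open>simp add: small_def\<close>)
      moreover have "(\<Inter>n. - from_nat_into N n) = - \<Union>(range (from_nat_into N))" by auto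
      ultimately have "analytic_set (- \<Union>N)" using N by simp
      then show ?thesis by (simp add: Compl_eq)
    qed (simp add: analytic_UNIV_polish)
    then have NB: "analytic_set (NB K \<Gamma> (\<lambda>c. q c \<notin> \<Union>N))" by (rule analytic_NB[OF q])
    have "continuous_on (NB K \<Gamma> (\<lambda>c. q c \<notin> \<Union>N)) (q \<circ> (\<lambda>\<Gamma>. base (\<Gamma> (pre (sq K) K))))"
      by (rule continuous_on_compose[OF cont_base continuous_on_subset[OF q]]) (auto simp: NB_def legal_def)
    from analytic_image[OF NB this] show ?thesis
      by (rule back_subst[of analytic_set]) (auto simp: spot_def NB_def ok_def)
  qed
  define \<S> where "\<S> = {(K, w). w \<in> range (win K) \<and> (\<exists>N. small N \<and> thin F (spot K w N))}"
  have cS: "countable \<S>"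
  proof (rule countable_subset)
    show "\<S> \<subseteq> (SIGMA K:UNIV. range (win K))" by (auto simp: \<S>_def)
    show "countable (SIGMA K:UNIV. range (win K))" by (intro countable_SIGMA countable_win) simp
  qed
  have "\<exists>N M. small N \<and> analytic_set (- M) \<and> thin F M \<and> spot (fst s) (snd s) N \<subseteq> M" if s: "s \<in> \<S>" for s
  proof -
    obtain K w where s': "s = (K, w)" by (cases s)
    then have "w \<in> range (win K)" "\<exists>N. small N \<and> thin F (spot K w N)"
      using s unfolding \<S>_def by simp_all
    then obtain \<Gamma> N where *: "s = (K, win K \<Gamma>)" "small N" "thin F (spot K (win K \<Gamma>) N)"
      using s' by blast
    then show ?thesis
      using thin_coanalytic_superset[OF spot_analytic[OF *(2), of K \<Gamma>] *(3) F] by auto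
  qed
  then obtain NN MM where NM: "\<And>s. s \<in> \<S> \<Longrightarrow> small (NN s) \<and> analytic_set (- MM s) \<and> thin F (MM s) \<and>
      spot (fst s) (snd s) (NN s) \<subseteq> MM s" by metis
  \<comment> \<open>One small family works for all windows at once: for each bad window it contains
    the family that makes its spot thin and a coanalytic thin set around that spot.\<close>
  define N where "N = (\<Union>s\<in>\<S>. NN s) \<union> MM ` \<S>"
  have N: "small N" using NM cS unfolding small_def N_def by (auto intro!: countable_UN)
  have "T \<subseteq> \<Union>N"
  proof (rule ccontr)
    assume "\<not> T \<subseteq> \<Union>N"
    then obtain t where t: "t \<in> T" "t \<notin> \<Union>N" by blast
    define good where "good K \<Gamma> \<longleftrightarrow> legal K \<Gamma> \<and> (\<forall>u. length u = K \<longrightarrow> ok N (base (\<Gamma> u)))" for K \<Gamma>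
    have "\<exists>\<Gamma>. \<forall>K. good K (\<Gamma> K) \<and> (\<forall>u b d. length u = K \<longrightarrow> d \<in> W K \<longrightarrow> \<Gamma> (Suc K) (u @ [b]) d = \<Gamma> K u d)"
    proof (rule dependent_nat_choice)
      have "t \<in> g ` D" using t D(3) by simp
      then obtain d where d: "d \<in> D" "g d = t" by auto
      have "snd t \<in> h ` C" using C(3) by simp
      then obtain e where e: "e \<in> C" "h e = snd t" by auto
      define \<Gamma> where "\<Gamma> u c = (case c of Inl (Inl j) \<Rightarrow> d j | Inl (Inr j) \<Rightarrow> e j | Inr _ \<Rightarrow> 0)"
        for u :: "bool list" and c :: "(nat + nat) cell"
      have b: "base (\<Gamma> u) = case_sum d e" for u by (auto simp: base_def \<Gamma>_def fun_eq_iff split: sum.splits)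
      have "case_sum d e \<in> A" using d e by (simp add: A_def K_def)
      then have "legal 0 \<Gamma>" by (simp add: legal_def b \<Gamma>_def)
      moreover have "ok N (base (\<Gamma> u))" for u using t(2) d by (simp add: ok_def b q_def)
      ultimately show "\<exists>\<Gamma>. good 0 \<Gamma>" by (auto simp: good_def)
    next
      fix \<Gamma> K assume g: "good K \<Gamma>"
      let ?s = "pre (sq K) K"
      have "\<not> thin F (spot K (win K \<Gamma>) N)"
      proof
        assume "thin F (spot K (win K \<Gamma>) N)"
        then have s: "(K, win K \<Gamma>) \<in> \<S>" using N by (auto simp: \<S>_def)
        have "q (base (\<Gamma> ?s)) \<in> spot K (win K \<Gamma>) N"
          using g win_refl unfolding spot_def good_def by blast
        also have "\<dots> \<subseteq> spot K (win K \<Gamma>) (NN (K, win K \<Gamma>))" by (rule spot_mono) (use s in \<open>auto simp: N_def\<close>)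
        also have "\<dots> \<subseteq> MM (K, win K \<Gamma>)" using NM[OF s] by simp
        also have "\<dots> \<subseteq> \<Union>N" using s by (auto simp: N_def)
        finally show False using g unfolding good_def ok_def by simp
      qed
      then obtain z z' v where zz: "(z, v) \<in> spot K (win K \<Gamma>) N" "(z', v) \<in> spot K (win K \<Gamma>) N" "(z, z') \<notin> F"
        unfolding thin_def by blast
      then obtain \<Gamma>0 \<Gamma>1 where G: "\<Gamma>0 \<in> win K \<Gamma>" "good K \<Gamma>0" "(z, v) = q (base (\<Gamma>0 ?s))"
        "\<Gamma>1 \<in> win K \<Gamma>" "good K \<Gamma>1" "(z', v) = q (base (\<Gamma>1 ?s))" unfolding spot_def good_def by blast
      \<comment> \<open>The two configurations name the same \<open>v\<close>, but possibly by
        different codes. Giving the second one the code from the first makes them agree on level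
        \<open>1\<close>, as joining demands.\<close>
      define \<Gamma>2 where "\<Gamma>2 u c = (case c of Inl (Inr j) \<Rightarrow> \<Gamma>0 u c | _ \<Rightarrow> \<Gamma>1 u c)"
        for u :: "bool list" and c :: "(nat + nat) cell"
      have il2: "?il (base (\<Gamma>2 u)) = ?il (base (\<Gamma>1 u))" for u by (simp add: base_def \<Gamma>2_def)
      have ir2: "?ir (base (\<Gamma>2 u)) = ?ir (base (\<Gamma>0 u))" for u by (simp add: base_def \<Gamma>2_def)
      have const: "?ir (base (\<Gamma>' u)) = ?ir (base (\<Gamma>' ?s))" if "good K \<Gamma>'" "length u = K" for \<Gamma>' u
      proof -
        have *: "\<forall>u v j. length u = K \<longrightarrow> length v = K \<longrightarrow> (\<forall>k<K. lev j \<le> 0 \<longrightarrow> u ! k = v ! k) \<longrightarrow>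
            \<Gamma>' u (Inl j) = \<Gamma>' v (Inl j)" using that(1) unfolding good_def legal_def by blast
        have "\<Gamma>' u (Inl (Inr j)) = \<Gamma>' ?s (Inl (Inr j))" for j
          by (rule *[rule_format]) (use that(2) in \<open>simp_all add: lev_def\<close>)
        then show ?thesis by (simp add: base_def)
      qed
      have in_A: "base (\<Gamma>' u) \<in> A" if "good K \<Gamma>'" "length u = K" for \<Gamma>' u
        using that by (simp add: good_def legal_def)
      have hv: "h (?ir (base (\<Gamma>' u))) = snd (q (base (\<Gamma>' ?s)))" if "good K \<Gamma>'" "length u = K" for \<Gamma>' u
        using const[OF that] AD(3)[OF in_A[OF that(1)], of ?s] by (simp add: q_def)
      have "legal K \<Gamma>2" unfolding legal_def
      proof (intro conjI allI impI)
        fix u :: "bool list" assume u: "length u = K"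
        have "snd (g (?il (base (\<Gamma>1 u)))) = v"
          using AD(3)[OF in_A[OF G(5) u]] hv[OF G(5) u] G(6) by (metis snd_conv)
        moreover have "h (?ir (base (\<Gamma>0 u))) = v" using hv[OF G(2) u] G(3) by (metis snd_conv)
        ultimately show "base (\<Gamma>2 u) \<in> A"
          using AD[OF in_A[OF G(2) u]] AD[OF in_A[OF G(5) u]] by (simp add: A_def K_def il2 ir2)
      next
        fix u v :: "bool list" and j assume "length u = K" "length v = K" "\<forall>k<K. lev j \<le> 0 \<longrightarrow> u ! k = v ! k"
        then have "\<Gamma>' u (Inl j) = \<Gamma>' v (Inl j)" if "good K \<Gamma>'" for \<Gamma>'
          using that unfolding good_def legal_def by blast
        from this[OF G(2)] this[OF G(5)] show "\<Gamma>2 u (Inl j) = \<Gamma>2 v (Inl j)"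
          by (cases j) (simp_all add: \<Gamma>2_def)
      next
        fix k u assume k: "k < K" "length u = K" "take k u = pre (sq k) k" "\<not> u ! k"
        then have "edge k (\<Gamma>1 u) (\<Gamma>1 (u[k := True]))" using G(5) by (simp add: good_def legal_def)
        then show "edge k (\<Gamma>2 u) (\<Gamma>2 (u[k := True]))"
          by (simp add: edge_def Lf_def q_def il2) (simp add: \<Gamma>2_def)
      qed
      moreover have q2: "q (base (\<Gamma>2 u)) = q (base (\<Gamma>1 u))" for u by (simp add: q_def il2)
      ultimately have g2: "good K \<Gamma>2" using G(5) by (simp add: good_def ok_def)
      have w2: "\<Gamma>2 \<in> win K \<Gamma>" using G(1,4) by (auto simp: win_def \<Gamma>2_def split: sum.splits)
      have "joinc K (\<Gamma>0, \<Gamma>2) \<in> dbl K \<Gamma> (ok N)"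
      proof (rule joinc_dbl)
        show "fst (\<Gamma>0, \<Gamma>2) \<in> NB K \<Gamma> (ok N)" "snd (\<Gamma>0, \<Gamma>2) \<in> NB K \<Gamma> (ok N)"
          using G(1,2) g2 w2 by (auto simp: NB_def good_def)
        show "simS 0 (fst (\<Gamma>0, \<Gamma>2)) (snd (\<Gamma>0, \<Gamma>2))"
          unfolding simS_def by (auto simp: \<Gamma>2_def lev_def split: sum.splits)
        fix l i assume "(l, i) \<in> set (Lf 0)"
        then show "(l (base (fst (\<Gamma>0, \<Gamma>2) ?s)), l (base (snd (\<Gamma>0, \<Gamma>2) ?s))) \<notin> F"
          using zz(3) G(3,6) q2[of ?s] by (simp add: Lf_def) (metis fst_conv)
      qed
      then have d: "joinc K (\<Gamma>0, \<Gamma>2) \<in> dbl K \<Gamma> (ok N)" .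
      then have "good (Suc K) (joinc K (\<Gamma>0, \<Gamma>2))" unfolding dbl_def good_def by blast
      then show "\<exists>\<Gamma>'. good (Suc K) \<Gamma>' \<and> (\<forall>u b d. length u = K \<longrightarrow> d \<in> W K \<longrightarrow> \<Gamma>' (u @ [b]) d = \<Gamma> u d)"
        using d unfolding dbl_def by blast
    qed
    then obtain \<Gamma> where \<Gamma>: "\<And>K. good K (\<Gamma> K)"
      "\<And>K u b d. length u = K \<Longrightarrow> d \<in> W K \<Longrightarrow> \<Gamma> (Suc K) (u @ [b]) d = \<Gamma> K u d" by blast
    have "\<exists>\<theta>\<in>codes. \<forall>x d K. thr d \<le> K \<longrightarrow> tab \<theta> x d = \<Gamma> K (pre x K) d"
      by (rule scheme) (use \<Gamma> in \<open>auto simp: good_def\<close>)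
    then obtain \<theta> where \<theta>: "\<theta> \<in> codes" by blast
    have "rich {0}" unfolding rich_def using sq by blast
    obtain \<Psi> :: "(nat \<Rightarrow> nat \<Rightarrow> bool) \<Rightarrow> nat + nat \<Rightarrow> nat" where \<Psi>: "continuous_on UNIV \<Psi> \<and>
      (\<forall>X. \<exists>x. \<Psi> X = base (tab \<theta> x)) \<and>
      (\<forall>X Y j. (\<forall>r\<ge>lev j. X r = Y r) \<longrightarrow> \<Psi> X j = \<Psi> Y j) \<and>
      (\<forall>p\<in>{0}. \<forall>X Y. (\<forall>r>p. X r = Y r) \<longrightarrow> X p \<noteq> Y p \<longrightarrow>
         (\<forall>(l, i)\<in>set (Lf p). (l (\<Psi> X), l (\<Psi> Y)) \<notin> F))"
      using thinning[OF \<theta> \<open>rich {0}\<close>] by (rule exE)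
    \<comment> \<open>Only row \<open>0\<close> varies, so uncountably many pairwise inequivalent
      points land in one section.\<close>
    define \<psi> where "\<psi> \<xi> = \<Psi> (\<lambda>r. if r = 0 then \<xi> else (\<lambda>_. False))" for \<xi>
    have \<psi>A: "\<psi> \<xi> \<in> A" for \<xi>
    proof -
      obtain x where "\<psi> \<xi> = base (tab \<theta> x)" using \<Psi> unfolding \<psi>_def by blast
      then show ?thesis using \<theta> by (simp add: codes_def)
    qed
    have "\<psi> \<xi> (Inr j) = \<psi> \<xi>' (Inr j)" for \<xi> \<xi>' j
    proof -
      have "\<forall>X Y j. (\<forall>r\<ge>lev j. X r = Y r) \<longrightarrow> \<Psi> X j = \<Psi> Y j" using \<Psi> by blast
      then show ?thesis unfolding \<psi>_def by (elim allE impE) (auto simp: lev_def)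
    qed
    then have ir: "?ir (\<psi> \<xi>) = ?ir (\<psi> \<xi>')" for \<xi> \<xi>' by blast
    have sq: "snd (q (\<psi> \<xi>)) = h (?ir (\<psi> \<xi>))" for \<xi> using AD(3)[OF \<psi>A] by (simp add: q_def)
    have "snd (q (\<psi> \<xi>)) = snd (q (\<psi> \<xi>'))" for \<xi> \<xi>'
      by (simp only: sq[of \<xi>] sq[of \<xi>'] ir[of \<xi> \<xi>'])
    then have v: "snd (q (\<psi> \<xi>)) = snd (q (\<psi> (\<lambda>_. False)))" for \<xi> by simp
    define v where "v = snd (q (\<psi> (\<lambda>_. False)))"
    note v = v[folded v_def]
    have inT: "(fst (q (\<psi> \<xi>)), v) \<in> T" for \<xi> using qT[OF \<psi>A, of \<xi>] v[of \<xi>] by (metis prod.collapse)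
    have sep: "(fst (q (\<psi> \<xi>)), fst (q (\<psi> \<xi>'))) \<notin> F" if "\<xi> \<noteq> \<xi>'" for \<xi> \<xi>'
    proof -
      let ?X = "\<lambda>\<xi> r. if r = 0 then \<xi> else (\<lambda>_. False)"
      have "\<forall>(l, i)\<in>set (Lf 0). (l (\<Psi> (?X \<xi>)), l (\<Psi> (?X \<xi>'))) \<notin> F" using \<Psi> that by simp
      then show ?thesis by (simp add: Lf_def \<psi>_def)
    qed
    obtain D0 where D0: "countable D0" "\<And>z. (z, v) \<in> T \<Longrightarrow> \<exists>d\<in>D0. (d, z) \<in> F" using ctbl by blast
    have "\<forall>\<xi>. \<exists>d. d \<in> D0 \<and> (d, fst (q (\<psi> \<xi>))) \<in> F" using D0(2)[OF inT] by blast
    then obtain f where f: "\<And>\<xi>. f \<xi> \<in> D0" "\<And>\<xi>. (f \<xi>, fst (q (\<psi> \<xi>))) \<in> F" by metis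
    have "inj f"
    proof (rule injI, rule ccontr)
      fix \<xi> \<xi>' assume "f \<xi> = f \<xi>'" "\<xi> \<noteq> \<xi>'"
      have "sym F" "trans F" using F(1) by (auto simp: equiv_def)
      then have "(fst (q (\<psi> \<xi>)), fst (q (\<psi> \<xi>'))) \<in> F"
        using f(2)[of \<xi>] f(2)[of \<xi>'] \<open>f \<xi> = f \<xi>'\<close> by (metis symD transD)
      then show False using sep[OF \<open>\<xi> \<noteq> \<xi>'\<close>] by simp
    qed
    moreover have "countable (range f)" using f(1) by (intro countable_subset[OF _ D0(1)]) auto
    ultimately show False using uncountable_cantor countable_image_inj_on by blast
  qed
  then show ?thesis using N by (auto simp: small_def)
qed

section \<open>Heavy cells\<close>

text \<open>The index set \<open>S\<close> lists leaves whose classes are prescribed by \<open>g\<close>; such leaves cannot be asked to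
  avoid anything on the top row \<open>M\<close>, where \<open>lvo\<close> keeps only the leaves in \<open>J\<close>.\<close>

definition cell :: "(nat \<Rightarrow> ('x \<times> 'x) set) \<Rightarrow> ('s \<Rightarrow> 'c \<Rightarrow> 'x) \<Rightarrow> ('s \<Rightarrow> nat) \<Rightarrow> 'c set \<Rightarrow> 's set \<Rightarrow> 'c \<Rightarrow> 'c set" where
  "cell R f e a S g = {c\<in>a. \<forall>s\<in>S. (f s g, f s c) \<in> R (e s)}"

definition lvo :: "(nat \<Rightarrow> 'c \<Rightarrow> ('x \<times> nat) set) \<Rightarrow> nat \<Rightarrow> ('s \<Rightarrow> 'c \<Rightarrow> 'x) \<Rightarrow> ('s \<Rightarrow> nat) \<Rightarrow> 's set
    \<Rightarrow> nat \<Rightarrow> 'c \<Rightarrow> ('x \<times> nat) set" where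
  "lvo lv M f e J p c = (if p = M then (\<lambda>s. (f s c, e s)) ` J else lv p c)"

text \<open>A game of height \<open>M\<close> consults only rows below \<open>M\<close>, where
  \<open>lvo\<close> changes nothing.\<close>

lemma live_lvo_iff: "live sim (lvo lv M f e J) R M A c \<longleftrightarrow> live sim lv R M A c"
  using live_map[of M sim sim id A "lvo lv M f e J" lv R c] live_map[of M sim sim id A lv "lvo lv M f e J" R c]
  by (auto simp: lvo_def)

text \<open>Take a maximal set \<open>S\<close> of prescribed leaves for which some cell is live at
  height \<open>M\<close>. If a family beat this cell on row \<open>M\<close>, the cell would be
  covered by a part that is not live and countably many cells with one more prescribed leaf; one of
  the latter would be live, against maximality.\<close>

lemma live_maximal_cell:
  fixes lv :: "nat \<Rightarrow> 'c \<Rightarrow> ('x \<times> nat) set" and f :: "'s \<Rightarrow> 'c \<Rightarrow> 'x"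
  assumes I: "finite I" and R: "\<And>i. equiv UNIV (R i)" and refl: "sim M c c"
    and L: "live sim lv R M a c"
  shows "\<exists>S\<subseteq>I. \<exists>g\<in>a. live sim (lvo lv M f e (I - S)) R (Suc M) (cell R f e a S g) c"
proof -
  define P where "P S \<longleftrightarrow> (\<exists>g\<in>a. live sim lv R M (cell R f e a S g) c)" for S
  have "cell R f e a {} g = a" for g by (simp add: cell_def)
  then have "P {}" using live_nonempty[OF L] L by (auto simp: P_def)
  then have "finite {S\<in>Pow I. P S}" "{S\<in>Pow I. P S} \<noteq> {}" using I by auto
  from finite_has_maximal[OF this] obtain S where S: "S \<subseteq> I" "P S"
    "\<And>T. T \<subseteq> I \<Longrightarrow> P T \<Longrightarrow> S \<subseteq> T \<Longrightarrow> S = T" by auto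
  obtain g where g: "g \<in> a" "live sim lv R M (cell R f e a S g) c" using S(2) unfolding P_def by blast
  let ?C = "cell R f e a S g" and ?lv = "lvo lv M f e (I - S)"
  have "live sim ?lv R (Suc M) ?C c"
  proof (rule live_SucI, rule ccontr)
    fix D :: "('x \<times> nat) set" assume D: "countable D"
    assume "\<nexists>c'. sim M c c' \<and> live sim ?lv R M {x\<in>?C. miss R (?lv M x) D} c'"
    then have dead: "\<not> live sim lv R M {x\<in>?C. miss R (?lv M x) D} c" using refl by (auto simp: live_lvo_iff)
    let ?X = "\<lambda>(s, d). {x\<in>?C. e s = snd d \<and> (fst d, f s x) \<in> R (e s)}"
    have "?C \<subseteq> {x\<in>?C. miss R (?lv M x) D} \<union> (\<Union>q\<in>(I - S) \<times> D. ?X q)"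
    proof
      fix x assume x: "x \<in> ?C"
      show "x \<in> {x\<in>?C. miss R (?lv M x) D} \<union> (\<Union>q\<in>(I - S) \<times> D. ?X q)"
      proof (cases "miss R (?lv M x) D")
        case False
        then obtain s d where "s \<in> I - S" "(d, e s) \<in> D" "(d, f s x) \<in> R (e s)"
          by (auto simp: miss_def lvo_def)
        then have "(s, (d, e s)) \<in> (I - S) \<times> D" "x \<in> ?X (s, (d, e s))" using x by auto
        then show ?thesis by blast
      qed (use x in simp)
    qed
    from live_Un[OF live_mono[OF g(2) this]] dead
    have L: "live sim lv R M (\<Union>q\<in>(I - S) \<times> D. ?X q) c" by blast
    have "countable ((I - S) \<times> D)" using D I by (intro countable_SIGMA) (auto intro: countable_finite)
    from live_UN[OF this L] obtain q where q: "q \<in> (I - S) \<times> D" "live sim lv R M (?X q) c" by (rule bexE)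
    obtain s d where sd: "q = (s, d)" by (cases q)
    obtain g1 where g1: "g1 \<in> ?X q" using live_nonempty[OF q(2)] by blast
    have tr: "(x, z) \<in> R i" if "(y, x) \<in> R i" "(y, z) \<in> R i" for x y z i
      using R[of i] that by (meson equiv_def symD transD)
    have "?X q \<subseteq> cell R f e a (insert s S) g1"
    proof
      fix x assume x: "x \<in> ?X q"
      show "x \<in> cell R f e a (insert s S) g1" unfolding cell_def
      proof (intro CollectI conjI ballI)
        show "x \<in> a" using x sd by (simp add: cell_def)
        fix s' assume "s' \<in> insert s S"
        then show "(f s' g1, f s' x) \<in> R (e s')" using x g1 sd by (auto simp: cell_def intro: tr)
      qed
    qed
    then have "live sim lv R M (cell R f e a (insert s S) g1) c" using live_mono[OF q(2)] by blast
    moreover have "g1 \<in> a" using g1 sd by (simp add: cell_def)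
    ultimately have "P (insert s S)" unfolding P_def by blast
    then have "S = insert s S" using q(1) sd S(1) by (intro S(3)) auto
    then show False using q(1) sd by auto
  qed
  then show ?thesis using S(1) g(1) by blast
qed

text \<open>Minimality of \<open>S\<close> gives, for each proper subset \<open>J\<close> and each
  \<open>q\<close> in \<open>H\<close>, a countable family that beats the cell of \<open>q\<close>
  over \<open>J\<close>. A live cell over \<open>S\<close> inside it is not beaten, so a further
  leaf of its centre lies in a class named by the family. Thus countably many representatives that
  match on sets of size \<open>n\<close> lead to countably many that match on one more leaf. All
  games start at the same \<open>c\<close>, which makes their outcomes comparable.\<close>

lemma countable_heavy_cells:
  fixes lv :: "nat \<Rightarrow> 'c \<Rightarrow> ('x \<times> nat) set" and f :: "'s \<Rightarrow> 'c \<Rightarrow> 'x"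
  assumes I: "finite I" "S \<subseteq> I" and R: "\<And>i. equiv UNIV (R i)"
    and dead: "\<And>J g. J \<subset> S \<Longrightarrow> g \<in> a \<Longrightarrow> \<not> live sim (lvo lv M f e (I - J)) R (Suc M) (cell R f e a J g) c"
    and H: "H \<subseteq> a" "\<And>g. g \<in> H \<Longrightarrow> live sim (lvo lv M f e (I - S)) R (Suc M) (cell R f e a S g) c"
  shows "\<exists>Q. countable Q \<and> (\<forall>g\<in>H. \<exists>q\<in>Q. \<forall>s\<in>S. (f s q, f s g) \<in> R (e s))"
proof -
  have tr: "(x, z) \<in> R i" if "(y, x) \<in> R i" "(y, z) \<in> R i" for x y z i
    using R[of i] that by (meson equiv_def symD transD)
  have rf: "(x, x) \<in> R i" for x i using R[of i] by (meson UNIV_I equiv_def refl_onD)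
  have "\<exists>Q\<subseteq>H. countable Q \<and> (\<forall>g\<in>H. \<exists>J\<subseteq>S. card J = n \<and> (\<exists>q\<in>Q. \<forall>s\<in>J. (f s q, f s g) \<in> R (e s)))"
    if "n \<le> card S" for n
    using that
  proof (induction n)
    case 0
    show ?case
    proof (cases "H = {}")
      case False
      then obtain g where "g \<in> H" by blast
      then show ?thesis by (intro exI[of _ "{g}"] conjI ballI exI[of _ "{}"]) auto
    qed auto
  next
    case (Suc n)
    then obtain Q where Q: "Q \<subseteq> H" "countable Q"
      "\<And>g. g \<in> H \<Longrightarrow> \<exists>J\<subseteq>S. card J = n \<and> (\<exists>q\<in>Q. \<forall>s\<in>J. (f s q, f s g) \<in> R (e s))" by auto
    define kills where "kills J q D \<longleftrightarrow> countable D \<and> (\<forall>c'. sim M c c' \<longrightarrow>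
       \<not> live sim lv R M {x\<in>cell R f e a J q. miss R (lvo lv M f e (I - J) M x) D} c')" for J q D
    have "\<exists>D. kills J q D" if "J \<subset> S" "q \<in> H" for J q
    proof -
      have "q \<in> a" using that(2) H(1) by blast
      from dead[OF that(1) this] show ?thesis unfolding kills_def by (auto simp: live_lvo_iff)
    qed
    then have kills: "kills J q (SOME D. kills J q D)" if "J \<subset> S" "q \<in> H" for J q
      using that by (metis someI_ex)
    define D where "D J q = (SOME D. kills J q D)" for J q
    have D: "countable (D J q)" "sim M c c' \<Longrightarrow>
        \<not> live sim lv R M {x\<in>cell R f e a J q. miss R (lvo lv M f e (I - J) M x) (D J q)} c'"
      if "J \<subset> S" "q \<in> H" for J q c'
      using kills[OF that] unfolding D_def kills_def by blast+
    define ok where "ok = (\<lambda>(q, J, s, d :: 'x \<times> nat) g. g \<in> H \<and> (\<forall>t\<in>J. (f t q, f t g) \<in> R (e t)) \<and> (fst d, f s g) \<in> R (e s))"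
    define T where "T = (SIGMA q:Q. SIGMA J:{J. J \<subset> S}. S \<times> D J q)"
    define T' where "T' = {t\<in>T. \<exists>g. ok t g}"
    define pick where "pick t = (SOME g. ok t g)" for t
    have pick: "ok t (pick t)" if "t \<in> T'" for t
      using that unfolding T'_def pick_def by (auto intro: someI_ex)
    have fS: "finite S" using I finite_subset by blast
    have "countable T" unfolding T_def
    proof (intro countable_SIGMA Q(2))
      show "countable {J. J \<subset> S}" using fS by (intro countable_finite finite_subset[of "{J. J \<subset> S}" "Pow S"]) auto
    qed (use D(1) Q(1) fS in \<open>auto intro: countable_finite\<close>)
    then have "countable T'" unfolding T'_def by (rule countable_subset[rotated]) (rule Collect_restrict)
    then have cT': "countable (pick ` T')" by (rule countable_image)
    have "\<exists>J\<subseteq>S. card J = Suc n \<and> (\<exists>q\<in>pick ` T'. \<forall>s\<in>J. (f s q, f s g) \<in> R (e s))" if g: "g \<in> H" for g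
    proof -
      obtain J q where Jq: "J \<subseteq> S" "card J = n" "q \<in> Q" "\<And>s. s \<in> J \<Longrightarrow> (f s q, f s g) \<in> R (e s)"
        using Q(3)[OF g] by blast
      have JS: "J \<subset> S" using Jq(1,2) Suc.prems by auto
      have qH: "q \<in> H" using Q(1) Jq(3) by blast
      obtain c' where c': "sim M c c'"
        "live sim lv R M {x\<in>cell R f e a S g. miss R (lvo lv M f e (I - S) M x) (D J q)} c'"
        using H(2)[OF g] D(1)[OF JS qH] by (auto simp: live_lvo_iff)
      have "\<exists>s\<in>S - J. \<exists>d\<in>D J q. snd d = e s \<and> (fst d, f s g) \<in> R (e s)"
      proof (rule ccontr)
        assume no: "\<not> ?thesis"
        have "{x\<in>cell R f e a S g. miss R (lvo lv M f e (I - S) M x) (D J q)} \<subseteq>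
            {x\<in>cell R f e a J q. miss R (lvo lv M f e (I - J) M x) (D J q)}"
        proof (intro subsetI CollectI conjI)
          fix x assume x: "x \<in> {x\<in>cell R f e a S g. miss R (lvo lv M f e (I - S) M x) (D J q)}"
          then have xS: "(f s g, f s x) \<in> R (e s)" if "s \<in> S" for s using that by (simp add: cell_def)
          have "(f s q, f s x) \<in> R (e s)" if "s \<in> J" for s
            using Jq(4)[OF that] xS[of s] that Jq(1) R[of "e s"] by (meson equiv_def subsetD transD)
          then show "x \<in> cell R f e a J q" using x by (simp add: cell_def)
          show "miss R (lvo lv M f e (I - J) M x) (D J q)" unfolding miss_def
          proof (intro allI impI notI)
            fix y i d assume h: "(y, i) \<in> lvo lv M f e (I - J) M x" "(d, i) \<in> D J q" "(d, y) \<in> R i"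
            then obtain s where s: "s \<in> I - J" "y = f s x" "i = e s" by (auto simp: lvo_def)
            show False
            proof (cases "s \<in> S")
              case True
              have "(f s x, f s g) \<in> R (e s)" using xS[OF True] R[of "e s"] by (meson equiv_def symD)
              then have "(d, f s g) \<in> R (e s)" using h(3) s R[of "e s"] by (meson equiv_def transD)
              then show False using no True s h(2) by fastforce
            next
              case False
              then have "(y, i) \<in> lvo lv M f e (I - S) M x" using s by (auto simp: lvo_def)
              then show False using x h(2,3) by (auto simp: miss_def)
            qed
          qed
        qed
        then show False using live_mono[OF c'(2)] D(2)[OF JS qH c'(1)] by blast
      qed
      then obtain s d where sd: "s \<in> S" "s \<notin> J" "d \<in> D J q" "(fst d, f s g) \<in> R (e s)" by blast
      let ?t = "(q, J, s, d)"
      have "ok ?t g" using g Jq(4) sd(4) by (simp add: ok_def)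
      moreover have "?t \<in> T" using Jq(3) JS sd by (simp add: T_def)
      ultimately have t: "?t \<in> T'" by (auto simp: T'_def)
      have "(f t (pick ?t), f t g) \<in> R (e t)" if "t \<in> insert s J" for t
        using pick[OF t] that Jq(4)[of t] sd(4) by (auto simp: ok_def intro: tr)
      moreover have "card (insert s J) = Suc n" using sd(2) Jq(1,2) fS by (simp add: finite_subset)
      ultimately show ?thesis using t sd(1) Jq(1) by (intro exI[of _ "insert s J"]) blast
    qed
    moreover have "pick ` T' \<subseteq> H"
    proof
      fix g assume "g \<in> pick ` T'"
      then obtain t where "g = pick t" "t \<in> T'" by blast
      then show "g \<in> H" using pick[of t] by (auto simp: ok_def split: prod.splits)
    qed
    ultimately show ?case using cT' by (intro exI[of _ "pick ` T'"]) blast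
  qed
  from this[OF order_refl] obtain Q where Q: "countable Q"
    "\<And>g. g \<in> H \<Longrightarrow> \<exists>J\<subseteq>S. card J = card S \<and> (\<exists>q\<in>Q. \<forall>s\<in>J. (f s q, f s g) \<in> R (e s))" by blast
  have "finite S" using I finite_subset by blast
  then have "J = S" if "J \<subseteq> S" "card J = card S" for J using that card_subset_eq by blast
  then show ?thesis using Q by (intro exI[of _ Q]) blast
qed

section \<open>The null ideal\<close>

text \<open>Countable index phrased without quotients. Neither \<open>x\<close> nor the
  representatives in \<open>D\<close> need to lie in \<open>B\<close>, so the property passes to
  subsets and countable unions directly.\<close>

definition ctbl_over :: "('a \<times> 'a) set \<Rightarrow> ('a \<times> 'a) set \<Rightarrow> 'a set \<Rightarrow> bool" where
  "ctbl_over E F B \<longleftrightarrow> (\<forall>x. \<exists>D. countable D \<and> (\<forall>z\<in>B. (x, z) \<in> E \<longrightarrow> (\<exists>d\<in>D. (d, z) \<in> F)))"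

definition basic :: "('a::polish_space \<times> 'a) set \<Rightarrow> (nat \<Rightarrow> ('a \<times> 'a) set) \<Rightarrow> nat \<Rightarrow> 'a set \<Rightarrow> bool" where
  "basic E En i B \<longleftrightarrow> B \<in> sets borel \<and> invariant_set (En i) B \<and> ctbl_over E (En i) B"

text \<open>Exact unions rather than subsets of unions, so that null sets are Borel and the sets
  obtained by avoiding them stay analytic.\<close>

definition null :: "('a::polish_space \<times> 'a) set \<Rightarrow> (nat \<Rightarrow> ('a \<times> 'a) set) \<Rightarrow> 'a set \<Rightarrow> bool" where
  "null E En B \<longleftrightarrow> (\<exists>\<C>. countable \<C> \<and> (\<forall>C\<in>\<C>. \<exists>i. basic E En i C) \<and> B = \<Union>\<C>)"

lemma null_empty: "null E En {}"
  unfolding null_def by (intro exI[of _ "{}"]) simp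

lemma null_basic: "basic E En i B \<Longrightarrow> null E En B"
  unfolding null_def by (intro exI[of _ "{B}"]) auto

lemma null_UN:
  assumes "countable I" "\<And>k. k \<in> I \<Longrightarrow> null E En (B k)"
  shows "null E En (\<Union>k\<in>I. B k)"
proof -
  have "\<forall>k\<in>I. \<exists>\<C>. countable \<C> \<and> (\<forall>C\<in>\<C>. \<exists>i. basic E En i C) \<and> B k = \<Union>\<C>"
    using assms(2) unfolding null_def by blast
  then obtain \<C> where "\<And>k. k \<in> I \<Longrightarrow> countable (\<C> k) \<and> (\<forall>C\<in>\<C> k. \<exists>i. basic E En i C) \<and> B k = \<Union>(\<C> k)"
    by metis
  then show ?thesis unfolding null_def using assms(1)
    by (intro exI[of _ "\<Union>k\<in>I. \<C> k"]) auto
qed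

lemma null_Un: "null E En B \<Longrightarrow> null E En C \<Longrightarrow> null E En (B \<union> C)"
  using null_UN[of "{True, False}" E En "\<lambda>b. if b then B else C"] by (simp add: Un_commute)

lemma null_borel: "null E En B \<Longrightarrow> B \<in> sets borel"
  unfolding null_def basic_def by (auto intro: sets.countable_Union)

lemma analytic_saturation:
  fixes F :: "('a::polish_space \<times> 'a) set"
  assumes "analytic_set F" "analytic_set A"
  shows "analytic_set (F `` A)"
proof -
  have "analytic_set {p\<in>F. fst p \<in> A}"
    by (rule analytic_preimage[OF assms(1) _ assms(2)]) (intro continuous_on_fst continuous_on_id)
  then have "analytic_set (snd ` {p\<in>F. fst p \<in> A})"
    by (rule analytic_image) (intro continuous_on_snd continuous_on_id)
  moreover have "snd ` {p\<in>F. fst p \<in> A} = F `` A" by (force simp: Image_def)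
  ultimately show ?thesis by simp
qed

text \<open>Countably many coanalytic thin sets that cover \<open>E\<close> over the saturation of \<open>A\<close> cover it over an
  invariant coanalytic set, and an invariant Borel set fits in between.\<close>

theorem basic_superset:
  fixes E :: "('a::polish_space \<times> 'a) set" and En :: "nat \<Rightarrow> ('a \<times> 'a) set"
  assumes E: "equiv UNIV E" "analytic_set E"
    and En: "equiv UNIV (En i)" "En i \<in> sets borel" "En i \<subseteq> E"
    and A: "analytic_set A" "ctbl_over E (En i) A"
  shows "\<exists>B. A \<subseteq> B \<and> basic E En i B"
proof -
  let ?F = "En i"
  have EnE: "(x, y) \<in> ?F \<Longrightarrow> (x, y) \<in> E" for x y using En(3) by blast
  have symE: "(x, y) \<in> E \<Longrightarrow> (y, x) \<in> E" and transE: "(x, y) \<in> E \<Longrightarrow> (y, z) \<in> E \<Longrightarrow> (x, z) \<in> E" for x y z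
    using E(1) by (meson equiv_def symD transD)+
  have reflF: "(x, x) \<in> ?F" and symF: "(x, y) \<in> ?F \<Longrightarrow> (y, x) \<in> ?F"
    and transF: "(x, y) \<in> ?F \<Longrightarrow> (y, z) \<in> ?F \<Longrightarrow> (x, z) \<in> ?F" for x y z
    using En(1) by (meson UNIV_I equiv_def refl_onD symD transD)+
  have anF: "analytic_set ?F" by (rule analytic_borel[OF En(2)])
  define A' where "A' = ?F `` A"
  have A': "analytic_set A'" unfolding A'_def by (rule analytic_saturation[OF anF A(1)])
  have AA': "A \<subseteq> A'" using reflF by (auto simp: A'_def)
  define T where "T = {p\<in>E. fst p \<in> A'}"
  have T: "analytic_set T" unfolding T_def
    by (rule analytic_preimage[OF E(2) _ A']) (intro continuous_on_fst continuous_on_id)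
  have "\<exists>D. countable D \<and> (\<forall>z. (z, v) \<in> T \<longrightarrow> (\<exists>d\<in>D. (d, z) \<in> ?F))" for v
  proof -
    obtain D where D: "countable D" "\<And>z. z \<in> A \<Longrightarrow> (v, z) \<in> E \<Longrightarrow> \<exists>d\<in>D. (d, z) \<in> ?F"
      using A(2) unfolding ctbl_over_def by meson
    have "\<exists>d\<in>D. (d, z) \<in> ?F" if z: "(z, v) \<in> T" for z
    proof -
      obtain a where a: "a \<in> A" "(a, z) \<in> ?F" using z by (auto simp: T_def A'_def)
      have "(v, a) \<in> E" using z symE transE EnE[OF a(2)] unfolding T_def by (metis (no_types, lifting) mem_Collect_eq)
      then obtain d where "d \<in> D" "(d, a) \<in> ?F" using D(2) a(1) by blast
      then show ?thesis using a(2) transF by blast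
    qed
    then show ?thesis using D(1) by blast
  qed
  from thin_cover[OF T En(1,2) this] obtain \<N> where N: "countable \<N>"
    "\<And>N. N \<in> \<N> \<Longrightarrow> analytic_set (- N) \<and> thin ?F N" "T \<subseteq> \<Union>\<N>" by blast
  define U where "U = E \<inter> - \<Union>\<N>"
  have U: "analytic_set U"
  proof (cases "\<N> = {}")
    case False
    then have r: "range (from_nat_into \<N>) = \<N>" using N(1) by (rule range_from_nat_into)
    have "from_nat_into \<N> n \<in> \<N>" for n using False by (rule from_nat_into)
    then have "analytic_set (\<Inter>n. - from_nat_into \<N> n)" by (intro analytic_INT) (use N(2) in simp)
    moreover have "(\<Inter>n. - from_nat_into \<N> n) = - \<Union>(range (from_nat_into \<N>))" by auto
    ultimately have "analytic_set (- \<Union>\<N>)" using r by simp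
    then show ?thesis unfolding U_def by (rule analytic_Int[OF E(2)])
  qed (use E(2) in \<open>simp add: U_def\<close>)
  \<comment> \<open>\<open>H\<close> consists of the points for which every equivalent
    \<open>z'\<close> has all its pairs \<open>(z', v)\<close> in \<open>E\<close> covered by the
    family. Its complement is the saturation of an analytic projection, so \<open>H\<close> is
    coanalytic.\<close>
  define H where "H = {z. \<forall>z' v. (z, z') \<in> ?F \<longrightarrow> (z', v) \<in> E \<longrightarrow> (z', v) \<in> \<Union>\<N>}"
  have "analytic_set (?F `` (fst ` U))"
    by (intro analytic_saturation[OF anF] analytic_image[OF U]) (intro continuous_on_fst continuous_on_id)
  moreover have "?F `` (fst ` U) = - H"
  proof (intro equalityI subsetI)
    fix z assume "z \<in> ?F `` (fst ` U)"
    then obtain z' v where "(z', v) \<in> U" "(z', z) \<in> ?F" by auto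
    then show "z \<in> - H" using symF unfolding H_def U_def by blast
  next
    fix z assume "z \<in> - H"
    then obtain z' v where "(z, z') \<in> ?F" "(z', v) \<in> U" unfolding H_def U_def by blast
    then show "z \<in> ?F `` (fst ` U)" using symF by force
  qed
  ultimately have H: "analytic_set (- H)" by simp
  have invH: "invariant_set ?F H" unfolding invariant_set_def
  proof (intro allI impI)
    fix x y assume "x \<in> H" "(x, y) \<in> ?F"
    then show "y \<in> H" using transF unfolding H_def by blast
  qed
  have AH: "A' \<subseteq> H"
  proof
    fix z assume "z \<in> A'"
    then have "z' \<in> A'" if "(z, z') \<in> ?F" for z' using that transF unfolding A'_def by blast
    then show "z \<in> H" using N(3) unfolding H_def T_def by auto
  qed
  obtain B where B: "B \<in> sets borel" "A' \<subseteq> B" "B \<subseteq> H" "invariant_set ?F B"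
    using invariant_borel_between[OF En(1) anF A' AH H invH] by blast
  have "ctbl_over E ?F B" unfolding ctbl_over_def
  proof
    fix x :: 'a
    \<comment> \<open>For fixed \<open>x\<close> a thin set meets the section over \<open>x\<close>
      in at most one class, so one representative for each set suffices.\<close>
    define pt where "pt N = (SOME z. (z, x) \<in> N)" for N :: "('a \<times> 'a) set"
    have "\<exists>d\<in>pt ` \<N>. (d, z) \<in> ?F" if z: "z \<in> B" "(x, z) \<in> E" for z
    proof -
      have "(z, x) \<in> \<Union>\<N>" using z B(3) reflF symE unfolding H_def by blast
      then obtain M where M: "M \<in> \<N>" "(z, x) \<in> M" by blast
      then have "(pt M, x) \<in> M" unfolding pt_def by (auto intro: someI)
      then have "(pt M, z) \<in> ?F" using N(2)[OF M(1)] M(2) unfolding thin_def by blast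
      then show ?thesis using M(1) by blast
    qed
    then show "\<exists>D. countable D \<and> (\<forall>z\<in>B. (x, z) \<in> E \<longrightarrow> (\<exists>d\<in>D. (d, z) \<in> ?F))"
      using N(1) by (intro exI[of _ "pt ` \<N>"]) auto
  qed
  then show ?thesis using B AA' unfolding basic_def by blast
qed

text \<open>The classes named by \<open>D\<close> are traced on the given \<open>E\<close>-class.
  Empty traces are discarded, because \<open>D\<close> may name classes that do not meet it.\<close>

lemma countable_index_of_ctbl_over:
  assumes E: "equiv UNIV E" and F: "equiv UNIV F" "F \<subseteq> E" and B: "ctbl_over E F B"
  shows "countable_index_on E F B"
  unfolding countable_index_on_def
proof
  fix C assume "C \<in> B // rel_restrict E B"
  then obtain x where x: "x \<in> B" "C = rel_restrict E B `` {x}" by (rule quotientE)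
  have reflF: "(y, y) \<in> F" and symF: "(y, z) \<in> F \<Longrightarrow> (z, y) \<in> F"
    and transF: "(y, z) \<in> F \<Longrightarrow> (z, w) \<in> F \<Longrightarrow> (y, w) \<in> F" for y z w
    using F(1) by (meson UNIV_I equiv_def refl_onD symD transD)+
  have transE: "(y, z) \<in> E \<Longrightarrow> (z, w) \<in> E \<Longrightarrow> (y, w) \<in> E" for y z w
    using E by (meson equiv_def transD)
  obtain D where D: "countable D" "\<And>z. z \<in> B \<Longrightarrow> (x, z) \<in> E \<Longrightarrow> \<exists>d\<in>D. (d, z) \<in> F"
    using B unfolding ctbl_over_def by meson
  let ?G = "\<lambda>d. {z\<in>C. (d, z) \<in> F}"
  let ?\<D> = "?G ` {d\<in>D. ?G d \<noteq> {}}"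
  have "?G d \<in> B // rel_restrict F B" if d: "?G d \<noteq> {}" for d
  proof -
    obtain z where z: "z \<in> C" "(d, z) \<in> F" using d by blast
    have "?G d = rel_restrict F B `` {z}"
    proof (intro equalityI subsetI)
      fix y assume "y \<in> ?G d"
      then show "y \<in> rel_restrict F B `` {z}" using z x(2) symF transF unfolding rel_restrict_def by blast
    next
      fix y assume "y \<in> rel_restrict F B `` {z}"
      then have y: "(z, y) \<in> F" "y \<in> B" by (auto simp: rel_restrict_def)
      have "(x, z) \<in> E" using z(1) x(2) by (auto simp: rel_restrict_def)
      then have "(x, y) \<in> E" using y(1) F(2) transE by blast
      moreover have "(d, y) \<in> F" by (rule transF[OF z(2) y(1)])
      ultimately show "y \<in> ?G d" using y(2) x by (simp add: rel_restrict_def)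
    qed
    moreover have "z \<in> B" using z(1) x(2) by (auto simp: rel_restrict_def)
    ultimately show ?thesis by (simp add: quotientI)
  qed
  then have "?\<D> \<subseteq> B // rel_restrict F B" by blast
  moreover have "C = \<Union>?\<D>"
  proof (intro equalityI subsetI)
    fix z assume z: "z \<in> C"
    then have "z \<in> B" "(x, z) \<in> E" using x(2) by (auto simp: rel_restrict_def)
    then obtain d where "d \<in> D" "(d, z) \<in> F" using D(2) by blast
    then show "z \<in> \<Union>?\<D>" using z by blast
  qed auto
  moreover have "countable ?\<D>" using D(1) by auto
  ultimately show "\<exists>\<D>. countable \<D> \<and> \<D> \<subseteq> B // rel_restrict F B \<and> C = \<Union>\<D>" by blast
qed

lemma countable_cover_of_null:
  assumes E: "equiv UNIV E" and En: "\<And>n. equiv UNIV (En n)" "\<And>n. En n \<subseteq> E"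
    and null: "null E En UNIV"
  shows "\<exists>B :: nat \<Rightarrow> 'a::polish_space set. (\<Union>n. B n) = UNIV \<and>
      (\<forall>n. B n \<in> sets borel \<and> invariant_set (En n) (B n) \<and> countable_index_on E (En n) (B n))"
proof -
  obtain \<C> where C: "countable \<C>" "\<forall>C\<in>\<C>. \<exists>i. basic E En i C" "UNIV = \<Union>\<C>"
    using null unfolding null_def by blast
  define B where "B n = \<Union>{C\<in>\<C>. basic E En n C}" for n
  have c: "countable {C\<in>\<C>. basic E En n C}" for n using C(1) by (rule countable_subset[rotated]) auto
  have "(\<Union>n. B n) = UNIV"
  proof (intro equalityI subsetI)
    fix x :: 'a
    obtain A where A: "A \<in> \<C>" "x \<in> A" using C(3) by blast
    then obtain i where "basic E En i A" using C(2) by blast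
    then show "x \<in> (\<Union>n. B n)" using A unfolding B_def by blast
  qed simp
  moreover have "B n \<in> sets borel" for n
    unfolding B_def by (rule sets.countable_Union[OF c]) (auto simp: basic_def)
  moreover have "invariant_set (En n) (B n)" for n
    unfolding B_def basic_def invariant_set_def by blast
  moreover have "countable_index_on E (En n) (B n)" for n
  proof (rule countable_index_of_ctbl_over[OF E En])
    show "ctbl_over E (En n) (B n)" unfolding ctbl_over_def
    proof
      fix x
      have "\<forall>C\<in>{C\<in>\<C>. basic E En n C}. \<exists>D. countable D \<and> (\<forall>z\<in>C. (x, z) \<in> E \<longrightarrow> (\<exists>d\<in>D. (d, z) \<in> En n))"
      proof
        fix C assume "C \<in> {C\<in>\<C>. basic E En n C}"
        then have "ctbl_over E (En n) C" by (simp add: basic_def)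
        then show "\<exists>D. countable D \<and> (\<forall>z\<in>C. (x, z) \<in> E \<longrightarrow> (\<exists>d\<in>D. (d, z) \<in> En n))"
          unfolding ctbl_over_def by (rule spec)
      qed
      then have "\<exists>D. \<forall>C\<in>{C\<in>\<C>. basic E En n C}.
          countable (D C) \<and> (\<forall>z\<in>C. (x, z) \<in> E \<longrightarrow> (\<exists>d\<in>D C. (d, z) \<in> En n))" by (rule bchoice)
      then obtain D where D': "\<forall>C\<in>{C\<in>\<C>. basic E En n C}.
          countable (D C) \<and> (\<forall>z\<in>C. (x, z) \<in> E \<longrightarrow> (\<exists>d\<in>D C. (d, z) \<in> En n))" by (rule exE)
      note D = bspec[OF D']
      have "countable (\<Union>C\<in>{C\<in>\<C>. basic E En n C}. D C)" by (rule countable_UN[OF c]) (rule conjunct1[OF D])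
      moreover have "\<exists>d\<in>(\<Union>C\<in>{C\<in>\<C>. basic E En n C}. D C). (d, z) \<in> En n" if z: "z \<in> B n" "(x, z) \<in> E" for z
      proof -
        obtain C where Cz: "C \<in> {C\<in>\<C>. basic E En n C}" "z \<in> C" using z(1) by (auto simp: B_def)
        from D[OF Cz(1)] have "\<forall>z\<in>C. (x, z) \<in> E \<longrightarrow> (\<exists>d\<in>D C. (d, z) \<in> En n)" by (rule conjunct2)
        then have "\<exists>d\<in>D C. (d, z) \<in> En n" using Cz(2) z(2) by simp
        then show ?thesis using Cz(1) by (meson UN_I)
      qed
      ultimately show "\<exists>D. countable D \<and> (\<forall>z\<in>B n. (x, z) \<in> E \<longrightarrow> (\<exists>d\<in>D. (d, z) \<in> En n))" by blast
    qed
  qed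
  ultimately show ?thesis by blast
qed

section \<open>Paths\<close>

text \<open>Slot \<open>0\<close> of a code carries a code of a point \<open>z\<close>, and slot \<open>q + 1\<close> a code of a pair in \<open>E\<close>, the
  link \<open>q\<close> of a path \<open>z = x\<^sub>0 E x\<^sub>1 E x\<^sub>2 \<dots>\<close>. The link \<open>q\<close> has level \<open>q\<close>, so two points of the frame
  whose levels from \<open>q\<close> on agree share \<open>x\<^sub>q\<close> and have \<open>E\<close>-equivalent initial points.\<close>

locale paths =
  fixes E :: "('a::polish_space \<times> 'a) set" and En :: "nat \<Rightarrow> ('a \<times> 'a) set"
    and D0 :: "(nat \<Rightarrow> nat) set" and g0 :: "(nat \<Rightarrow> nat) \<Rightarrow> 'a"
    and C :: "(nat \<Rightarrow> nat) set" and f :: "(nat \<Rightarrow> nat) \<Rightarrow> 'a \<times> 'a"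
    and DR :: "nat \<Rightarrow> (nat \<Rightarrow> nat) set" and gR :: "nat \<Rightarrow> (nat \<Rightarrow> nat) \<Rightarrow> 'a \<times> 'a"
    and rw :: "nat \<Rightarrow> nat" and sq :: "nat \<Rightarrow> nat \<Rightarrow> bool"
  assumes E: "equiv UNIV E" "analytic_set E"
    and En: "\<And>n. equiv UNIV (En n)" "\<And>n. En n \<in> sets borel" "\<And>n. En n \<subseteq> E"
    and D0: "closed D0" "continuous_on D0 g0" "g0 ` D0 = UNIV"
    and C: "closed C" "continuous_on C f" "f ` C = E"
    and DR: "\<And>i. closed (DR i)" "\<And>i. continuous_on (DR i) (gR i)" "\<And>i. gR i ` DR i = - En i"
    and rw: "\<And>k. rw k \<le> k"
    and sq: "\<And>p n x. \<exists>k\<ge>n. rw k = p \<and> (\<forall>i<n. sq k i = x i)"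
begin

definition slot :: "(nat \<times> nat \<Rightarrow> nat) \<Rightarrow> nat \<Rightarrow> nat \<Rightarrow> nat" where
  "slot c q m = c (q, m)"

text \<open>The subtraction is truncated: the initial point and the link \<open>0\<close> both have
  level \<open>0\<close>.\<close>

definition lev :: "nat \<times> nat \<Rightarrow> nat" where
  "lev j = fst j - 1"

definition origin :: "(nat \<times> nat \<Rightarrow> nat) \<Rightarrow> 'a" where
  "origin c = g0 (slot c 0)"

definition node :: "(nat \<times> nat \<Rightarrow> nat) \<Rightarrow> nat \<Rightarrow> 'a" where
  "node c q = fst (f (slot c (Suc q)))"

definition P :: "(nat \<times> nat \<Rightarrow> nat) set" where
  "P = {c. slot c 0 \<in> D0 \<and> (\<forall>q. slot c (Suc q) \<in> C) \<and> node c 0 = origin c \<and>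
     (\<forall>q. snd (f (slot c (Suc q))) = node c (Suc q))}"

text \<open>The same leaf, the initial point, is listed once for each index up to \<open>p\<close>.
  Separation on row \<open>p\<close> then means leaving \<open>En 0\<close> to \<open>En p\<close>
  at once.\<close>

definition Lf :: "nat \<Rightarrow> (((nat \<times> nat \<Rightarrow> nat) \<Rightarrow> 'a) \<times> nat) list" where
  "Lf p = map (\<lambda>i. (origin, i)) [0..<Suc p]"

text \<open>Only data of level below \<open>K\<close> are frozen at stage \<open>K\<close>. Higher
  links stay free, which is what makes tails of paths exchangeable.\<close>

definition act :: "nat \<Rightarrow> (nat \<times> nat) set" where
  "act K = {j. lev j < K}"

lemma cont_slot: "continuous_on S (\<lambda>c. slot c q)"
  unfolding slot_def by (rule continuous_on_comp_index)

lemma closed_P: "closed P" and cont_origin: "continuous_on P origin"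
proof -
  define K where "K = {c\<in>UNIV. slot c 0 \<in> D0} \<inter> (\<Inter>q. {c\<in>UNIV. slot c (Suc q) \<in> C})"
  have K: "closed K" unfolding K_def by (intro closed_Int closed_INT ballI closed_pre D0 C cont_slot) simp_all
  have "continuous_on K (g0 \<circ> (\<lambda>c. slot c 0))"
    by (rule continuous_on_compose[OF cont_slot continuous_on_subset[OF D0(2)]]) (auto simp: K_def)
  then have z: "continuous_on K origin" by (simp add: o_def origin_def[abs_def])
  have f: "continuous_on K (\<lambda>c. f (slot c (Suc q)))" for q
  proof -
    have "continuous_on K (f \<circ> (\<lambda>c. slot c (Suc q)))"
      by (rule continuous_on_compose[OF cont_slot continuous_on_subset[OF C(2)]]) (auto simp: K_def)
    then show ?thesis by (simp add: o_def)
  qed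
  have n: "continuous_on K (\<lambda>c. node c q)" for q unfolding node_def by (rule continuous_on_fst[OF f])
  have "closed {c\<in>K. node c 0 = origin c}" by (rule closed_agree[OF K n z])
  moreover have "closed (\<Inter>q. {c\<in>K. snd (f (slot c (Suc q))) = node c (Suc q)})"
    by (intro closed_INT ballI closed_agree[OF K continuous_on_snd[OF f] n])
  moreover have PK: "P = {c\<in>K. node c 0 = origin c} \<inter> (\<Inter>q. {c\<in>K. snd (f (slot c (Suc q))) = node c (Suc q)})"
    by (auto simp: P_def K_def)
  ultimately show "closed P" by (simp only: closed_Int)
  show "continuous_on P origin" by (rule continuous_on_subset[OF z]) (auto simp: PK)
qed

sublocale frame lev P Lf En DR gR rw sq act
proof
  fix p l i assume "(l, i) \<in> set (Lf p)"
  then show "continuous_on P l" using cont_origin by (auto simp: Lf_def)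
next
  fix j :: "nat \<times> nat"
  show "\<exists>K0. \<forall>K\<ge>K0. j \<in> act K" unfolding act_def by (intro exI[of _ "Suc (lev j)"]) auto
qed (use closed_P En DR in auto)

lemma E_sym: "(x, y) \<in> E \<Longrightarrow> (y, x) \<in> E" and E_trans: "(x, y) \<in> E \<Longrightarrow> (y, z) \<in> E \<Longrightarrow> (x, z) \<in> E"
  and E_refl: "(x, x) \<in> E"
  using E(1) by (meson UNIV_I equiv_def refl_onD symD transD)+

lemma node_E: "c \<in> P \<Longrightarrow> (origin c, node c q) \<in> E"
proof (induction q)
  case 0
  then show ?case using E_refl by (simp add: P_def)
next
  case (Suc q)
  have "f (slot c (Suc q)) \<in> E" using Suc.prems C(3) by (auto simp: P_def)
  moreover have "f (slot c (Suc q)) = (node c q, node c (Suc q))"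
    using Suc.prems by (simp add: P_def node_def prod_eq_iff)
  ultimately show ?case using Suc E_trans by metis
qed

lemma legal_common:
  assumes "legal K \<Gamma>" "length u = K" "length v = K" "K \<le> lev j"
  shows "\<Gamma> u (Inl j) = \<Gamma> v (Inl j)"
proof -
  have "\<not> lev j \<le> rw k" if "k < K" for k using rw[of k] that assms(4) by simp
  then show ?thesis using assms(1-3) unfolding legal_def by blast
qed

lemma legal_common_slot:
  assumes "legal K \<Gamma>" "length u = K" "length v = K" "K \<le> q"
  shows "slot (base (\<Gamma> u)) (Suc q) = slot (base (\<Gamma> v)) (Suc q)"
  using legal_common[OF assms(1-3), of "(Suc q, m)" for m] assms(4)
  by (simp add: fun_eq_iff slot_def base_def lev_def)

lemma legal_P: "legal K \<Gamma> \<Longrightarrow> length u = K \<Longrightarrow> base (\<Gamma> u) \<in> P"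
  by (simp add: legal_def)

text \<open>Since \<open>rw k\<close> never exceeds \<open>k\<close>, all bits of stage
  \<open>K\<close> lie in rows below \<open>K\<close>. The link \<open>K\<close> is thus common to
  all leaves, and each of them is equivalent to the point where it begins.\<close>

lemma legal_leaves_E:
  assumes "legal K \<Gamma>" "length u = K" "length v = K"
  shows "(origin (base (\<Gamma> u)), origin (base (\<Gamma> v))) \<in> E"
proof -
  have "node (base (\<Gamma> u)) K = node (base (\<Gamma> v)) K"
    using legal_common_slot[OF assms order_refl] by (simp add: node_def)
  then show ?thesis using node_E[OF legal_P[OF assms(1,2)], of K] node_E[OF legal_P[OF assms(1,3)], of K]
    E_sym E_trans by metis
qed

section \<open>Heavy cells of configurations of paths\<close>

definition avoiding :: "nat \<Rightarrow> (nat \<times> nat) config \<Rightarrow> 'a set \<Rightarrow> (nat \<times> nat) config set" where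
  "avoiding K \<Gamma> B = NB K \<Gamma> (\<lambda>c. origin c \<notin> B)"

definition leaf :: "bool list \<times> nat \<Rightarrow> (nat \<times> nat) config \<Rightarrow> 'a" where
  "leaf s \<Gamma> = origin (base (\<Gamma> (fst s)))"

definition ind :: "nat \<Rightarrow> nat \<Rightarrow> (bool list \<times> nat) set" where
  "ind K p = {u. length u = K} \<times> {..p}"

abbreviation "lvx K S \<equiv> lvo (lvS K) K leaf snd (ind K K - S)"

text \<open>The starting position is existentially quantified. For a fixed \<open>E\<close>-class,
  the exchange of tails below provides one position that works for all cells.\<close>

definition heavy :: "nat \<Rightarrow> (nat \<times> nat) config set \<Rightarrow> (bool list \<times> nat) set \<Rightarrow> (nat \<times> nat) config \<Rightarrow> bool" where
  "heavy K a S g \<longleftrightarrow> (\<exists>c. live simS (lvx K S) En (Suc K) (cell En leaf snd a S g) c)"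

lemma finite_ind: "finite (ind K p)"
  using finite_lists_length_eq[of "UNIV :: bool set" K] by (simp add: ind_def)

lemma lvS_ind: "lvS K p \<Gamma> = (\<lambda>s. (leaf s \<Gamma>, snd s)) ` ind K p"
  by (force simp: lvS_def lvL_def Lf_def ind_def leaf_def)

lemma heavy_empty: "heavy K a {} g \<longleftrightarrow> (\<exists>c. live simS (lvS K) En (Suc K) a c)"
proof -
  have "lvx K {} = lvS K" by (auto simp: lvo_def lvS_ind fun_eq_iff)
  then show ?thesis by (simp add: heavy_def cell_def)
qed

lemma avoiding_mono: "B \<subseteq> B' \<Longrightarrow> avoiding K \<Gamma> B' \<subseteq> avoiding K \<Gamma> B"
  by (auto simp: avoiding_def NB_def)

lemma heavy_mono: "heavy K a S g \<Longrightarrow> a \<subseteq> b \<Longrightarrow> heavy K b S g"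
  unfolding heavy_def cell_def by (blast intro: live_mono)

text \<open>The cells of level at least \<open>K\<close> are common to all leaves and lie outside the window of stage
  \<open>K\<close>, hence the tail of a path may be replaced by any path inside the same \<open>E\<close>-class.\<close>

lemma live_exchange_tail:
  assumes S: "s \<in> S" "S \<subseteq> ind K K"
  shows "\<exists>c0. \<forall>g c. (v, leaf s g) \<in> E \<longrightarrow> live simS (lvx K S) En (Suc K) (cell En leaf snd (avoiding K \<Gamma> B) S g) c \<longrightarrow>
    live simS (lvx K S) En (Suc K) (cell En leaf snd (avoiding K \<Gamma> B) S g) c0"
proof -
  obtain cv where cv: "cv \<in> C" "f cv = (v, v)" using C(3) E_refl[of v] by (metis imageE)
  define c0 where "c0 u c = (case c of Inl (q, m) \<Rightarrow> if K + 2 \<le> q then cv m else 0 | Inr _ \<Rightarrow> 0)"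
    for u :: "bool list" and c :: "(nat \<times> nat) cell"
  define lk where "lk x = (SOME w. w \<in> C \<and> f w = (x, v))" for x
  have lk: "lk x \<in> C \<and> f (lk x) = (x, v)" if "(x, v) \<in> E" for x
  proof -
    have "\<exists>w. w \<in> C \<and> f w = (x, v)" using that C(3) by (metis imageE)
    then show ?thesis unfolding lk_def by (rule someI_ex)
  qed
  \<comment> \<open>The path is followed up to its node \<open>K\<close>, joined to \<open>v\<close>
    by a single link in slot \<open>K + 1\<close>, and left at \<open>v\<close> from there on. The
    new link depends only on node \<open>K\<close>, so coherence is kept.\<close>
  define h where "h \<Gamma>' u c = (case c of
      Inl (q, m) \<Rightarrow> if K + 2 \<le> q then cv m else if q = K + 1 then lk (node (base (\<Gamma>' u)) K) m else \<Gamma>' u c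
    | Inr _ \<Rightarrow> \<Gamma>' u c)"
    for \<Gamma>' :: "(nat \<times> nat) config" and u :: "bool list" and c :: "(nat \<times> nat) cell"
  have sl: "slot (base (h \<Gamma>' u)) q = (if K + 2 \<le> q then cv else if q = K + 1 then lk (node (base (\<Gamma>' u)) K)
      else slot (base (\<Gamma>' u)) q)" for \<Gamma>' u q
    by (auto simp: slot_def base_def h_def fun_eq_iff)
  have zh: "origin (base (h \<Gamma>' u)) = origin (base (\<Gamma>' u))" for \<Gamma>' u by (simp add: origin_def sl)
  have h_in: "h \<Gamma>' \<in> avoiding K \<Gamma> B" if \<Gamma>': "\<Gamma>' \<in> avoiding K \<Gamma> B" "(v, leaf s \<Gamma>') \<in> E" for \<Gamma>'
  proof -
    have leg: "legal K \<Gamma>'" using \<Gamma>'(1) by (simp add: avoiding_def NB_def)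
    have ls: "length (fst s) = K" using S by (auto simp: ind_def)
    have nv: "(node (base (\<Gamma>' u)) K, v) \<in> E" if "length u = K" for u
    proof -
      have "(origin (base (\<Gamma>' u)), leaf s \<Gamma>') \<in> E" unfolding leaf_def by (rule legal_leaves_E[OF leg that ls])
      then show ?thesis using node_E[OF legal_P[OF leg that], of K] \<Gamma>'(2) E_sym E_trans by metis
    qed
    have "legal K (h \<Gamma>')" unfolding legal_def
    proof (intro conjI allI impI)
      fix u :: "bool list" assume u: "length u = K"
      note b = legal_P[OF leg u] and l = lk[OF nv[OF u]]
      let ?b = "base (\<Gamma>' u)" and ?h = "base (h \<Gamma>' u)"
      have node_h: "node ?h q = (if q \<le> K then node ?b q else v)" for q
        using l cv by (auto simp: node_def sl)
      show "?h \<in> P" unfolding P_def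
      proof (intro CollectI conjI allI)
        show "slot ?h 0 \<in> D0" using b by (simp add: sl P_def)
        show "node ?h 0 = origin ?h" using b by (simp add: node_h zh P_def)
        fix q
        show "slot ?h (Suc q) \<in> C" using b l cv by (simp add: sl P_def)
        show "snd (f (slot ?h (Suc q))) = node ?h (Suc q)" using b l cv by (auto simp: sl node_h P_def)
      qed
    next
      fix u v :: "bool list" and j
      assume uv: "length u = K" "length v = K" and eq: "\<forall>k<K. lev j \<le> rw k \<longrightarrow> u ! k = v ! k"
      have 1: "\<Gamma>' u (Inl j) = \<Gamma>' v (Inl j)" using leg uv eq unfolding legal_def by blast
      have 2: "node (base (\<Gamma>' u)) K = node (base (\<Gamma>' v)) K"
        using legal_common_slot[OF leg uv order_refl] by (simp add: node_def)
      show "h \<Gamma>' u (Inl j) = h \<Gamma>' v (Inl j)" using 1 2 by (cases j) (simp add: h_def)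
    next
      fix k u assume k: "k < K" "length u = K" "take k u = pre (sq k) k" "\<not> u ! k"
      then have "edge k (\<Gamma>' u) (\<Gamma>' (u[k := True]))" using leg by (simp add: legal_def)
      moreover have "(\<lambda>m. h \<Gamma>' u (Inr (k, n, m))) = (\<lambda>m. \<Gamma>' u (Inr (k, n, m)))" for n by (simp add: h_def)
      moreover have "Lf (rw k) ! n = (origin, n)" if "n < length (Lf (rw k))" for n
        using that by (simp add: Lf_def del: upt_Suc)
      ultimately show "edge k (h \<Gamma>' u) (h \<Gamma>' (u[k := True]))" by (simp add: edge_def zh)
    qed
    moreover have "h \<Gamma>' \<in> win K \<Gamma>" unfolding win_def
    proof (intro CollectI allI impI)
      fix u c assume uc: "length (u :: bool list) = K" "c \<in> W K"
      have "h \<Gamma>' u c = \<Gamma>' u c" using uc(2) by (auto simp: W_def act_def lev_def h_def split: sum.splits)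
      then show "h \<Gamma>' u c = \<Gamma> u c" using \<Gamma>'(1) uc by (simp add: avoiding_def NB_def win_def)
    qed
    ultimately show ?thesis using \<Gamma>'(1) by (simp add: avoiding_def NB_def zh)
  qed
  have "live simS (lvx K S) En (Suc K) (cell En leaf snd (avoiding K \<Gamma> B) S g) c0"
    if vg: "(v, leaf s g) \<in> E" and L: "live simS (lvx K S) En (Suc K) (cell En leaf snd (avoiding K \<Gamma> B) S g) c" for g c
  proof -
    let ?c = "cell En leaf snd (avoiding K \<Gamma> B) S g"
    have lh: "leaf t (h \<Gamma>') = leaf t \<Gamma>'" for t \<Gamma>' by (simp add: leaf_def zh)
    have "live simS (lvx K S) En (Suc K) (h ` ?c) (h c)"
    proof (rule live_map[OF _ _ L])
      fix p and \<Gamma>1 \<Gamma>2 :: "(nat \<times> nat) config" assume p: "p < Suc K" "simS p \<Gamma>1 \<Gamma>2"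
      have agree: "\<Gamma>1 u (Inl (q, m)) = \<Gamma>2 u (Inl (q, m))" if "p < q - 1" for u q m
        using p(2) that by (simp add: simS_def lev_def)
      have "node (base (\<Gamma>1 u)) K = node (base (\<Gamma>2 u)) K" if "p < K" for u
        using agree[of "Suc K" u] that by (simp add: node_def slot_def[abs_def] base_def)
      then show "simS p (h \<Gamma>1) (h \<Gamma>2)" using agree unfolding simS_def
        by (auto simp: h_def lev_def)
    next
      fix p \<Gamma>' show "lvx K S p (h \<Gamma>') \<subseteq> lvx K S p \<Gamma>'" by (simp add: lvo_def lvS_ind lh)
    qed
    moreover have "h ` ?c \<subseteq> ?c"
    proof (intro image_subsetI)
      fix \<Gamma>' assume G: "\<Gamma>' \<in> ?c"
      then have "(leaf s g, leaf s \<Gamma>') \<in> En (snd s)" using S by (simp add: cell_def)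
      then have "(v, leaf s \<Gamma>') \<in> E" using En(3) vg E_trans by blast
      then show "h \<Gamma>' \<in> ?c" using G h_in[of \<Gamma>'] by (simp add: cell_def lh)
    qed
    ultimately have "live simS (lvx K S) En (Suc K) ?c (h c)" by (rule live_mono)
    moreover have "simS K (h c) c0" unfolding simS_def by (auto simp: h_def c0_def lev_def)
    ultimately show ?thesis using live_cong_top[OF level_sim_simS] by metis
  qed
  then show ?thesis by (intro exI[of _ c0]) blast
qed

text \<open>A pair of configurations is coded as one point: the first is played, the second is the
  centre \<open>g\<close> of the cell. All coordinates of \<open>g\<close> get level
  \<open>Suc K\<close>, so no answer can change \<open>g\<close>, and its leaf is read off from data
  that codes preserve.\<close>

lemma analytic_heavy:
  assumes B: "B \<in> sets borel" and S: "s \<in> S" "S \<subseteq> ind K K"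
  shows "analytic_set {leaf s g |g. g \<in> avoiding K \<Gamma> B \<and> heavy K (avoiding K \<Gamma> B) S g}"
proof -
  define un1 where "un1 x u c = x (Inl (u, c))" for x :: "(bool list \<times> (nat \<times> nat) cell) + (bool list \<times> (nat \<times> nat) cell) \<Rightarrow> nat" and u c
  define un2 where "un2 x u c = x (Inr (u, c))" for x :: "(bool list \<times> (nat \<times> nat) cell) + (bool list \<times> (nat \<times> nat) cell) \<Rightarrow> nat" and u c
  have cb: "continuous_on T (\<lambda>x. base (un1 x u))" "continuous_on T (\<lambda>x. base (un2 x u))" for T u
    unfolding base_def un1_def un2_def by (rule continuous_on_comp_index)+
  have cu: "continuous_on T un1" "continuous_on T un2" for T
    unfolding un1_def[abs_def] un2_def[abs_def]
    by (intro continuous_on_coordinatewise_then_product continuous_on_coord)+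
  let ?cl = "{\<Gamma>. legal K \<Gamma>} \<inter> win K \<Gamma>"
  let ?U = "{u :: bool list. length u = K}"
  define A0 where "A0 = {x\<in>{x\<in>UNIV. un1 x \<in> ?cl}. un2 x \<in> ?cl}"
  have "closed A0" unfolding A0_def by (intro closed_pre closed_Int closed_legal closed_win cu closed_UNIV)
  then have A0: "analytic_set A0" by (rule analytic_closed_fun)
  have cz1: "continuous_on A0 (\<lambda>x. origin (base (un1 x u)))" and cz2: "continuous_on A0 (\<lambda>x. origin (base (un2 x u)))"
    if "u \<in> ?U" for u
  proof -
    have "continuous_on A0 (origin \<circ> (\<lambda>x. base (un1 x u)))"
      by (rule continuous_on_compose[OF cb(1) continuous_on_subset[OF cont_origin]])
        (use that in \<open>auto simp: A0_def legal_P\<close>)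
    moreover have "continuous_on A0 (origin \<circ> (\<lambda>x. base (un2 x u)))"
      by (rule continuous_on_compose[OF cb(2) continuous_on_subset[OF cont_origin]])
        (use that in \<open>auto simp: A0_def legal_P\<close>)
    ultimately show "continuous_on A0 (\<lambda>x. origin (base (un1 x u)))" "continuous_on A0 (\<lambda>x. origin (base (un2 x u)))"
      by (simp_all add: o_def)
  qed
  define A1 where "A1 = {x\<in>A0. \<forall>u\<in>?U. (origin (base (un1 x u)), origin (base (un2 x u))) \<in> (- B) \<times> (- B)}"
  have mB: "- B \<in> sets borel" using B sets.compl_sets[of B borel] by (simp add: Compl_eq_Diff_UNIV)
  have "analytic_set ((- B) \<times> (- B))" by (rule analytic_Times[OF analytic_borel[OF mB] analytic_borel[OF mB]])
  then have A1: "analytic_set A1" unfolding A1_def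
    by (intro analytic_finite_preimages A0 continuous_on_Pair cz1 cz2)
      (use finite_lists_length_eq[of "UNIV :: bool set" K] in auto)
  define A2 where "A2 = {x\<in>A1. \<forall>t\<in>S. (origin (base (un2 x (fst t))), origin (base (un1 x (fst t)))) \<in> En (snd t)}"
  have fS: "finite S" using S(2) finite_ind finite_subset by blast
  have SU: "fst t \<in> ?U" if "t \<in> S" for t using S(2) that by (auto simp: ind_def)
  have A1A0: "A1 \<subseteq> A0" by (auto simp: A1_def)
  have A2: "analytic_set A2" unfolding A2_def
    by (intro analytic_finite_preimages A1 fS continuous_on_Pair analytic_borel En
        continuous_on_subset[OF cz1 A1A0] continuous_on_subset[OF cz2 A1A0] SU)
  have A2A0: "A2 \<subseteq> A0" using A1A0 by (auto simp: A2_def)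
  have A2_iff: "x \<in> A2 \<longleftrightarrow> un2 x \<in> avoiding K \<Gamma> B \<and> un1 x \<in> cell En leaf snd (avoiding K \<Gamma> B) S (un2 x)" for x
    by (auto simp: A2_def A1_def A0_def avoiding_def NB_def cell_def leaf_def)
  define lev' where "lev' j = (case j of Inl (u, c) \<Rightarrow> (case c of Inl j \<Rightarrow> lev j | Inr _ \<Rightarrow> 0) | Inr _ \<Rightarrow> Suc K)"
    for j :: "(bool list \<times> (nat \<times> nat) cell) + (bool list \<times> (nat \<times> nat) cell)"
  define Ip where "Ip p = (if p = K then ind K K - S else ind K p)" for p
  have "\<exists>xs. set xs = Ip p" for p using finite_ind by (intro finite_list) (simp add: Ip_def)
  then obtain xs where xs: "\<And>p. set (xs p) = Ip p" by metis
  define Lf' where "Lf' p = map (\<lambda>t. ((\<lambda>x. leaf t (un1 x)), snd t)) (xs p)" for p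
  have lv: "lvL Lf' p x = lvx K S p (un1 x)" for p x
    by (auto simp: lvL_def Lf'_def xs Ip_def lvo_def lvS_ind image_image)
  have IpU: "fst t \<in> ?U" if "t \<in> Ip p" for t p using that by (auto simp: Ip_def ind_def split: if_splits)
  have an: "analytic_set {leaf s (un2 x) |x. live (simL lev') (lvL Lf') En (Suc K) A2 x}"
  proof (rule analytic_live[OF A2 _ En(1) En(2)])
    fix p l i assume "(l, i) \<in> set (Lf' p)"
    then obtain t where t: "t \<in> Ip p" "l = (\<lambda>x. leaf t (un1 x))" by (auto simp: Lf'_def xs)
    show "continuous_on A2 l" unfolding t(2) leaf_def
      by (rule continuous_on_subset[OF cz1[OF IpU[OF t(1)]] A2A0])
  next
    show "continuous_on A2 (\<lambda>x. leaf s (un2 x))" unfolding leaf_def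
      by (rule continuous_on_subset[OF cz2[OF SU[OF S(1)]] A2A0])
  next
    fix x y :: "(bool list \<times> (nat \<times> nat) cell) + (bool list \<times> (nat \<times> nat) cell) \<Rightarrow> nat"
    assume xy: "\<And>j. Suc K \<le> lev' j \<Longrightarrow> x j = y j"
    have "un2 x = un2 y" by (auto simp: un2_def fun_eq_iff intro!: xy) (simp add: lev'_def)
    then show "leaf s (un2 x) = leaf s (un2 y)" by simp
  qed simp
  have "{leaf s (un2 x) |x. live (simL lev') (lvL Lf') En (Suc K) A2 x} =
      {leaf s g |g. g \<in> avoiding K \<Gamma> B \<and> heavy K (avoiding K \<Gamma> B) S g}"
  proof (intro equalityI subsetI)
    fix y assume "y \<in> {leaf s (un2 x) |x. live (simL lev') (lvL Lf') En (Suc K) A2 x}"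
    then obtain x where x: "y = leaf s (un2 x)" "live (simL lev') (lvL Lf') En (Suc K) A2 x" by blast
    let ?A = "{b\<in>A2. simL lev' K x b}"
    have L: "live (simL lev') (lvL Lf') En (Suc K) ?A x" by (rule live_restrict_sim[OF level_sim_simL x(2)])
    have same: "un2 b = un2 x" if "b \<in> ?A" for b
      using that by (auto simp: simL_def un2_def fun_eq_iff lev'_def)
    have "live simS (lvx K S) En (Suc K) (un1 ` ?A) (un1 x)"
    proof (rule live_map[OF _ _ L])
      show "simS p (un1 a) (un1 b)" if "simL lev' p a b" for p a b
        using that unfolding simS_def simL_def un1_def by (auto simp: lev'_def)
    qed (simp add: lv)
    moreover have "un1 ` ?A \<subseteq> cell En leaf snd (avoiding K \<Gamma> B) S (un2 x)"
    proof (intro image_subsetI)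
      fix b assume b: "b \<in> ?A"
      then show "un1 b \<in> cell En leaf snd (avoiding K \<Gamma> B) S (un2 x)" using A2_iff[of b] same[OF b] by auto
    qed
    ultimately have "heavy K (avoiding K \<Gamma> B) S (un2 x)" unfolding heavy_def by (blast intro: live_mono)
    moreover obtain b where b: "b \<in> ?A" using live_nonempty[OF L] by blast
    then have "un2 x \<in> avoiding K \<Gamma> B" using A2_iff[of b] same[OF b] by auto
    ultimately show "y \<in> {leaf s g |g. g \<in> avoiding K \<Gamma> B \<and> heavy K (avoiding K \<Gamma> B) S g}" using x(1) by blast
  next
    fix y assume "y \<in> {leaf s g |g. g \<in> avoiding K \<Gamma> B \<and> heavy K (avoiding K \<Gamma> B) S g}"
    then obtain g c where g: "y = leaf s g" "g \<in> avoiding K \<Gamma> B"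
      "live simS (lvx K S) En (Suc K) (cell En leaf snd (avoiding K \<Gamma> B) S g) c" unfolding heavy_def by blast
    define h where "h \<Gamma>' = case_sum (\<lambda>(u, c). \<Gamma>' u c) (\<lambda>(u, c). g u c)" for \<Gamma>' :: "(nat \<times> nat) config"
    have h: "un1 (h \<Gamma>') = \<Gamma>'" "un2 (h \<Gamma>') = g" for \<Gamma>' by (simp_all add: un1_def un2_def h_def fun_eq_iff)
    have "live (simL lev') (lvL Lf') En (Suc K) (h ` cell En leaf snd (avoiding K \<Gamma> B) S g) (h c)"
    proof (rule live_map[OF _ _ g(3)])
      show "simL lev' p (h a) (h b)" if "simS p a b" for p a b
        using that unfolding simS_def simL_def by (auto simp: lev'_def h_def split: sum.splits)
    qed (simp add: lv h)
    then have "live (simL lev') (lvL Lf') En (Suc K) A2 (h c)"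
      by (rule live_mono) (use g(2) in \<open>auto simp: A2_iff h\<close>)
    then show "y \<in> {leaf s (un2 x) |x. live (simL lev') (lvL Lf') En (Suc K) A2 x}"
      using g(1) h(2)[of c] by (intro CollectI exI[of _ "h c"]) simp
  qed
  then show ?thesis using an by simp
qed

text \<open>Minimality of \<open>S\<close> and the common position from the exchange of tails leave
  only countably many classes of leaves over one \<open>E\<close>-class. Watching a single leaf
  \<open>s\<close> of \<open>S\<close> suffices: a configuration that avoids a basic set around
  these leaves is not the centre of a heavy cell.\<close>

lemma remove_heavy:
  assumes B: "null E En B" and S: "S \<noteq> {}" "S \<subseteq> ind K K"
    and light: "\<And>J g. J \<subset> S \<Longrightarrow> g \<in> avoiding K \<Gamma> B \<Longrightarrow> \<not> heavy K (avoiding K \<Gamma> B) J g"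
  shows "\<exists>B'. null E En B' \<and> (\<forall>g\<in>avoiding K \<Gamma> B'. g \<in> avoiding K \<Gamma> B \<longrightarrow> \<not> heavy K (avoiding K \<Gamma> B) S g)"
proof -
  let ?a = "avoiding K \<Gamma> B"
  obtain s where s: "s \<in> S" using S(1) by blast
  let ?A = "{leaf s g |g. g \<in> ?a \<and> heavy K ?a S g}"
  have ctbl: "ctbl_over E (En (snd s)) ?A" unfolding ctbl_over_def
  proof
    fix v
    obtain c0 where c0: "\<And>g c. (v, leaf s g) \<in> E \<Longrightarrow> live simS (lvx K S) En (Suc K) (cell En leaf snd ?a S g) c \<Longrightarrow>
      live simS (lvx K S) En (Suc K) (cell En leaf snd ?a S g) c0"
      using live_exchange_tail[OF s S(2), of v \<Gamma> B] by blast
    define H where "H = {g\<in>?a. heavy K ?a S g \<and> (v, leaf s g) \<in> E}"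
    have "\<exists>Q. countable Q \<and> (\<forall>g\<in>H. \<exists>q\<in>Q. \<forall>s\<in>S. (leaf s q, leaf s g) \<in> En (snd s))"
    proof (rule countable_heavy_cells[OF finite_ind S(2) En(1)])
      show "\<not> live simS (lvx K J) En (Suc K) (cell En leaf snd ?a J g) c0" if "J \<subset> S" "g \<in> ?a" for J g
        using light[OF that] unfolding heavy_def by blast
      show "H \<subseteq> ?a" by (auto simp: H_def)
      show "live simS (lvx K S) En (Suc K) (cell En leaf snd ?a S g) c0" if "g \<in> H" for g
        using that c0 unfolding H_def heavy_def by blast
    qed
    then obtain Q where Q: "countable Q" "\<And>g. g \<in> H \<Longrightarrow> \<exists>q\<in>Q. \<forall>s\<in>S. (leaf s q, leaf s g) \<in> En (snd s)"
      by blast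
    have "\<exists>d\<in>leaf s ` Q. (d, z) \<in> En (snd s)" if z: "z \<in> ?A" "(v, z) \<in> E" for z
    proof -
      obtain g where g: "z = leaf s g" "g \<in> H" using z by (auto simp: H_def)
      then show ?thesis using Q(2)[OF g(2)] s by blast
    qed
    then show "\<exists>D. countable D \<and> (\<forall>z\<in>?A. (v, z) \<in> E \<longrightarrow> (\<exists>d\<in>D. (d, z) \<in> En (snd s)))"
      using Q(1) by (intro exI[of _ "leaf s ` Q"]) auto
  qed
  have "\<exists>B. ?A \<subseteq> B \<and> basic E En (snd s) B"
    by (intro basic_superset[where En = En and i = "snd s"] E En analytic_heavy[OF null_borel[OF B] s S(2)] ctbl)
  then obtain B' where B': "?A \<subseteq> B'" "basic E En (snd s) B'" by blast
  have "\<not> heavy K ?a S g" if g: "g \<in> avoiding K \<Gamma> B'" "g \<in> ?a" for g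
  proof
    assume "heavy K ?a S g"
    then have "leaf s g \<in> B'" using g(2) B'(1) by blast
    moreover have "length (fst s) = K" using s S(2) by (auto simp: ind_def)
    ultimately show False using g(1) by (auto simp: avoiding_def NB_def leaf_def)
  qed
  then show ?thesis using null_basic[OF B'(2)] by blast
qed

text \<open>Sets \<open>S\<close> are handled by increasing size, so their proper subsets have been
  dealt with before. Enlarging the null set shrinks the cells and creates no heavy ones. The empty
  set is covered by \<open>dead\<close>, as a heavy cell with nothing prescribed is just liveness at
  height \<open>Suc K\<close>.\<close>

lemma remove_all_heavy:
  assumes B: "null E En B" and dead: "\<And>c. \<not> live simS (lvS K) En (Suc K) (avoiding K \<Gamma> B) c"
  shows "\<exists>B'. null E En B' \<and> B \<subseteq> B' \<and>
    (\<forall>S g. S \<subseteq> ind K K \<longrightarrow> card S < n \<longrightarrow> g \<in> avoiding K \<Gamma> B' \<longrightarrow> \<not> heavy K (avoiding K \<Gamma> B') S g)"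
proof (induction n)
  case 0
  show ?case using B by (intro exI[of _ B]) simp
next
  case (Suc n)
  then obtain B' where B': "null E En B'" "B \<subseteq> B'"
    "\<And>S g. S \<subseteq> ind K K \<Longrightarrow> card S < n \<Longrightarrow> g \<in> avoiding K \<Gamma> B' \<Longrightarrow> \<not> heavy K (avoiding K \<Gamma> B') S g" by blast
  have "\<exists>B''. null E En B'' \<and> (\<forall>g\<in>avoiding K \<Gamma> B''. g \<in> avoiding K \<Gamma> B' \<longrightarrow> \<not> heavy K (avoiding K \<Gamma> B') S g)"
    if S: "S \<in> {S. S \<subseteq> ind K K \<and> card S = n}" for S
  proof (cases "S = {}")
    case True
    have "\<not> heavy K (avoiding K \<Gamma> B') {} g" for g
      using dead live_mono[OF _ avoiding_mono[OF B'(2)]] unfolding heavy_empty by blast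
    then show ?thesis using True null_empty by blast
  next
    case False
    have fS: "finite S" using S finite_ind finite_subset by blast
    show ?thesis
    proof (rule remove_heavy[OF B'(1) False])
      fix J g assume J: "J \<subset> S" "g \<in> avoiding K \<Gamma> B'"
      then have "card J < n" using S psubset_card_mono[OF fS J(1)] by simp
      then show "\<not> heavy K (avoiding K \<Gamma> B') J g" using B'(3)[of J g] J S by blast
    qed (use S in simp)
  qed
  then have "\<exists>BB. \<forall>S\<in>{S. S \<subseteq> ind K K \<and> card S = n}. null E En (BB S) \<and>
      (\<forall>g\<in>avoiding K \<Gamma> (BB S). g \<in> avoiding K \<Gamma> B' \<longrightarrow> \<not> heavy K (avoiding K \<Gamma> B') S g)"
    by (intro bchoice ballI)
  then obtain BB where BB': "\<forall>S\<in>{S. S \<subseteq> ind K K \<and> card S = n}. null E En (BB S) \<and>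
      (\<forall>g\<in>avoiding K \<Gamma> (BB S). g \<in> avoiding K \<Gamma> B' \<longrightarrow> \<not> heavy K (avoiding K \<Gamma> B') S g)" by (rule exE)
  note BB = bspec[OF BB']
  let ?X = "{S. S \<subseteq> ind K K \<and> card S = n}"
  define B'' where "B'' = B' \<union> (\<Union>S\<in>?X. BB S)"
  have "finite ?X" using finite_ind[of K K] by simp
  then have "null E En B''" unfolding B''_def using B'(1) BB by (intro null_Un null_UN) (auto intro: countable_finite)
  moreover have "\<not> heavy K (avoiding K \<Gamma> B'') S g" if h: "S \<subseteq> ind K K" "card S < Suc n" "g \<in> avoiding K \<Gamma> B''" for S g
  proof
    assume hv: "heavy K (avoiding K \<Gamma> B'') S g"
    have sub: "avoiding K \<Gamma> B'' \<subseteq> avoiding K \<Gamma> B'" by (rule avoiding_mono) (simp add: B''_def)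
    have hv': "heavy K (avoiding K \<Gamma> B') S g" by (rule heavy_mono[OF hv sub])
    have g': "g \<in> avoiding K \<Gamma> B'" using sub h(3) by blast
    show False
    proof (cases "card S < n")
      case True
      then show False using B'(3)[OF h(1) True g'] hv' by blast
    next
      case False
      then have S: "S \<in> ?X" using h by simp
      have "BB S \<subseteq> B''" using S by (auto simp: B''_def)
      then have "g \<in> avoiding K \<Gamma> (BB S)" using avoiding_mono h(3) by blast
      then show False using BB[OF S] g' hv' by blast
    qed
  qed
  moreover have "B \<subseteq> B''" using B'(2) by (auto simp: B''_def)
  ultimately show ?case by blast
qed

text \<open>A set of configurations that is live at height \<open>K\<close> but not at height \<open>K + 1\<close> contains heavy cells.
  A minimal kind of heavy cell meets every \<open>E\<close>-class in countably many \<open>En i\<close>-classes, and the set of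
  its leaves is analytic, hence inside a null set. Removing these null sets kills all heavy cells.\<close>

theorem new_level:
  assumes L: "\<And>B. null E En B \<Longrightarrow> \<exists>c. live simS (lvS K) En K (avoiding K \<Gamma> B) c" and B: "null E En B"
  shows "\<exists>c. live simS (lvS K) En (Suc K) (avoiding K \<Gamma> B) c"
proof (rule ccontr)
  assume "\<not> ?thesis"
  then have dead: "\<not> live simS (lvS K) En (Suc K) (avoiding K \<Gamma> B) c" for c by blast
  obtain B' where B': "null E En B'"
    "\<And>S g. S \<subseteq> ind K K \<Longrightarrow> card S < Suc (card (ind K K)) \<Longrightarrow> g \<in> avoiding K \<Gamma> B' \<Longrightarrow> \<not> heavy K (avoiding K \<Gamma> B') S g"
    using remove_all_heavy[OF B dead] by blast
  obtain c where c: "live simS (lvS K) En K (avoiding K \<Gamma> B') c" using L[OF B'(1)] by blast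
  have "simS K c c" by (simp add: simS_def)
  from live_maximal_cell[OF finite_ind[of K K] En(1) this c, of leaf snd]
  obtain S g where Sg: "S \<subseteq> ind K K" "g \<in> avoiding K \<Gamma> B'" "heavy K (avoiding K \<Gamma> B') S g"
    unfolding heavy_def by blast
  have "card S \<le> card (ind K K)" by (rule card_mono[OF finite_ind Sg(1)])
  then show False using B'(2)[OF Sg(1) _ Sg(2)] Sg(3) by simp
qed

end

section \<open>The dichotomy\<close>

context paths
begin

text \<open>The height equals the stage, since before stage \<open>K\<close> only rows below
  \<open>K\<close> occur. The starting position may depend on the null set that is removed.\<close>

definition large :: "nat \<Rightarrow> (nat \<times> nat) config \<Rightarrow> bool" where
  "large K \<Gamma> \<longleftrightarrow> legal K \<Gamma> \<and> (\<forall>B. null E En B \<longrightarrow> (\<exists>c. live simS (lvS K) En K (avoiding K \<Gamma> B) c))"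

text \<open>Outside a null set there is still a point, and its constant path is a configuration of
  stage \<open>0\<close>. The window of stage \<open>0\<close> is empty, so one neighbourhood
  contains all these configurations.\<close>

lemma large_0:
  assumes "\<not> null E En UNIV"
  shows "\<exists>\<Gamma>. large 0 \<Gamma>"
proof -
  have "\<exists>\<Gamma>. legal 0 \<Gamma> \<and> (\<forall>u. origin (base (\<Gamma> u)) = z)" for z
  proof -
    obtain d where d: "d \<in> D0" "g0 d = z" using D0(3) by (metis UNIV_I imageE)
    obtain w where w: "w \<in> C" "f w = (z, z)" using C(3) E_refl[of z] by (metis imageE)
    define \<Gamma> where "\<Gamma> u c = (case c of Inl (q, m) \<Rightarrow> if q = 0 then d m else w m | Inr _ \<Rightarrow> 0)"
      for u :: "bool list" and c :: "(nat \<times> nat) cell"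
    have sl: "slot (base (\<Gamma> u)) q = (if q = 0 then d else w)" for u q
      by (auto simp: slot_def base_def \<Gamma>_def fun_eq_iff)
    have "base (\<Gamma> u) \<in> P" for u using d w by (simp add: P_def sl node_def origin_def)
    then have "legal 0 \<Gamma>" unfolding legal_def by (simp add: \<Gamma>_def)
    moreover have "origin (base (\<Gamma> u)) = z" for u using d by (simp add: origin_def sl)
    ultimately show ?thesis by blast
  qed
  then obtain \<Gamma> where \<Gamma>: "\<And>z. legal 0 (\<Gamma> z)" "\<And>z u. origin (base (\<Gamma> z u)) = z" by metis
  have "\<exists>c. live simS (lvS 0) En 0 (avoiding 0 (\<Gamma> z0) B) c" if "null E En B" for B z0
  proof -
    have "B \<noteq> UNIV" using assms that by blast
    then obtain z where "z \<notin> B" by blast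
    then have "\<Gamma> z \<in> avoiding 0 (\<Gamma> z0) B" using \<Gamma> by (simp add: avoiding_def NB_def win_def W_def)
    then show ?thesis by auto
  qed
  then show ?thesis using \<Gamma>(1) unfolding large_def by blast
qed

text \<open>The height is raised before doubling, because row \<open>K\<close> may be the one that
  is doubled. A single window has to serve all null sets: if each window failed for some null set,
  the union of these countably many null sets would leave no live window.\<close>

lemma large_Suc:
  assumes "large K \<Gamma>"
  shows "\<exists>\<Gamma>'. large (Suc K) \<Gamma>' \<and> (\<forall>u b c. length u = K \<longrightarrow> c \<in> W K \<longrightarrow> \<Gamma>' (u @ [b]) c = \<Gamma> u c)"
proof -
  let ?d = "\<lambda>B. dbl K \<Gamma> (\<lambda>c. origin c \<notin> B)"
  let ?L = "live simS (lvS (Suc K)) En (Suc K)"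
  have L: "\<exists>c. ?L (?d B) c" if B: "null E En B" for B
  proof -
    obtain c where "live simS (lvS K) En (Suc K) (avoiding K \<Gamma> B) c"
      using new_level[of K \<Gamma> B] assms B unfolding large_def by blast
    then show ?thesis unfolding avoiding_def using live_double[of K "Suc K"] rw[of K] by (meson le_imp_less_Suc)
  qed
  have "\<exists>w\<in>range (win (Suc K)). \<forall>B. null E En B \<longrightarrow> (\<exists>c. ?L (?d B \<inter> w) c)"
  proof (rule ccontr)
    assume "\<not> ?thesis"
    then have "\<forall>w\<in>range (win (Suc K)). \<exists>B. null E En B \<and> (\<forall>c. \<not> ?L (?d B \<inter> w) c)" by blast
    then obtain B where B: "\<forall>w\<in>range (win (Suc K)). null E En (B w) \<and> (\<forall>c. \<not> ?L (?d (B w) \<inter> w) c)"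
      using bchoice by meson
    let ?B = "\<Union>w\<in>range (win (Suc K)). B w"
    have "null E En ?B" by (rule null_UN[OF countable_win]) (use B in blast)
    then obtain c where "?L (?d ?B) c" using L by blast
    moreover have "?d ?B \<subseteq> (\<Union>w\<in>range (win (Suc K)). ?d ?B \<inter> w)" using win_refl by auto
    ultimately have "?L (\<Union>w\<in>range (win (Suc K)). ?d ?B \<inter> w) c" by (rule live_mono)
    from live_UN[OF countable_win this] obtain w where w: "w \<in> range (win (Suc K))" "?L (?d ?B \<inter> w) c" by (rule bexE)
    have "?d ?B \<inter> w \<subseteq> ?d (B w) \<inter> w" using w(1) unfolding dbl_def by auto
    from live_mono[OF w(2) this] show False using B w(1) by blast
  qed
  then obtain w where w: "w \<in> range (win (Suc K))" "\<And>B. null E En B \<Longrightarrow> \<exists>c. ?L (?d B \<inter> w) c" by blast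
  obtain c0 where "?L (?d {} \<inter> w) c0" using w(2)[OF null_empty] by blast
  from live_nonempty[OF this] obtain \<Gamma>' where \<Gamma>': "\<Gamma>' \<in> ?d {}" "\<Gamma>' \<in> w" by auto
  have w': "w = win (Suc K) \<Gamma>'" using w(1) \<Gamma>'(2) win_eq by auto
  have "\<exists>c. ?L (avoiding (Suc K) \<Gamma>' B) c" if B: "null E En B" for B
  proof -
    obtain c where c: "?L (?d B \<inter> w) c" using w(2)[OF B] by blast
    have "?d B \<inter> w \<subseteq> avoiding (Suc K) \<Gamma>' B" unfolding w' avoiding_def by (auto simp: dbl_def NB_def)
    from live_mono[OF c this] show ?thesis by blast
  qed
  then show ?thesis using \<Gamma>'(1) unfolding large_def dbl_def by blast
qed

theorem homomorphism_of_not_null: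
  assumes "\<not> null E En UNIV"
  shows "\<exists>\<phi> :: (nat \<Rightarrow> nat \<Rightarrow> bool) \<Rightarrow> 'a. continuous_on UNIV \<phi> \<and>
      (\<forall>n. rel_homomorphism (EE1 - F0 n) (E - (\<Union>i\<le>n. En i)) \<phi>)"
proof -
  have "\<exists>\<Gamma>. \<forall>K. large K (\<Gamma> K) \<and> (\<forall>u b c. length u = K \<longrightarrow> c \<in> W K \<longrightarrow> \<Gamma> (Suc K) (u @ [b]) c = \<Gamma> K u c)"
    by (rule dependent_nat_choice) (rule large_0[OF assms], rule large_Suc)
  then obtain \<Gamma> where \<Gamma>: "\<And>K. large K (\<Gamma> K)"
    "\<And>K u b c. length u = K \<Longrightarrow> c \<in> W K \<Longrightarrow> \<Gamma> (Suc K) (u @ [b]) c = \<Gamma> K u c" by blast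
  have "\<exists>\<theta>\<in>codes. \<forall>x c K. thr c \<le> K \<longrightarrow> tab \<theta> x c = \<Gamma> K (pre x K) c"
    by (rule scheme) (use \<Gamma> in \<open>auto simp: large_def\<close>)
  then obtain \<theta> where \<theta>: "\<theta> \<in> codes" by blast
  have "rich UNIV" unfolding rich_def using sq by blast
  obtain \<Psi> :: "(nat \<Rightarrow> nat \<Rightarrow> bool) \<Rightarrow> nat \<times> nat \<Rightarrow> nat" where \<Psi>: "continuous_on UNIV \<Psi> \<and>
    (\<forall>X. \<exists>x. \<Psi> X = base (tab \<theta> x)) \<and>
    (\<forall>X Y j. (\<forall>r\<ge>lev j. X r = Y r) \<longrightarrow> \<Psi> X j = \<Psi> Y j) \<and>
    (\<forall>p\<in>UNIV. \<forall>X Y. (\<forall>r>p. X r = Y r) \<longrightarrow> X p \<noteq> Y p \<longrightarrow>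
       (\<forall>(l, i)\<in>set (Lf p). (l (\<Psi> X), l (\<Psi> Y)) \<notin> En i))"
    using thinning[OF \<theta> \<open>rich UNIV\<close>] by (rule exE)
  have \<Psi>P: "\<Psi> X \<in> P" for X
  proof -
    obtain x where "\<Psi> X = base (tab \<theta> x)" using \<Psi> by blast
    then show ?thesis using \<theta> by (simp add: codes_def)
  qed
  have "continuous_on UNIV (origin \<circ> \<Psi>)"
    by (rule continuous_on_compose[OF _ continuous_on_subset[OF cont_origin]]) (use \<Psi> \<Psi>P in auto)
  moreover have "rel_homomorphism (EE1 - F0 n) (E - (\<Union>i\<le>n. En i)) (origin \<circ> \<Psi>)" for n
    unfolding rel_homomorphism_def
  proof (intro image_subsetI)
    fix XY assume "XY \<in> EE1 - F0 n"
    then obtain X Y where XY: "XY = (X, Y)" "(X, Y) \<in> EE1" "(X, Y) \<notin> F0 n" by (cases XY) auto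
    obtain m where m: "\<forall>l\<ge>m. X l = Y l" using XY(2) by (auto simp: EE1_def F0_def)
    obtain r where r: "n \<le> r" "X r \<noteq> Y r" using XY(3) by (auto simp: F0_def)
    let ?D = "{r. X r \<noteq> Y r}"
    have "?D \<subseteq> {..<m}" using m by (auto simp: not_less[symmetric])
    then have fD: "finite ?D" by (rule finite_subset) simp
    \<comment> \<open>The highest row in which the points differ. It is at least \<open>n\<close>,
      so separation on this row covers all indices up to \<open>n\<close>.\<close>
    define p where "p = Max ?D"
    have p: "X p \<noteq> Y p" unfolding p_def using Max_in[OF fD] r(2) by blast
    have "n \<le> p" unfolding p_def using Max_ge[OF fD, of r] r by simp
    have above: "\<forall>r>p. X r = Y r"
    proof (intro allI impI, rule ccontr)
      fix q assume "p < q" "X q \<noteq> Y q"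
      then show False unfolding p_def using Max_ge[OF fD, of q] by simp
    qed
    have sep: "\<forall>(l, i)\<in>set (Lf p). (l (\<Psi> X), l (\<Psi> Y)) \<notin> En i" using \<Psi> above p by simp
    have "(origin (\<Psi> X), origin (\<Psi> Y)) \<notin> En i" if "i \<le> n" for i
    proof -
      have "(origin, i) \<in> set (Lf p)" using that \<open>n \<le> p\<close> by (auto simp: Lf_def)
      then show ?thesis using sep by blast
    qed
    moreover have "(origin (\<Psi> X), origin (\<Psi> Y)) \<in> E"
    proof -
      have "\<forall>X Y j. (\<forall>r\<ge>lev j. X r = Y r) \<longrightarrow> \<Psi> X j = \<Psi> Y j" using \<Psi> by blast
      \<comment> \<open>Slot \<open>p + 2\<close> is the link \<open>p + 1\<close>. It has level
        \<open>p + 1\<close> and so depends only on rows where \<open>X\<close> and \<open>Y\<close>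
        agree.\<close>
      then have "\<Psi> X (Suc (Suc p), i) = \<Psi> Y (Suc (Suc p), i)" for i using above by (simp add: lev_def)
      then have "node (\<Psi> X) (Suc p) = node (\<Psi> Y) (Suc p)" by (simp add: node_def slot_def[abs_def])
      then show ?thesis using node_E[OF \<Psi>P] E_sym E_trans by metis
    qed
    ultimately show "map_prod (origin \<circ> \<Psi>) (origin \<circ> \<Psi>) XY \<in> E - (\<Union>i\<le>n. En i)" using XY(1) by auto
  qed
  ultimately show ?thesis by blast
qed

end

section \<open>Incompatibility of the two alternatives\<close>

lemma dense_below_fst:
  assumes "\<And>z0. dense_below (\<lambda>_. UNIV) 0 z0 D"
  shows "dense_below (prow rw p) n0 w0 {w. (\<lambda>k. fst (w k)) \<in> D}"
  unfolding dense_below_def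
proof (intro allI impI)
  fix n w assume w: "w \<in> seqbox (prow rw p) n0 w0"
  let ?z = "\<lambda>k. fst (w k)"
  have "?z \<in> seqbox (\<lambda>_. UNIV) 0 ?z" by (simp add: seqbox_def seqs_def)
  then obtain m z' where m: "n \<le> m" "z' \<in> seqbox (\<lambda>_. UNIV) n ?z" "seqbox (\<lambda>_. UNIV) m z' \<subseteq> D"
    using assms[of ?z] unfolding dense_below_def by (metis le0)
  define w' where "w' k = (if k < n then w k else (z' k, z' k))" for k
  have z': "fst (w' k) = z' k" for k using m(2) by (auto simp: w'_def seqbox_def)
  have "w' \<in> seqbox (prow rw p) n w" using w by (auto simp: seqbox_def seqs_def prow_def w'_def)
  moreover have "seqbox (prow rw p) m w' \<subseteq> {w. (\<lambda>k. fst (w k)) \<in> D}"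
  proof
    fix v assume "v \<in> seqbox (prow rw p) m w'"
    then have "(\<lambda>k. fst (v k)) \<in> seqbox (\<lambda>_. UNIV) m z'" using z' by (simp add: seqbox_def seqs_def)
    then show "v \<in> {w. (\<lambda>k. fst (w k)) \<in> D}" using m(3) by blast
  qed
  ultimately show "\<exists>m z'. n \<le> m \<and> z' \<in> seqbox (prow rw p) n w \<and>
      seqbox (prow rw p) m z' \<subseteq> {w. (\<lambda>k. fst (w k)) \<in> D}" using m(1) by blast
qed

lemma dense_below_differ:
  assumes "\<And>n. \<exists>k\<ge>n. rw k = p"
  shows "dense_below (prow rw p) n0 w0 {w. \<exists>k. rw k = p \<and> fst (w k) \<noteq> snd (w k)}"
  unfolding dense_below_def
proof (intro allI impI)
  fix n w assume w: "w \<in> seqbox (prow rw p) n0 w0"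
  obtain k where k: "n \<le> k" "rw k = p" using assms by blast
  let ?w = "w(k := (True, False))"
  have "?w \<in> seqbox (prow rw p) n w" using w k by (auto simp: seqbox_def seqs_def prow_def)
  moreover have "seqbox (prow rw p) (Suc k) ?w \<subseteq> {w. \<exists>k. rw k = p \<and> fst (w k) \<noteq> snd (w k)}"
  proof
    fix v assume "v \<in> seqbox (prow rw p) (Suc k) ?w"
    then have "v k = (True, False)" by (simp add: seqbox_def)
    then show "v \<in> {w. \<exists>k. rw k = p \<and> fst (w k) \<noteq> snd (w k)}" using k(2) by force
  qed
  ultimately show "\<exists>m z'. n \<le> m \<and> z' \<in> seqbox (prow rw p) n w \<and>
      seqbox (prow rw p) m z' \<subseteq> {w. \<exists>k. rw k = p \<and> fst (w k) \<noteq> snd (w k)}"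
    using k(1) by (intro exI[of _ "Suc k"] exI[of _ ?w]) simp
qed

text \<open>Distinct points of \<open>T\<close> lie in distinct members of the countable family of
  classes that exhausts their \<open>E\<close>-class.\<close>

lemma countable_index_countable:
  assumes F: "equiv UNIV F" and idx: "countable_index_on E F B"
    and T: "T \<subseteq> B" "\<And>x y. x \<in> T \<Longrightarrow> y \<in> T \<Longrightarrow> (x, y) \<in> E"
      "\<And>x y. x \<in> T \<Longrightarrow> y \<in> T \<Longrightarrow> x \<noteq> y \<Longrightarrow> (x, y) \<notin> F"
  shows "countable T"
proof (cases "T = {}")
  case False
  then obtain x where x: "x \<in> T" by blast
  let ?C = "rel_restrict E B `` {x}"
  have "?C \<in> B // rel_restrict E B" using x T(1) by (intro quotientI) blast
  with idx have "\<exists>\<D>. countable \<D> \<and> \<D> \<subseteq> B // rel_restrict F B \<and> ?C = \<Union>\<D>"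
    unfolding countable_index_on_def by (rule bspec)
  then obtain \<D> where D: "countable \<D>" "\<D> \<subseteq> B // rel_restrict F B" "?C = \<Union>\<D>" by (elim exE conjE)
  have "\<exists>d. d \<in> \<D> \<and> y \<in> d" if "y \<in> T" for y
  proof -
    have "y \<in> ?C" using that x T(1,2) by (auto simp: rel_restrict_def)
    then show ?thesis using D(3) by blast
  qed
  then obtain d where d: "\<And>y. y \<in> T \<Longrightarrow> d y \<in> \<D> \<and> y \<in> d y" by metis
  have "inj_on d T"
  proof (rule inj_onI, rule ccontr)
    fix y y' assume y: "y \<in> T" "y' \<in> T" "d y = d y'" "y \<noteq> y'"
    obtain b where "d y = rel_restrict F B `` {b}" using d[OF y(1)] D(2) by (meson quotientE subsetD)
    then have "(b, y) \<in> F" "(b, y') \<in> F" using d[OF y(1)] d[OF y(2)] y(3) by (auto simp: rel_restrict_def)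
    then have "(y, y') \<in> F" using F by (meson equiv_def symD transD)
    then show False using T(3) y by blast
  qed
  moreover have "countable (d ` T)" using d D(1) by (intro countable_subset[of "d ` T" \<D>]) auto
  ultimately show ?thesis using countable_image_inj_on by blast
qed simp

theorem no_homomorphism_with_cover:
  fixes E :: "('a::polish_space \<times> 'a) set" and \<phi> :: "(nat \<Rightarrow> nat \<Rightarrow> bool) \<Rightarrow> 'a"
  assumes En: "\<And>n. equiv UNIV (En n)"
    and B: "(\<Union>n. B n) = UNIV" "\<And>n. B n \<in> sets borel" "\<And>n. countable_index_on E (En n) (B n)"
    and \<phi>: "continuous_on UNIV \<phi>" "\<And>n. rel_homomorphism (EE1 - F0 n) (E - (\<Union>i\<le>n. En i)) \<phi>"
    and E: "equiv UNIV E"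
  shows False
proof -
  \<comment> \<open>The pairing function arranges a binary sequence in rows, so that category
    arguments run on Cantor space with \<open>rw k\<close> as the row of coordinate
    \<open>k\<close>.\<close>
  define dec where "dec x r m = x (prod_encode (r, m))" for x :: "nat \<Rightarrow> bool" and r m
  define rw where "rw k = fst (prod_decode k)" for k
  have "continuous_on UNIV dec" unfolding dec_def[abs_def]
    by (intro continuous_on_coordinatewise_then_product continuous_on_coord)
  then have "continuous_on UNIV (\<phi> \<circ> dec)"
    by (rule continuous_on_compose) (rule continuous_on_subset[OF \<phi>(1)], simp)
  then have m: "\<phi> \<circ> dec \<in> borel_measurable borel" by (rule borel_measurable_continuous_onI)
  have V: "{x. \<phi> (dec x) \<in> B n} \<in> sets borel" for n
    using measurable_sets[OF m B(2)[of n]] by (simp add: vimage_def)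
  let ?S = "\<lambda>_ :: nat. UNIV :: bool set"
  have "\<forall>n. \<exists>U D. box_open ?S U \<and> (\<forall>i::nat. \<forall>z0. dense_below ?S 0 z0 (D i)) \<and>
    (\<forall>z\<in>seqs ?S. (\<forall>i. z \<in> D i) \<longrightarrow> (z \<in> {x. \<phi> (dec x) \<in> B n} \<longleftrightarrow> z \<in> U))"
    using borel_baire_property[OF V] by blast
  then obtain U D where UD: "\<And>n. box_open ?S (U n)" "\<And>n i z0. dense_below ?S 0 z0 (D n i)"
    "\<And>n z. z \<in> seqs ?S \<Longrightarrow> (\<And>i::nat. z \<in> D n i) \<Longrightarrow> \<phi> (dec z) \<in> B n \<longleftrightarrow> z \<in> U n" by (metis mem_Collect_eq)
  have sS: "z \<in> seqs ?S" for z by (simp add: seqs_def)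
  have "\<exists>z\<in>seqbox ?S 0 (\<lambda>_. False). \<forall>i. z \<in> (case prod_decode i of (n, i') \<Rightarrow> D n i')"
    by (rule dense_below_baire) (use UD(2) sS in \<open>auto split: prod.splits\<close>)
  \<comment> \<open>\<open>u\<close> is generic for the preimages of all the sets \<open>B n\<close>
    at once, so one that contains \<open>u\<close> is comeager in a box around
    \<open>u\<close>.\<close>
  then obtain u where u: "\<And>i. u \<in> (case prod_decode i of (n, i') \<Rightarrow> D n i')" by blast
  have uD: "u \<in> D n i" for n i using u[of "prod_encode (n, i)"] by simp
  obtain n where n: "\<phi> (dec u) \<in> B n" using B(1) by blast
  then have "u \<in> U n" using UD(3)[OF sS uD] by blast
  then obtain n0 where n0: "seqbox ?S n0 u \<subseteq> U n" using UD(1)[of n] sS unfolding box_open_def by blast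
  \<comment> \<open>Requirement \<open>0\<close> makes a pair differ in row \<open>n\<close>. The
    others keep its first component generic, so that membership of the image in \<open>B n\<close>
    is decided by the box.\<close>
  define DD where "DD i = (case i of 0 \<Rightarrow> {w. \<exists>k. rw k = n \<and> fst (w k) \<noteq> snd (w k)}
     | Suc i \<Rightarrow> {w :: nat \<Rightarrow> bool \<times> bool. (\<lambda>k. fst (w k)) \<in> D n i})" for i
  have dd: "dense_below (prow rw p) n0 (\<lambda>k. (u k, u k)) (DD i)" if p: "p \<in> {n}" for p i
  proof (cases i)
    case 0
    have "\<exists>k\<ge>m. rw k = n" for m
      by (rule exI[of _ "prod_encode (n, m)"]) (simp add: rw_def le_prod_encode_2)
    from dense_below_differ[of rw n, OF this] show ?thesis using 0 p by (simp add: DD_def)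
  next
    case (Suc i')
    show ?thesis unfolding DD_def Suc nat.case by (rule dense_below_fst[OF UD(2)])
  qed
  obtain \<rho> :: "(nat \<Rightarrow> nat \<Rightarrow> bool) \<Rightarrow> nat \<Rightarrow> bool" where
    \<rho>: "(\<forall>X k. k < n0 \<longrightarrow> \<rho> X k = u k) \<and> (\<forall>k X Y. agree (Suc k) (rw k) X Y \<longrightarrow> \<rho> X k = \<rho> Y k) \<and>
      (\<forall>p X Y i. p \<in> {n} \<longrightarrow> (\<forall>r>p. X r = Y r) \<longrightarrow> X p \<noteq> Y p \<longrightarrow> (\<lambda>k. (\<rho> X k, \<rho> Y k)) \<in> DD i)"
    using mycielski_rows[of "{n}" rw n0 u "\<lambda>_. DD", OF dd] by (rule exE)
  define X where "X \<xi> r = (if r = n then \<xi> else (\<lambda>_. False))" for \<xi> :: "nat \<Rightarrow> bool" and r :: nat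
  define y where "y \<xi> = \<phi> (dec (\<rho> (X \<xi>)))" for \<xi>
  have all: "(\<lambda>k. (\<rho> (X \<xi>) k, \<rho> (X \<xi>') k)) \<in> DD i" if "\<xi> \<noteq> \<xi>'" for \<xi> \<xi>' i
    using \<rho> that by (simp add: X_def)
  have yB: "y \<xi> \<in> B n" for \<xi>
  proof -
    \<comment> \<open>The requirements speak of pairs, so some partner different from \<xi> has to
      be named; only the first component matters here.\<close>
    have "\<xi> \<noteq> (\<lambda>m. \<not> \<xi> m)" by (metis (full_types))
    from all[OF this, of "Suc i" for i] have "\<rho> (X \<xi>) \<in> D n i" for i by (simp add: DD_def)
    then have "y \<xi> \<in> B n \<longleftrightarrow> \<rho> (X \<xi>) \<in> U n" unfolding y_def by (intro UD(3) sS)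
    moreover have "\<rho> (X \<xi>) \<in> seqbox ?S n0 u" using \<rho> sS by (simp add: seqbox_def)
    ultimately show ?thesis using n0 by blast
  qed
  have rel: "(y \<xi>, y \<xi>') \<in> E - En n" if neq: "\<xi> \<noteq> \<xi>'" for \<xi> \<xi>'
  proof -
    have eq: "\<rho> (X \<xi>) k = \<rho> (X \<xi>') k" if "n < rw k" for k
    proof -
      have "agree (Suc k) (rw k) (X \<xi>) (X \<xi>')" using that by (simp add: agree_def X_def)
      then show ?thesis using \<rho> by blast
    qed
    have "dec (\<rho> (X \<xi>)) r = dec (\<rho> (X \<xi>')) r" if "n < r" for r
      using that by (simp add: dec_def[abs_def] eq rw_def)
    then have "(dec (\<rho> (X \<xi>)), dec (\<rho> (X \<xi>'))) \<in> EE1"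
      unfolding EE1_def F0_def by (intro UN_I[of "Suc n"]) auto
    moreover obtain k where k: "rw k = n" "\<rho> (X \<xi>) k \<noteq> \<rho> (X \<xi>') k"
      using all[OF neq, of 0] by (auto simp: DD_def)
    have "dec (\<rho> (X \<xi>)) n \<noteq> dec (\<rho> (X \<xi>')) n"
    proof
      assume "dec (\<rho> (X \<xi>)) n = dec (\<rho> (X \<xi>')) n"
      then have "dec (\<rho> (X \<xi>)) n (snd (prod_decode k)) = dec (\<rho> (X \<xi>')) n (snd (prod_decode k))" by simp
      moreover have "prod_encode (n, snd (prod_decode k)) = k"
        using k(1) unfolding rw_def by (metis prod.collapse prod_decode_inverse)
      ultimately show False using k(2) by (simp add: dec_def)
    qed
    then have "(dec (\<rho> (X \<xi>)), dec (\<rho> (X \<xi>'))) \<notin> F0 n" by (auto simp: F0_def)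
    ultimately have "(dec (\<rho> (X \<xi>)), dec (\<rho> (X \<xi>'))) \<in> EE1 - F0 n" by simp
    then have "map_prod \<phi> \<phi> (dec (\<rho> (X \<xi>)), dec (\<rho> (X \<xi>'))) \<in> E - (\<Union>i\<le>n. En i)"
      using \<phi>(2)[of n] unfolding rel_homomorphism_def by blast
    then show ?thesis by (simp add: y_def)
  qed
  have reflE: "(x, x) \<in> E" for x using E by (meson UNIV_I equiv_def refl_onD)
  have reflF: "(x, x) \<in> En n" for x using En[of n] by (meson UNIV_I equiv_def refl_onD)
  have "inj y"
  proof (rule injI, rule ccontr)
    fix \<xi> \<xi>' assume "y \<xi> = y \<xi>'" "\<xi> \<noteq> \<xi>'"
    then show False using rel[of \<xi> \<xi>'] reflF by simp
  qed
  moreover have "countable (range y)"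
  proof (rule countable_index_countable[OF En B(3)])
    show "range y \<subseteq> B n" using yB by blast
    fix a b assume ab: "a \<in> range y" "b \<in> range y"
    then obtain \<xi> \<xi>' where x: "a = y \<xi>" "b = y \<xi>'" by blast
    show "(a, b) \<in> E" using rel[of \<xi> \<xi>'] reflE x by (cases "\<xi> = \<xi>'") auto
    show "(a, b) \<notin> En n" if "a \<noteq> b" using rel[of \<xi> \<xi>'] x that by (cases "\<xi> = \<xi>'") auto
  qed
  ultimately show False using uncountable_cantor countable_image_inj_on by blast
qed

theorem theorem6p2:
  fixes E :: "('a::polish_space \<times> 'a) set"
    and En :: "nat \<Rightarrow> ('a \<times> 'a) set"
  assumes E_equiv: "equiv UNIV E"
    and E_analytic: "analytic_set E"
    and En_equiv: "\<And>n. equiv UNIV (En n)"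
    and En_sub: "\<And>n. En n \<subseteq> E"
    and En_borel: "\<And>n. En n \<in> sets borel"
  defines "alt1 \<equiv> \<exists>B :: nat \<Rightarrow> 'a set. (\<Union>n. B n) = UNIV \<and>
      (\<forall>n. B n \<in> sets borel \<and> invariant_set (En n) (B n) \<and> countable_index_on E (En n) (B n))"
    and "alt2 \<equiv> \<exists>\<phi> :: (nat \<Rightarrow> nat \<Rightarrow> bool) \<Rightarrow> 'a. continuous_on UNIV \<phi> \<and>
      (\<forall>n. rel_homomorphism (EE1 - F0 n) (E - (\<Union>i\<le>n. En i)) \<phi>)"
  shows "(alt1 \<or> alt2) \<and> \<not> (alt1 \<and> alt2)"
proof
  show "alt1 \<or> alt2"
  proof (cases "null E En UNIV")
    case True
    from countable_cover_of_null[OF E_equiv En_equiv En_sub this]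
    show ?thesis unfolding alt1_def by (rule disjI1)
  next
    case False
    obtain D0 g0 where D0: "closed (D0 :: (nat \<Rightarrow> nat) set)" "continuous_on D0 g0" "g0 ` D0 = (UNIV :: 'a set)"
      using analytic_UNIV_polish by (rule analytic_setE)
    obtain C f where C: "closed (C :: (nat \<Rightarrow> nat) set)" "continuous_on C f" "f ` C = E"
      using E_analytic by (rule analytic_setE)
    obtain DR gR where DR: "\<forall>i. closed (DR i :: (nat \<Rightarrow> nat) set) \<and> continuous_on (DR i) (gR i) \<and> gR i ` DR i = - En i"
      using borel_complement_codes[of En, OF En_borel] by (elim exE)
    obtain rw :: "nat \<Rightarrow> nat" and sq :: "nat \<Rightarrow> nat \<Rightarrow> bool" where rw: "\<forall>k. rw k \<le> k"
      "\<forall>p n x. \<exists>k\<ge>n. rw k = p \<and> (\<forall>i<n. sq k i = x i)"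
      using rows_exist by (elim exE conjE)
    interpret paths E En D0 g0 C f DR gR rw sq
      by unfold_locales (use E_equiv E_analytic En_equiv En_borel En_sub D0 C DR rw in auto)
    show ?thesis unfolding alt2_def using homomorphism_of_not_null[OF False] by (rule disjI2)
  qed
  show "\<not> (alt1 \<and> alt2)"
  proof
    assume "alt1 \<and> alt2"
    then obtain B :: "nat \<Rightarrow> 'a set" and \<phi> :: "(nat \<Rightarrow> nat \<Rightarrow> bool) \<Rightarrow> 'a" where
      both: "(\<Union>n. B n) = UNIV" "\<forall>n. B n \<in> sets borel \<and> invariant_set (En n) (B n) \<and> countable_index_on E (En n) (B n)"
      "continuous_on UNIV \<phi>" "\<forall>n. rel_homomorphism (EE1 - F0 n) (E - (\<Union>i\<le>n. En i)) \<phi>"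
      unfolding alt1_def alt2_def by blast
    show False
      by (rule no_homomorphism_with_cover[OF En_equiv, where B = B and \<phi> = \<phi>, OF _ _ _ _ _ E_equiv]) (use both in auto)
  qed
qed

end
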